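(* Let $k$ be a field of characteristic zero, let $H$ be a finite-dimensional Hopf algebra over $k$, and let $\alpha:H\times H\to k$ be a normalized convolution-invertible two-cocycle. Let $\mathcal K_H^{\alpha}$ be the field of fractions of the integral domain $\mathcal B_H^{\alpha}$. If the algebra ${}^{\alpha}H$ is simple, then so is the algebra $\mathcal K_H^{\alpha}\otimes_{\mathcal B_H^{\alpha}}\mathcal A_H^{\alpha}$.
   Context: All algebras are associative unital $k$-algebras; unadorned tensor products are over $k$; $\Delta$, $\varepsilon$ are the comultiplication and counit of $H$, with Sweedler notation. Cocycles and twisted algebras: let $R$ be a commutative algebra. A two-cocycle with values in $R$ is a bilinear map $\alpha:H\times H\to R$ with $\sum\alpha(x_{(1)},y_{(1)})\alpha(x_{(2)}y_{(2)},z)=\sum\alpha(y_{(1)},z_{(1)})\alpha(x,y_{(2)}z_{(2)})$ for all $x,y,z\in H$; it is normalized if $\alpha(x,1)=\alpha(1,x)=\varepsilon(x)1$, and convolution-invertible if it is invertible for convolution in $\operatorname{Hom}(H\otimes H,R)$. The twisted algebra $R\otimes{}^{\alpha}H$ is $R\otimes H$ with product $(b\otimes x)\cdot_\alpha(c\otimes y)=\sum bc\,\alpha(x_{(1)},y_{(1)})\otimes x_{(2)}y_{(2)}$. For $R=k$ write ${}^{\alpha}H=k\otimes{}^{\alpha}H$. Universal cocycle: let $t_H$ be a copy of the vector space $H$ (with identity map $h\mapsto t_h$), $S(t_H)$ its symmetric algebra, $K_H$ the field of fractions of $S(t_H)$. Let $t^{-1}:H\to K_H$, $h\mapsto t_h^{-1}$,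 be the unique linear map with $\sum t_{h_{(1)}}t^{-1}_{h_{(2)}}=\sum t^{-1}_{h_{(1)}}t_{h_{(2)}}=\varepsilon(h)1$ for all $h\in H$ (it exists; note that $t^{-1}_h$ is in general not $1/t_h$). Define $\sigma:H\times H\to K_H$ by $\sigma(x,y)=\sum t_{x_{(1)}}t_{y_{(1)}}\alpha(x_{(2)},y_{(2)})t^{-1}_{x_{(3)}y_{(3)}}$; it is a convolution-invertible two-cocycle with convolution inverse $\sigma^{-1}(x,y)=\sum t_{x_{(1)}y_{(1)}}\alpha^{-1}(x_{(2)},y_{(2)})t^{-1}_{x_{(3)}}t^{-1}_{y_{(3)}}$. $\mathcal B_H^{\alpha}$ is the subalgebra of $K_H$ generated by all values of $\sigma$ and $\sigma^{-1}$, and $\mathcal A_H^{\alpha}=\mathcal B_H^{\alpha}\otimes{}^{\sigma}H$ is the corresponding twisted algebra, which is associative with unit $t_1^{-1}\otimes1$ and is a $\mathcal B_H^{\alpha}$-algebra. *)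

theory Defs
  imports
    "HOL-Algebra.Algebra"
    "HOL-Algebra.Algebraic_Closure_Type"
    "HOL-Library.Poly_Mapping"
begin

section \<open>Algebras on subsets of a type\<close>

definition algebra_on :: "('r \<Rightarrow> 'a \<Rightarrow> 'a) \<Rightarrow> 'a::ring_1 set \<Rightarrow> ('r, 'a) module" where
  "algebra_on s C =
     \<lparr>carrier = C, monoid.mult = (*), one = 1, ring.zero = 0, add = (+), module.smult = s\<rparr>"

definition simple_algebra :: "('a, 'm) ring_scheme \<Rightarrow> bool" where
  "simple_algebra A \<longleftrightarrow>
     ring A \<and> carrier A \<noteq> {\<zero>\<^bsub>A\<^esub>} \<and> (\<forall>I. ideal I A \<longrightarrow> I = {\<zero>\<^bsub>A\<^esub>} \<or> I = carrier A)"

definition generated_subalgebra :: "('r \<Rightarrow> 'a \<Rightarrow> 'a) \<Rightarrow> 'a::ring_1 set \<Rightarrow> 'a set" where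
  "generated_subalgebra s G =
     (\<lambda>C. 1 \<in> C \<and> (\<forall>c. \<forall>x\<in>C. s c x \<in> C) \<and>
          (\<forall>x\<in>C. \<forall>y\<in>C. x + y \<in> C) \<and> (\<forall>x\<in>C. \<forall>y\<in>C. x * y \<in> C)) hull G"


section \<open>Tensor products\<close>

text \<open>
  \<open>M \<otimes>\<^sub>R N\<close> is the free abelian group on \<open>carrier M \<times> carrier N\<close> modulo the subgroup
  generated by the relations below. Its elements are cosets, and the group is written
  multiplicatively.
\<close>

definition tensor_relations ::
  "('r, 'm) ring_scheme \<Rightarrow> ('r, 'a) module \<Rightarrow> ('r, 'b) module \<Rightarrow> ('a \<times> 'b \<Rightarrow>\<^sub>0 int) set" where
  "tensor_relations R M N =
     {frag_of (x \<oplus>\<^bsub>M\<^esub> x', y) - frag_of (x, y) - frag_of (x', y) | x x' y.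
        x \<in> carrier M \<and> x' \<in> carrier M \<and> y \<in> carrier N} \<union>
     {frag_of (x, y \<oplus>\<^bsub>N\<^esub> y') - frag_of (x, y) - frag_of (x, y') | x y y'.
        x \<in> carrier M \<and> y \<in> carrier N \<and> y' \<in> carrier N} \<union>
     {frag_of (r \<odot>\<^bsub>M\<^esub> x, y) - frag_of (x, r \<odot>\<^bsub>N\<^esub> y) | r x y.
        r \<in> carrier R \<and> x \<in> carrier M \<and> y \<in> carrier N}"

definition tensor_subgroup ::
  "('r, 'm) ring_scheme \<Rightarrow> ('r, 'a) module \<Rightarrow> ('r, 'b) module \<Rightarrow> ('a \<times> 'b \<Rightarrow>\<^sub>0 int) set" where
  "tensor_subgroup R M N =
     generate (free_Abelian_group (carrier M \<times> carrier N)) (tensor_relations R M N)"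

definition tensor_group ::
  "('r, 'm) ring_scheme \<Rightarrow> ('r, 'a) module \<Rightarrow> ('r, 'b) module \<Rightarrow> ('a \<times> 'b \<Rightarrow>\<^sub>0 int) set monoid" where
  "tensor_group R M N =
     free_Abelian_group (carrier M \<times> carrier N) Mod tensor_subgroup R M N"

definition pure_tensor ::
  "('r, 'm) ring_scheme \<Rightarrow> ('r, 'a) module \<Rightarrow> ('r, 'b) module \<Rightarrow> 'a \<Rightarrow> 'b
     \<Rightarrow> ('a \<times> 'b \<Rightarrow>\<^sub>0 int) set" where
  "pure_tensor R M N x y =
     tensor_subgroup R M N #>\<^bsub>free_Abelian_group (carrier M \<times> carrier N)\<^esub> frag_of (x, y)"

text \<open>
  The value at the tensor \<open>u\<close> of the homomorphism into the abelian group \<open>G\<close> (written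
  multiplicatively) that sends \<open>x \<otimes> y\<close> to \<open>f x y\<close>. It is computed on a representative of the
  coset \<open>u\<close>, and does not depend on it when \<open>f\<close> is biadditive and balanced; the definition is
  used for such \<open>f\<close> only.
\<close>
definition tensor_lift ::
  "('c, 'm) monoid_scheme \<Rightarrow> ('a \<Rightarrow> 'b \<Rightarrow> 'c) \<Rightarrow> ('a \<times> 'b \<Rightarrow>\<^sub>0 int) set \<Rightarrow> 'c" where
  "tensor_lift G f u =
     (let p = (SOME p. p \<in> u)
      in finprod G (\<lambda>(x, y). f x y [^]\<^bsub>G\<^esub> Poly_Mapping.lookup p (x, y)) (Poly_Mapping.keys p))"

definition tensor_sum :: "('a \<Rightarrow> 'b \<Rightarrow> 'c::ring_1) \<Rightarrow> ('a \<times> 'b \<Rightarrow>\<^sub>0 int) set \<Rightarrow> 'c" where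
  "tensor_sum f u = tensor_lift (add_monoid (ring_of_type_algebra :: 'c ring)) f u"

definition tensor_algebra ::
  "('r, 'm) ring_scheme \<Rightarrow> ('r, 'a) module \<Rightarrow> ('r, 'b) module
     \<Rightarrow> ('r, ('a \<times> 'b \<Rightarrow>\<^sub>0 int) set) module" where
  "tensor_algebra R M N =
     (let T = tensor_group R M N; pt = pure_tensor R M N in
      \<lparr>carrier = carrier T,
       monoid.mult = (\<lambda>u v. tensor_lift T (\<lambda>x y. tensor_lift T (\<lambda>x' y'.
                        pt (x \<otimes>\<^bsub>M\<^esub> x') (y \<otimes>\<^bsub>N\<^esub> y')) v) u),
       one = pt \<one>\<^bsub>M\<^esub> \<one>\<^bsub>N\<^esub>,
       ring.zero = \<one>\<^bsub>T\<^esub>,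
       add = monoid.mult T,
       module.smult = (\<lambda>r. tensor_lift T (\<lambda>x y. pt (r \<odot>\<^bsub>M\<^esub> x) y))\<rparr>)"


section \<open>Hopf algebras\<close>

text \<open>The ground field is the type \<open>'k\<close>, and \<open>H\<close> is the ring \<open>'h\<close> with the scalar
  multiplication \<open>scale\<close>.\<close>

type_synonym 'h tensor_square = "('h \<times> 'h \<Rightarrow>\<^sub>0 int) set"

abbreviation ground_ring :: "'k::ring_1 ring" where
  "ground_ring \<equiv> ring_of_type_algebra"

abbreviation HH :: "('k::field \<Rightarrow> 'h \<Rightarrow> 'h) \<Rightarrow> ('k, ('h::ring_1) tensor_square) module" where
  "HH scale \<equiv> tensor_algebra ground_ring (algebra_on scale UNIV) (algebra_on scale UNIV)"

abbreviation HHH ::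
  "('k::field \<Rightarrow> 'h \<Rightarrow> 'h) \<Rightarrow> ('k, ('h::ring_1 \<times> 'h tensor_square \<Rightarrow>\<^sub>0 int) set) module" where
  "HHH scale \<equiv> tensor_algebra ground_ring (algebra_on scale UNIV) (HH scale)"

abbreviation pure2 ::
  "('k::field \<Rightarrow> 'h \<Rightarrow> 'h) \<Rightarrow> 'h \<Rightarrow> 'h \<Rightarrow> ('h::ring_1) tensor_square" where
  "pure2 scale \<equiv> pure_tensor ground_ring (algebra_on scale UNIV) (algebra_on scale UNIV)"

abbreviation pure3 ::
  "('k::field \<Rightarrow> 'h \<Rightarrow> 'h) \<Rightarrow> 'h \<Rightarrow> ('h::ring_1) tensor_square
     \<Rightarrow> ('h \<times> 'h tensor_square \<Rightarrow>\<^sub>0 int) set" where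
  "pure3 scale \<equiv> pure_tensor ground_ring (algebra_on scale UNIV) (HH scale)"

text \<open>Coassociativity compares both sides in \<open>H \<otimes> (H \<otimes> H)\<close>.\<close>
locale hopf_algebra = vector_space scale
  for scale :: "'k::field \<Rightarrow> 'h::ring_1 \<Rightarrow> 'h" +
  fixes \<Delta> :: "'h \<Rightarrow> 'h tensor_square"
    and \<epsilon> :: "'h \<Rightarrow> 'k"
    and antipode :: "'h \<Rightarrow> 'h"
  assumes scale_mult_left: "scale a x * y = scale a (x * y)"
    and scale_mult_right: "x * scale a y = scale a (x * y)"
    and comult_ring_hom: "\<Delta> \<in> ring_hom ring_of_type_algebra (HH scale)"
    and comult_scale: "\<Delta> (scale a x) = a \<odot>\<^bsub>HH scale\<^esub> \<Delta> x"
    and counit_linear: "Vector_Spaces.linear scale (*) \<epsilon>"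
    and counit_mult: "\<epsilon> (x * y) = \<epsilon> x * \<epsilon> y"
    and counit_one: "\<epsilon> 1 = 1"
    and coassoc:
      "tensor_lift (add_monoid (HHH scale))
         (\<lambda>x' x3. tensor_lift (add_monoid (HHH scale)) (\<lambda>x1 x2. pure3 scale x1 (pure2 scale x2 x3)) (\<Delta> x'))
         (\<Delta> x)
       = tensor_lift (add_monoid (HHH scale)) (\<lambda>x1 x'. pure3 scale x1 (\<Delta> x')) (\<Delta> x)"
    and counit_left: "tensor_sum (\<lambda>x1 x2. scale (\<epsilon> x1) x2) (\<Delta> x) = x"
    and counit_right: "tensor_sum (\<lambda>x1 x2. scale (\<epsilon> x2) x1) (\<Delta> x) = x"
    and antipode_linear: "Vector_Spaces.linear scale scale antipode"
    and antipode_left: "tensor_sum (\<lambda>x1 x2. antipode x1 * x2) (\<Delta> x) = scale (\<epsilon> x) 1"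
    and antipode_right: "tensor_sum (\<lambda>x1 x2. x1 * antipode x2) (\<Delta> x) = scale (\<epsilon> x) 1"

definition finite_dimensional :: "('k::field \<Rightarrow> 'h \<Rightarrow> 'h::ab_group_add) \<Rightarrow> bool" where
  "finite_dimensional scale \<longleftrightarrow> (\<exists>E. finite E \<and> module.span scale E = UNIV)"

definition sweedler2 ::
  "('h \<Rightarrow> 'h tensor_square) \<Rightarrow> ('h \<Rightarrow> 'h \<Rightarrow> 'c::ring_1) \<Rightarrow> 'h \<Rightarrow> 'c" where
  "sweedler2 \<Delta> f x = tensor_sum f (\<Delta> x)"

definition sweedler3 ::
  "('h \<Rightarrow> 'h tensor_square) \<Rightarrow> ('h \<Rightarrow> 'h \<Rightarrow> 'h \<Rightarrow> 'c::ring_1) \<Rightarrow> 'h \<Rightarrow> 'c" where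
  "sweedler3 \<Delta> f x = sweedler2 \<Delta> (\<lambda>x1 x'. sweedler2 \<Delta> (\<lambda>x2 x3. f x1 x2 x3) x') x"


section \<open>Two-cocycles and twisted algebras\<close>

definition bilinear_form ::
  "('k::field \<Rightarrow> 'h \<Rightarrow> 'h::ab_group_add) \<Rightarrow> ('h \<Rightarrow> 'h \<Rightarrow> 'k) \<Rightarrow> bool" where
  "bilinear_form scale \<alpha> \<longleftrightarrow>
     (\<forall>x. Vector_Spaces.linear scale (*) (\<lambda>y. \<alpha> x y)) \<and>
     (\<forall>y. Vector_Spaces.linear scale (*) (\<lambda>x. \<alpha> x y))"

definition two_cocycle ::
  "('k::field \<Rightarrow> 'h \<Rightarrow> 'h) \<Rightarrow> ('h::ring_1 \<Rightarrow> 'h tensor_square) \<Rightarrow> ('h \<Rightarrow> 'h \<Rightarrow> 'k) \<Rightarrow> bool" where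
  "two_cocycle scale \<Delta> \<alpha> \<longleftrightarrow>
     bilinear_form scale \<alpha> \<and>
     (\<forall>x y z.
        sweedler2 \<Delta> (\<lambda>x1 x2. sweedler2 \<Delta> (\<lambda>y1 y2. \<alpha> x1 y1 * \<alpha> (x2 * y2) z) y) x =
        sweedler2 \<Delta> (\<lambda>y1 y2. sweedler2 \<Delta> (\<lambda>z1 z2. \<alpha> y1 z1 * \<alpha> x (y2 * z2)) z) y)"

definition normalized :: "('h \<Rightarrow> 'k::field) \<Rightarrow> ('h::ring_1 \<Rightarrow> 'h \<Rightarrow> 'k) \<Rightarrow> bool" where
  "normalized \<epsilon> \<alpha> \<longleftrightarrow> (\<forall>x. \<alpha> x 1 = \<epsilon> x \<and> \<alpha> 1 x = \<epsilon> x)"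

definition is_convolution_inverse ::
  "('k::field \<Rightarrow> 'h \<Rightarrow> 'h) \<Rightarrow> ('h::ring_1 \<Rightarrow> 'h tensor_square) \<Rightarrow> ('h \<Rightarrow> 'k)
     \<Rightarrow> ('h \<Rightarrow> 'h \<Rightarrow> 'k) \<Rightarrow> ('h \<Rightarrow> 'h \<Rightarrow> 'k) \<Rightarrow> bool" where
  "is_convolution_inverse scale \<Delta> \<epsilon> \<alpha> \<beta> \<longleftrightarrow>
     bilinear_form scale \<beta> \<and>
     (\<forall>x y.
        sweedler2 \<Delta> (\<lambda>x1 x2. sweedler2 \<Delta> (\<lambda>y1 y2. \<alpha> x1 y1 * \<beta> x2 y2) y) x = \<epsilon> x * \<epsilon> y \<and>
        sweedler2 \<Delta> (\<lambda>x1 x2. sweedler2 \<Delta> (\<lambda>y1 y2. \<beta> x1 y1 * \<alpha> x2 y2) y) x = \<epsilon> x * \<epsilon> y)"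

definition convolution_invertible ::
  "('k::field \<Rightarrow> 'h \<Rightarrow> 'h) \<Rightarrow> ('h::ring_1 \<Rightarrow> 'h tensor_square) \<Rightarrow> ('h \<Rightarrow> 'k)
     \<Rightarrow> ('h \<Rightarrow> 'h \<Rightarrow> 'k) \<Rightarrow> bool" where
  "convolution_invertible scale \<Delta> \<epsilon> \<alpha> \<longleftrightarrow> (\<exists>\<beta>. is_convolution_inverse scale \<Delta> \<epsilon> \<alpha> \<beta>)"

definition convolution_inverse ::
  "('k::field \<Rightarrow> 'h \<Rightarrow> 'h) \<Rightarrow> ('h::ring_1 \<Rightarrow> 'h tensor_square) \<Rightarrow> ('h \<Rightarrow> 'k)
     \<Rightarrow> ('h \<Rightarrow> 'h \<Rightarrow> 'k) \<Rightarrow> ('h \<Rightarrow> 'h \<Rightarrow> 'k)" where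
  "convolution_inverse scale \<Delta> \<epsilon> \<alpha> = (THE \<beta>. is_convolution_inverse scale \<Delta> \<epsilon> \<alpha> \<beta>)"

text \<open>
  The twisted algebra \<open>R \<otimes> \<^sup>\<alpha>H\<close>, as an \<open>R\<close>-algebra, for a commutative algebra \<open>R\<close> over the ground
  field and a cocycle \<open>\<alpha>\<close> with values in \<open>R\<close>. Its unit is \<open>\<alpha>(1,1)\<^sup>-\<^sup>1 \<otimes> 1\<close>; the element
  \<open>\<alpha>(1,1)\<^sup>-\<^sup>1\<close> of \<open>R\<close> is the argument \<open>e\<close>.
\<close>
definition twisted_algebra ::
  "('k::field \<Rightarrow> 'h \<Rightarrow> 'h) \<Rightarrow> ('h::ring_1 \<Rightarrow> 'h tensor_square) \<Rightarrow> ('k, 'r) module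
     \<Rightarrow> ('h \<Rightarrow> 'h \<Rightarrow> 'r) \<Rightarrow> 'r \<Rightarrow> ('r, ('r \<times> 'h \<Rightarrow>\<^sub>0 int) set) module" where
  "twisted_algebra scale \<Delta> R \<alpha> e =
     (let T = tensor_group ground_ring R (algebra_on scale UNIV);
          pt = pure_tensor ground_ring R (algebra_on scale UNIV) in
      \<lparr>carrier = carrier T,
       monoid.mult = (\<lambda>u v.
         tensor_lift T (\<lambda>b x. tensor_lift T (\<lambda>c y.
           tensor_lift T (\<lambda>x1 x2. tensor_lift T (\<lambda>y1 y2.
             pt (b \<otimes>\<^bsub>R\<^esub> c \<otimes>\<^bsub>R\<^esub> \<alpha> x1 y1) (x2 * y2)) (\<Delta> y)) (\<Delta> x)) v) u),
       one = pt e 1,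
       ring.zero = \<one>\<^bsub>T\<^esub>,
       add = monoid.mult T,
       module.smult = (\<lambda>b. tensor_lift T (\<lambda>c x. pt (b \<otimes>\<^bsub>R\<^esub> c) x))\<rparr>)"

text \<open>\<open>\<^sup>\<alpha>H = k \<otimes> \<^sup>\<alpha>H\<close>, for a normalized cocycle \<open>\<alpha>\<close>, so that \<open>\<alpha>(1,1) = 1\<close>.\<close>
definition twisted_hopf_algebra ::
  "('k::field \<Rightarrow> 'h \<Rightarrow> 'h) \<Rightarrow> ('h::ring_1 \<Rightarrow> 'h tensor_square) \<Rightarrow> ('h \<Rightarrow> 'h \<Rightarrow> 'k)
     \<Rightarrow> ('k, ('k \<times> 'h \<Rightarrow>\<^sub>0 int) set) module" where
  "twisted_hopf_algebra scale \<Delta> \<alpha> = twisted_algebra scale \<Delta> (algebra_on (*) UNIV) \<alpha> 1"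


section \<open>The symmetric algebra and its field of fractions\<close>

text \<open>
  The symmetric algebra of a vector space is the commutative polynomial algebra with one variable
  for every vector, modulo the ideal which makes the variable depend linearly on the vector.
\<close>

type_synonym ('h, 'k) free_comm_algebra = "('h \<Rightarrow>\<^sub>0 nat) \<Rightarrow>\<^sub>0 'k"

definition free_var :: "'h \<Rightarrow> ('h, 'k::field) free_comm_algebra" where
  "free_var h = Poly_Mapping.single (Poly_Mapping.single h 1) 1"

definition free_const :: "'k \<Rightarrow> ('h, 'k::field) free_comm_algebra" where
  "free_const c = Poly_Mapping.single 0 c"

definition symmetric_ideal ::
  "('k::field \<Rightarrow> 'h \<Rightarrow> 'h::ab_group_add) \<Rightarrow> ('h, 'k) free_comm_algebra set" where
  "symmetric_ideal scale =
     Idl\<^bsub>ring_of_type_algebra\<^esub>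
       ({free_var (x + y) - free_var x - free_var y | x y. True} \<union>
        {free_var (scale c x) - free_const c * free_var x | c x. True})"

definition symmetric_algebra ::
  "('k::field \<Rightarrow> 'h \<Rightarrow> 'h::ab_group_add) \<Rightarrow> ('h, 'k) free_comm_algebra set ring" where
  "symmetric_algebra scale = ring_of_type_algebra Quot symmetric_ideal scale"

text \<open>\<open>j\<close> exhibits the field \<open>'f\<close> as the field of fractions of the commutative ring \<open>D\<close>.\<close>
definition is_fraction_field :: "('a, 'm) ring_scheme \<Rightarrow> ('a \<Rightarrow> 'f::field) \<Rightarrow> bool" where
  "is_fraction_field D j \<longleftrightarrow>
     j \<in> ring_hom D ring_of_type_algebra \<and>
     inj_on j (carrier D) \<and>
     (\<forall>z. \<exists>a\<in>carrier D. \<exists>b\<in>carrier D. b \<noteq> \<zero>\<^bsub>D\<^esub> \<and> z = j a / j b)"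


section \<open>The universal cocycle\<close>

text \<open>
  Below, \<open>'f\<close> is the field of fractions \<open>K\<^sub>H\<close> of the symmetric algebra \<open>S(t\<^sub>H)\<close>, and \<open>j\<close> is
  the embedding of \<open>S(t\<^sub>H)\<close>. Fields of fractions are unique up to isomorphism, so \<open>'f\<close> and \<open>j\<close>
  stay arbitrary, subject to \<open>is_fraction_field (symmetric_algebra scale) j\<close>.
\<close>

definition t_map ::
  "('k::field \<Rightarrow> 'h \<Rightarrow> 'h::ab_group_add) \<Rightarrow> (('h, 'k) free_comm_algebra set \<Rightarrow> 'f) \<Rightarrow> 'h \<Rightarrow> 'f" where
  "t_map scale j h = j (symmetric_ideal scale +>\<^bsub>ring_of_type_algebra\<^esub> free_var h)"

definition ground_map ::
  "('k::field \<Rightarrow> 'h \<Rightarrow> 'h::ab_group_add) \<Rightarrow> (('h, 'k) free_comm_algebra set \<Rightarrow> 'f) \<Rightarrow> 'k \<Rightarrow> 'f" where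
  "ground_map scale j c = j (symmetric_ideal scale +>\<^bsub>ring_of_type_algebra\<^esub> free_const c)"

definition K_scale ::
  "('k::field \<Rightarrow> 'h \<Rightarrow> 'h::ab_group_add) \<Rightarrow> (('h, 'k) free_comm_algebra set \<Rightarrow> 'f::field)
     \<Rightarrow> 'k \<Rightarrow> 'f \<Rightarrow> 'f" where
  "K_scale scale j c z = ground_map scale j c * z"

definition t_inv ::
  "('k::field \<Rightarrow> 'h \<Rightarrow> 'h) \<Rightarrow> ('h::ring_1 \<Rightarrow> 'h tensor_square) \<Rightarrow> ('h \<Rightarrow> 'k)
     \<Rightarrow> (('h, 'k) free_comm_algebra set \<Rightarrow> 'f::field) \<Rightarrow> 'h \<Rightarrow> 'f" where
  "t_inv scale \<Delta> \<epsilon> j =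
     (THE u. Vector_Spaces.linear scale (K_scale scale j) u \<and>
        (\<forall>h. sweedler2 \<Delta> (\<lambda>h1 h2. t_map scale j h1 * u h2) h = ground_map scale j (\<epsilon> h) \<and>
             sweedler2 \<Delta> (\<lambda>h1 h2. u h1 * t_map scale j h2) h = ground_map scale j (\<epsilon> h)))"

definition universal_cocycle ::
  "('k::field \<Rightarrow> 'h \<Rightarrow> 'h) \<Rightarrow> ('h::ring_1 \<Rightarrow> 'h tensor_square) \<Rightarrow> ('h \<Rightarrow> 'k) \<Rightarrow> ('h \<Rightarrow> 'h \<Rightarrow> 'k)
     \<Rightarrow> (('h, 'k) free_comm_algebra set \<Rightarrow> 'f::field) \<Rightarrow> 'h \<Rightarrow> 'h \<Rightarrow> 'f" where
  "universal_cocycle scale \<Delta> \<epsilon> \<alpha> j x y =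
     sweedler3 \<Delta> (\<lambda>x1 x2 x3. sweedler3 \<Delta> (\<lambda>y1 y2 y3.
       t_map scale j x1 * t_map scale j y1 * ground_map scale j (\<alpha> x2 y2) *
       t_inv scale \<Delta> \<epsilon> j (x3 * y3)) y) x"

definition universal_cocycle_inv ::
  "('k::field \<Rightarrow> 'h \<Rightarrow> 'h) \<Rightarrow> ('h::ring_1 \<Rightarrow> 'h tensor_square) \<Rightarrow> ('h \<Rightarrow> 'k) \<Rightarrow> ('h \<Rightarrow> 'h \<Rightarrow> 'k)
     \<Rightarrow> (('h, 'k) free_comm_algebra set \<Rightarrow> 'f::field) \<Rightarrow> 'h \<Rightarrow> 'h \<Rightarrow> 'f" where
  "universal_cocycle_inv scale \<Delta> \<epsilon> \<alpha> j x y =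
     sweedler3 \<Delta> (\<lambda>x1 x2 x3. sweedler3 \<Delta> (\<lambda>y1 y2 y3.
       t_map scale j (x1 * y1) * ground_map scale j (convolution_inverse scale \<Delta> \<epsilon> \<alpha> x2 y2) *
       t_inv scale \<Delta> \<epsilon> j x3 * t_inv scale \<Delta> \<epsilon> j y3) y) x"

definition B_set ::
  "('k::field \<Rightarrow> 'h \<Rightarrow> 'h) \<Rightarrow> ('h::ring_1 \<Rightarrow> 'h tensor_square) \<Rightarrow> ('h \<Rightarrow> 'k) \<Rightarrow> ('h \<Rightarrow> 'h \<Rightarrow> 'k)
     \<Rightarrow> (('h, 'k) free_comm_algebra set \<Rightarrow> 'f::field) \<Rightarrow> 'f set" where
  "B_set scale \<Delta> \<epsilon> \<alpha> j =
     generated_subalgebra (K_scale scale j)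
       ({universal_cocycle scale \<Delta> \<epsilon> \<alpha> j x y | x y. True} \<union>
        {universal_cocycle_inv scale \<Delta> \<epsilon> \<alpha> j x y | x y. True})"

definition B_algebra ::
  "('k::field \<Rightarrow> 'h \<Rightarrow> 'h) \<Rightarrow> ('h::ring_1 \<Rightarrow> 'h tensor_square) \<Rightarrow> ('h \<Rightarrow> 'k) \<Rightarrow> ('h \<Rightarrow> 'h \<Rightarrow> 'k)
     \<Rightarrow> (('h, 'k) free_comm_algebra set \<Rightarrow> 'f::field) \<Rightarrow> ('k, 'f) module" where
  "B_algebra scale \<Delta> \<epsilon> \<alpha> j = algebra_on (K_scale scale j) (B_set scale \<Delta> \<epsilon> \<alpha> j)"

text \<open>Here \<open>\<sigma>(1,1) = t\<^sub>1\<close>, whence the unit \<open>t\<^sub>1\<^sup>-\<^sup>1 \<otimes> 1\<close>.\<close>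
definition A_algebra ::
  "('k::field \<Rightarrow> 'h \<Rightarrow> 'h) \<Rightarrow> ('h::ring_1 \<Rightarrow> 'h tensor_square) \<Rightarrow> ('h \<Rightarrow> 'k) \<Rightarrow> ('h \<Rightarrow> 'h \<Rightarrow> 'k)
     \<Rightarrow> (('h, 'k) free_comm_algebra set \<Rightarrow> 'f::field) \<Rightarrow> ('f, ('f \<times> 'h \<Rightarrow>\<^sub>0 int) set) module" where
  "A_algebra scale \<Delta> \<epsilon> \<alpha> j =
     twisted_algebra scale \<Delta> (B_algebra scale \<Delta> \<epsilon> \<alpha> j) (universal_cocycle scale \<Delta> \<epsilon> \<alpha> j)
       (t_inv scale \<Delta> \<epsilon> j 1)"

text \<open>The field of fractions of \<open>\<B>\<^sub>H\<^sup>\<alpha>\<close>, inside \<open>K\<^sub>H\<close>, as an algebra over \<open>\<B>\<^sub>H\<^sup>\<alpha>\<close>.\<close>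
definition frac_B ::
  "('k::field \<Rightarrow> 'h \<Rightarrow> 'h) \<Rightarrow> ('h::ring_1 \<Rightarrow> 'h tensor_square) \<Rightarrow> ('h \<Rightarrow> 'k) \<Rightarrow> ('h \<Rightarrow> 'h \<Rightarrow> 'k)
     \<Rightarrow> (('h, 'k) free_comm_algebra set \<Rightarrow> 'f::field) \<Rightarrow> ('f, 'f) module" where
  "frac_B scale \<Delta> \<epsilon> \<alpha> j =
     algebra_on (*) {a / b | a b. a \<in> B_set scale \<Delta> \<epsilon> \<alpha> j \<and> b \<in> B_set scale \<Delta> \<epsilon> \<alpha> j \<and> b \<noteq> 0}"

end

theory Submission
  imports Defs "HOL-Library.Function_Algebras"
begin

text \<open>
  Over \<open>K = K\<^sub>H\<close> the universal cocycle \<open>\<sigma>\<close> is cohomologous to \<open>\<alpha>\<close>: the map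
  \<open>x \<mapsto> \<Sum> t(x\<^sub>1) \<otimes> x\<^sub>2\<close> turns \<open>K \<otimes> \<^sup>\<sigma>H\<close> into \<open>K \<otimes> \<^sup>\<alpha>H\<close>. It therefore embeds
  the algebra in question into \<open>K \<otimes> \<^sup>\<alpha>H\<close>, carrying a basis over the field of fractions of \<open>B\<close> to
  a basis over \<open>K\<close>; in particular it is an associative ring, and, since a linear system over a
  subfield that is solvable over \<open>K\<close> is solvable over the subfield, it is simple if
  \<open>K \<otimes> \<^sup>\<alpha>H\<close> is.

  For the latter, \<open>K\<close> is purely transcendental over \<open>k\<close> and has a place with residue field \<open>k\<close>. An
  element of a nonzero ideal can be rescaled so that its coordinates are finite at the place and do
  not all reduce to zero. The reductions form a nonzero ideal of \<open>\<^sup>\<alpha>H\<close>, hence contain \<open>1\<close>. So the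
  ideal contains an element that reduces to \<open>1\<close>; right multiplication by it is injective, again by
  rescaling, hence surjective, and the ideal is everything. If the place is centred at the counit,
  then the same argument shows that \<open>t\<close> is convolution invertible.
\<close>

text \<open>The algebra \<open>\<^sup>\<alpha>H\<close> need not be central over \<open>k\<close>,
  and a simple algebra with a larger centre can lose simplicity under extension of scalars. A place
  with residue field exactly \<open>k\<close> excludes this without any knowledge of the centre:
  residues of vectors over \<open>K\<close> are vectors over \<open>k\<close>, so an ideal over
  \<open>K\<close> leaves its trace in \<open>\<^sup>\<alpha>H\<close> itself. The counit is the
  right centre for the place because it is the unit for convolution: once \<open>t\<close> reduces
  to \<epsilon>, convolution with \<open>t\<close> reduces to the identity. A second obstacle is
  that no single choice of coordinates serves every purpose. The map \<open>\<kappa>\<close> has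
  values in the subfield \<open>Frac\<close>, but turns the product into one twisted by \<sigma>;
  the map \<open>\<Phi>\<close> leads to a product with structure constants in \<open>k\<close>, but
  has values in \<open>K\<close>. Multiplication is studied through \<open>\<Phi>\<close>, linear
  descent through \<open>\<kappa>\<close>, and the bijection \<open>shear t\<close> of
  \<open>W\<close> passes between the two.\<close>

abbreviation (input) "lookup \<equiv> Poly_Mapping.lookup"
abbreviation (input) "keys \<equiv> Poly_Mapping.keys"
abbreviation (input) "single \<equiv> Poly_Mapping.single"


section \<open>Tensor products over a ring\<close>

text \<open>The supports of two elements and of their sum differ. All three products are extended to
  the union of the two supports, where the added factors have exponent 0.\<close>

lemma free_extension_hom:
  assumes G: "comm_group G" and f: "\<And>s. s \<in> S \<Longrightarrow> f s \<in> carrier G"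
  shows "(\<lambda>p. finprod G (\<lambda>s. f s [^]\<^bsub>G\<^esub> lookup p s) (keys p))
           \<in> hom (free_Abelian_group S) G" (is "?h \<in> _")
proof (rule homI)
  interpret comm_group G by fact
  have ext: "?h p = finprod G (\<lambda>s. f s [^]\<^bsub>G\<^esub> lookup p s) A"
    if "keys p \<subseteq> A" "finite A" "A \<subseteq> S" for p A
    using that f by (intro finprod_mono_neutral_cong_left) (auto simp: in_keys_iff)
  fix p q assume "p \<in> carrier (free_Abelian_group S)" "q \<in> carrier (free_Abelian_group S)"
  then have pq: "keys p \<subseteq> S" "keys q \<subseteq> S" by auto
  show "?h p \<in> carrier G" using pq f by (intro finprod_closed) auto
  define A where "A = keys p \<union> keys q"
  have A: "finite A" "A \<subseteq> S" using pq by (auto simp: A_def)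
  have "?h (p + q) = finprod G (\<lambda>s. f s [^]\<^bsub>G\<^esub> lookup (p + q) s) A"
    using A keys_add[of p q] by (intro ext) (auto simp: A_def)
  also have "\<dots> = finprod G (\<lambda>s. f s [^]\<^bsub>G\<^esub> lookup p s \<otimes>\<^bsub>G\<^esub> f s [^]\<^bsub>G\<^esub> lookup q s) A"
    using A f by (intro finprod_cong') (auto simp: lookup_add int_pow_mult)
  also have "\<dots> = ?h p \<otimes>\<^bsub>G\<^esub> ?h q"
    using A f pq by (subst finprod_multf) (auto simp: ext[of p A] ext[of q A] A_def)
  finally show "?h (p \<otimes>\<^bsub>free_Abelian_group S\<^esub> q) = ?h p \<otimes>\<^bsub>G\<^esub> ?h q" by simp
qed

lemma free_extension_frag_of:
  assumes G: "comm_group G" and f: "f s \<in> carrier G"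
  shows "finprod G (\<lambda>s'. f s' [^]\<^bsub>G\<^esub> lookup (frag_of s) s') (keys (frag_of s)) = f s"
proof -
  interpret comm_group G by fact
  show ?thesis using f by (simp add: finprod_insert)
qed

text \<open>The three equations match the three families of generators in
  \<open>tensor_relations\<close>. The target is only an abelian group, so a scalar crosses from one
  argument to the other instead of being pulled out.\<close>

definition balanced_map ::
  "('r, 'm) ring_scheme \<Rightarrow> ('r, 'a) module \<Rightarrow> ('r, 'b) module \<Rightarrow> ('c, 'n) monoid_scheme
     \<Rightarrow> ('a \<Rightarrow> 'b \<Rightarrow> 'c) \<Rightarrow> bool" where
  "balanced_map R M N G f \<longleftrightarrow>
     (\<forall>x\<in>carrier M. \<forall>y\<in>carrier N. f x y \<in> carrier G) \<and>
     (\<forall>x\<in>carrier M. \<forall>x'\<in>carrier M. \<forall>y\<in>carrier N. f (x \<oplus>\<^bsub>M\<^esub> x') y = f x y \<otimes>\<^bsub>G\<^esub> f x' y) \<and>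
     (\<forall>x\<in>carrier M. \<forall>y\<in>carrier N. \<forall>y'\<in>carrier N. f x (y \<oplus>\<^bsub>N\<^esub> y') = f x y \<otimes>\<^bsub>G\<^esub> f x y') \<and>
     (\<forall>r\<in>carrier R. \<forall>x\<in>carrier M. \<forall>y\<in>carrier N. f (r \<odot>\<^bsub>M\<^esub> x) y = f x (r \<odot>\<^bsub>N\<^esub> y))"

lemma balanced_mapI:
  assumes "\<And>x y. x \<in> carrier M \<Longrightarrow> y \<in> carrier N \<Longrightarrow> f x y \<in> carrier G"
    and "\<And>x x' y. x \<in> carrier M \<Longrightarrow> x' \<in> carrier M \<Longrightarrow> y \<in> carrier N \<Longrightarrow> f (x \<oplus>\<^bsub>M\<^esub> x') y = f x y \<otimes>\<^bsub>G\<^esub> f x' y"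
    and "\<And>x y y'. x \<in> carrier M \<Longrightarrow> y \<in> carrier N \<Longrightarrow> y' \<in> carrier N \<Longrightarrow> f x (y \<oplus>\<^bsub>N\<^esub> y') = f x y \<otimes>\<^bsub>G\<^esub> f x y'"
    and "\<And>r x y. r \<in> carrier R \<Longrightarrow> x \<in> carrier M \<Longrightarrow> y \<in> carrier N \<Longrightarrow> f (r \<odot>\<^bsub>M\<^esub> x) y = f x (r \<odot>\<^bsub>N\<^esub> y)"
  shows "balanced_map R M N G f"
  using assms unfolding balanced_map_def by blast

lemma balanced_mapD:
  assumes "balanced_map R M N G f"
  shows "\<And>x y. x \<in> carrier M \<Longrightarrow> y \<in> carrier N \<Longrightarrow> f x y \<in> carrier G"
    and "\<And>x x' y. x \<in> carrier M \<Longrightarrow> x' \<in> carrier M \<Longrightarrow> y \<in> carrier N \<Longrightarrow> f (x \<oplus>\<^bsub>M\<^esub> x') y = f x y \<otimes>\<^bsub>G\<^esub> f x' y"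
    and "\<And>x y y'. x \<in> carrier M \<Longrightarrow> y \<in> carrier N \<Longrightarrow> y' \<in> carrier N \<Longrightarrow> f x (y \<oplus>\<^bsub>N\<^esub> y') = f x y \<otimes>\<^bsub>G\<^esub> f x y'"
    and "\<And>r x y. r \<in> carrier R \<Longrightarrow> x \<in> carrier M \<Longrightarrow> y \<in> carrier N \<Longrightarrow> f (r \<odot>\<^bsub>M\<^esub> x) y = f x (r \<odot>\<^bsub>N\<^esub> y)"
  using assms unfolding balanced_map_def by blast+

text \<open>Closure under scalars replaces the module laws, so that a factor may be an algebra about
  which little is known yet.\<close>

locale tensor_product =
  fixes R :: "('r, 'm) ring_scheme" and M :: "('r, 'a) module" and N :: "('r, 'b) module"
  assumes abelian_left: "abelian_group M" and abelian_right: "abelian_group N"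
    and smult_left_closed: "r \<in> carrier R \<Longrightarrow> x \<in> carrier M \<Longrightarrow> r \<odot>\<^bsub>M\<^esub> x \<in> carrier M"
    and smult_right_closed: "r \<in> carrier R \<Longrightarrow> y \<in> carrier N \<Longrightarrow> r \<odot>\<^bsub>N\<^esub> y \<in> carrier N"
begin

abbreviation "FA \<equiv> free_Abelian_group (carrier M \<times> carrier N)"
abbreviation "TS \<equiv> tensor_subgroup R M N"
abbreviation "TG \<equiv> tensor_group R M N"
abbreviation "pt \<equiv> pure_tensor R M N"

sublocale left: abelian_group M by (rule abelian_left)
sublocale right: abelian_group N by (rule abelian_right)
sublocale FA: comm_group FA by (rule abelian_free_Abelian_group)

lemma relations_closed: "tensor_relations R M N \<subseteq> carrier FA"
  unfolding tensor_relations_def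
  by (auto dest!: subsetD[OF keys_diff] simp: keys_frag_of smult_left_closed smult_right_closed)

lemma subgroup_TS: "subgroup TS FA"
  unfolding tensor_subgroup_def by (rule FA.generate_is_subgroup[OF relations_closed])

lemma normal_TS: "TS \<lhd> FA"
  using subgroup_TS by (rule FA.subgroup_imp_normal)

lemma comm_group_TG: "comm_group TG"
  unfolding tensor_group_def by (rule FA.abelian_FactGroup[OF subgroup_TS])

sublocale TG: comm_group TG by (rule comm_group_TG)

lemma coset_hom: "(\<lambda>p. TS #>\<^bsub>FA\<^esub> p) \<in> hom FA TG"
  unfolding tensor_group_def using normal_TS by (rule normal.r_coset_hom_Mod)

lemma carrier_TG: "carrier TG = (\<lambda>p. TS #>\<^bsub>FA\<^esub> p) ` carrier FA"
  unfolding tensor_group_def carrier_FactGroup by auto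

lemma pt_closed [simp]: "x \<in> carrier M \<Longrightarrow> y \<in> carrier N \<Longrightarrow> pt x y \<in> carrier TG"
  unfolding pure_tensor_def carrier_TG by auto

lemma coset_eq:
  assumes "p \<in> carrier FA" "q \<in> carrier FA" "p - q \<in> TS"
  shows "TS #>\<^bsub>FA\<^esub> p = TS #>\<^bsub>FA\<^esub> q"
proof (rule FA.repr_independence[symmetric, OF _ _ subgroup_TS])
  show "p \<in> TS #>\<^bsub>FA\<^esub> q" unfolding r_coset_def using assms by (auto intro!: bexI[of _ "p - q"])
qed (use assms in auto)

lemma balanced_pt: "balanced_map R M N TG pt"
proof (rule balanced_mapI)
  have rel: "p \<in> TS" if "p \<in> tensor_relations R M N" for p
    using that unfolding tensor_subgroup_def by (rule generate.incl)
  have mult: "pt x y \<otimes>\<^bsub>TG\<^esub> pt x' y' = TS #>\<^bsub>FA\<^esub> (frag_of (x, y) + frag_of (x', y'))"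
    if "x \<in> carrier M" "y \<in> carrier N" "x' \<in> carrier M" "y' \<in> carrier N" for x y x' y'
    unfolding pure_tensor_def using hom_mult[OF coset_hom, of "frag_of (x, y)" "frag_of (x', y')"] that by simp
  have closed: "frag_of (x, y) + frag_of (x', y') \<in> carrier FA"
    if "x \<in> carrier M" "y \<in> carrier N" "x' \<in> carrier M" "y' \<in> carrier N" for x y x' y'
    using FA.m_closed[of "frag_of (x, y)" "frag_of (x', y')"] that by simp
  show "pt (x \<oplus>\<^bsub>M\<^esub> x') y = pt x y \<otimes>\<^bsub>TG\<^esub> pt x' y"
    if "x \<in> carrier M" "x' \<in> carrier M" "y \<in> carrier N" for x x' y
    unfolding mult[OF that(1,3,2,3)] unfolding pure_tensor_def
    using that closed[of x y x' y]
    by (intro coset_eq rel) (auto simp: tensor_relations_def diff_diff_eq)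
  show "pt x (y \<oplus>\<^bsub>N\<^esub> y') = pt x y \<otimes>\<^bsub>TG\<^esub> pt x y'"
    if "x \<in> carrier M" "y \<in> carrier N" "y' \<in> carrier N" for x y y'
    unfolding mult[OF that(1,2,1,3)] unfolding pure_tensor_def
    using that closed[of x y x y']
    by (intro coset_eq rel) (auto simp: tensor_relations_def diff_diff_eq)
  show "pt (r \<odot>\<^bsub>M\<^esub> x) y = pt x (r \<odot>\<^bsub>N\<^esub> y)"
    if "r \<in> carrier R" "x \<in> carrier M" "y \<in> carrier N" for r x y
    unfolding pure_tensor_def
    using that smult_left_closed smult_right_closed
    by (intro coset_eq rel) (auto simp: tensor_relations_def)
qed auto

lemmas pt_add_left = balanced_mapD(2)[OF balanced_pt]
lemmas pt_add_right = balanced_mapD(3)[OF balanced_pt]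
lemmas pt_smult = balanced_mapD(4)[OF balanced_pt]

lemma pt_zero_left: "y \<in> carrier N \<Longrightarrow> pt \<zero>\<^bsub>M\<^esub> y = \<one>\<^bsub>TG\<^esub>"
  using pt_add_left[of "\<zero>\<^bsub>M\<^esub>" "\<zero>\<^bsub>M\<^esub>" y] by (simp add: TG.l_cancel_one')

lemma pt_minus_left: "x \<in> carrier M \<Longrightarrow> y \<in> carrier N \<Longrightarrow> inv\<^bsub>TG\<^esub> (pt x y) = pt (\<ominus>\<^bsub>M\<^esub> x) y"
  using pt_add_left[of "\<ominus>\<^bsub>M\<^esub> x" x y] by (intro TG.inv_equality) (simp_all add: left.l_neg pt_zero_left)

text \<open>There is no case for inverses, since the inverse of a pure tensor is pure. The proof
  carries the claim for inverses along, because induction in the free abelian group produces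
  differences.\<close>

lemma tensor_induct [consumes 1, case_names pure mult]:
  assumes u: "u \<in> carrier TG"
    and pure: "\<And>x y. x \<in> carrier M \<Longrightarrow> y \<in> carrier N \<Longrightarrow> P (pt x y)"
    and mult: "\<And>u v. u \<in> carrier TG \<Longrightarrow> v \<in> carrier TG \<Longrightarrow> P u \<Longrightarrow> P v \<Longrightarrow> P (u \<otimes>\<^bsub>TG\<^esub> v)"
  shows "P u"
proof -
  have one: "P \<one>\<^bsub>TG\<^esub>" using pure[of "\<zero>\<^bsub>M\<^esub>" "\<zero>\<^bsub>N\<^esub>"] by (simp add: pt_zero_left)
  have "P (TS #>\<^bsub>FA\<^esub> p) \<and> P (inv\<^bsub>TG\<^esub> (TS #>\<^bsub>FA\<^esub> p))"
    if "keys p \<subseteq> carrier M \<times> carrier N" for p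
    using that
  proof (induction rule: free_Abelian_group_induct[consumes 1, case_names zero diff frag])
    case zero
    then show ?case using hom_one[OF coset_hom] one by (simp add: FA.is_group TG.is_group)
  next
    case (diff p q)
    have pq: "p \<in> carrier FA" "q \<in> carrier FA" using diff by auto
    have mem: "TS #>\<^bsub>FA\<^esub> p \<in> carrier TG" "TS #>\<^bsub>FA\<^esub> q \<in> carrier TG" using pq by (auto simp: carrier_TG)
    have "TS #>\<^bsub>FA\<^esub> p = (TS #>\<^bsub>FA\<^esub> (p - q)) \<otimes>\<^bsub>TG\<^esub> (TS #>\<^bsub>FA\<^esub> q)"
      using hom_mult[OF coset_hom, of "p - q" q] pq FA.m_closed[of p "- q"] by simp
    then have "TS #>\<^bsub>FA\<^esub> (p - q) = (TS #>\<^bsub>FA\<^esub> p) \<otimes>\<^bsub>TG\<^esub> inv\<^bsub>TG\<^esub> (TS #>\<^bsub>FA\<^esub> q)"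
      using mem pq FA.m_closed[of p "- q"] by (simp add: carrier_TG TG.inv_solve_right)
    then show ?case using diff mem by (auto simp: TG.inv_mult_group intro!: mult)
  next
    case (frag a)
    then show ?case using pure pt_minus_left by (cases a) (auto simp: pure_tensor_def)
  qed
  then show ?thesis using u by (auto simp: carrier_TG)
qed

lemma tensor_hom_eq:
  assumes h: "h \<in> hom TG G" "h' \<in> hom TG G"
    and eq: "\<And>x y. x \<in> carrier M \<Longrightarrow> y \<in> carrier N \<Longrightarrow> h (pt x y) = h' (pt x y)"
    and u: "u \<in> carrier TG"
  shows "h u = h' u"
  using u by (induction rule: tensor_induct) (simp_all add: eq hom_mult[OF h(1)] hom_mult[OF h(2)])

context
  fixes G :: "('c, 'n) monoid_scheme" and f
  assumes G: "comm_group G" and bal: "balanced_map R M N G f"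
begin

interpretation G: comm_group G by (rule G)

text \<open>\<open>tensor_lift\<close> evaluates at a representative chosen by \<open>SOME\<close>.
  The extension of \<open>f\<close> to the free group kills every relation, hence is constant on
  cosets, and any representative gives the same value.\<close>

lemma tensor_lift_coset:
  assumes p: "p \<in> carrier FA"
  shows "tensor_lift G f (TS #>\<^bsub>FA\<^esub> p) =
    finprod G (\<lambda>s. case_prod f s [^]\<^bsub>G\<^esub> lookup p s) (keys p)"
proof -
  define h where "h p = finprod G (\<lambda>s. case_prod f s [^]\<^bsub>G\<^esub> lookup p s) (keys p)" for p :: "_ \<Rightarrow>\<^sub>0 int"
  have closed: "case_prod f s \<in> carrier G" if "s \<in> carrier M \<times> carrier N" for s
    using balanced_mapD(1)[OF bal] that by auto
  have hom: "h \<in> hom FA G"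
    unfolding h_def by (rule free_extension_hom[OF G closed])
  interpret h: group_hom FA G h using hom by unfold_locales
  have frag: "h (frag_of (x, y)) = f x y" if "x \<in> carrier M" "y \<in> carrier N" for x y
    using free_extension_frag_of[OF G, of "case_prod f" "(x, y)"] closed[of "(x, y)"] that by (simp add: h_def)
  have diff: "h (p - q) = h p \<otimes>\<^bsub>G\<^esub> inv\<^bsub>G\<^esub> h q" if "p \<in> carrier FA" "q \<in> carrier FA" for p q
    using h.hom_mult[of p "- q"] h.hom_inv[of q] that by simp
  have sub: "p - q \<in> carrier FA" if "p \<in> carrier FA" "q \<in> carrier FA" for p q
    using FA.m_closed[of p "- q"] that by simp
  have mem: "frag_of (x, y) \<in> carrier FA" if "x \<in> carrier M" "y \<in> carrier N" for x y
    using that by simp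
  have cancel: "a \<otimes>\<^bsub>G\<^esub> b \<otimes>\<^bsub>G\<^esub> inv\<^bsub>G\<^esub> a \<otimes>\<^bsub>G\<^esub> inv\<^bsub>G\<^esub> b = \<one>\<^bsub>G\<^esub>" if "a \<in> carrier G" "b \<in> carrier G" for a b
    using that by (metis G.inv_closed G.m_assoc G.m_closed G.m_comm G.r_inv G.r_one)
  have "h r = \<one>\<^bsub>G\<^esub>" if "r \<in> tensor_relations R M N" for r
    using that unfolding tensor_relations_def
    by (elim UnE; clarsimp)
       (simp_all add: diff sub mem frag balanced_mapD[OF bal] smult_left_closed smult_right_closed cancel
         del: carrier_free_Abelian_group_iff)
  then have "tensor_relations R M N \<subseteq> kernel FA G h"
    using relations_closed by (auto simp: kernel_def simp del: carrier_free_Abelian_group_iff)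
  then have TS: "TS \<subseteq> kernel FA G h"
    unfolding tensor_subgroup_def by (intro FA.generate_subgroup_incl h.subgroup_kernel)
  have same: "h q = h p" if q: "q \<in> TS #>\<^bsub>FA\<^esub> p" for q
  proof -
    obtain r where r: "r \<in> TS" "q = r \<otimes>\<^bsub>FA\<^esub> p" using q unfolding r_coset_def by blast
    then have "r \<in> carrier FA" "h r = \<one>\<^bsub>G\<^esub>" using TS by (auto simp: kernel_def subset_iff)
    then show ?thesis using p h.hom_mult[of r p] h.hom_closed[of p] r
      by (simp del: carrier_free_Abelian_group_iff mult_free_Abelian_group)
  qed
  have "p \<in> TS #>\<^bsub>FA\<^esub> p" using FA.rcos_self[OF p subgroup_TS] .
  then have "(SOME q. q \<in> TS #>\<^bsub>FA\<^esub> p) \<in> TS #>\<^bsub>FA\<^esub> p" by (rule someI)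
  from same[OF this] show ?thesis
    unfolding tensor_lift_def Let_def h_def by (simp add: case_prod_unfold)
qed

lemma tensor_lift_hom: "tensor_lift G f \<in> hom TG G"
proof (rule homI)
  have closed: "case_prod f s \<in> carrier G" if "s \<in> carrier M \<times> carrier N" for s
    using balanced_mapD(1)[OF bal] that by auto
  have hom: "(\<lambda>p. finprod G (\<lambda>s. case_prod f s [^]\<^bsub>G\<^esub> lookup p s) (keys p)) \<in> hom FA G"
    by (rule free_extension_hom[OF G closed])
  fix u v assume "u \<in> carrier TG" "v \<in> carrier TG"
  then obtain p q where pq: "p \<in> carrier FA" "q \<in> carrier FA" "u = TS #>\<^bsub>FA\<^esub> p" "v = TS #>\<^bsub>FA\<^esub> q"
    by (auto simp: carrier_TG)
  show "tensor_lift G f u \<in> carrier G"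
    using hom_in_carrier[OF hom pq(1)] by (simp add: pq tensor_lift_coset del: carrier_free_Abelian_group_iff)
  have "u \<otimes>\<^bsub>TG\<^esub> v = TS #>\<^bsub>FA\<^esub> (p \<otimes>\<^bsub>FA\<^esub> q)" using hom_mult[OF coset_hom pq(1,2)] pq by simp
  then show "tensor_lift G f (u \<otimes>\<^bsub>TG\<^esub> v) = tensor_lift G f u \<otimes>\<^bsub>G\<^esub> tensor_lift G f v"
    using hom_mult[OF hom pq(1,2)] FA.m_closed[OF pq(1,2)] pq
    by (simp add: tensor_lift_coset del: mult_free_Abelian_group carrier_free_Abelian_group_iff)
qed

lemma tensor_lift_pure:
  assumes "x \<in> carrier M" "y \<in> carrier N"
  shows "tensor_lift G f (pt x y) = f x y"
proof -
  have mem: "frag_of (x, y) \<in> carrier FA" using assms by simp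
  show ?thesis using free_extension_frag_of[OF G, of "case_prod f" "(x, y)"] balanced_mapD(1)[OF bal assms]
    unfolding pure_tensor_def tensor_lift_coset[OF mem] by simp
qed

lemma tensor_lift_closed: "u \<in> carrier TG \<Longrightarrow> tensor_lift G f u \<in> carrier G"
  by (rule hom_in_carrier[OF tensor_lift_hom])

lemma tensor_lift_mult:
  "u \<in> carrier TG \<Longrightarrow> v \<in> carrier TG \<Longrightarrow>
     tensor_lift G f (u \<otimes>\<^bsub>TG\<^esub> v) = tensor_lift G f u \<otimes>\<^bsub>G\<^esub> tensor_lift G f v"
  by (rule hom_mult[OF tensor_lift_hom])

end

lemma tensor_lift_comp:
  assumes G: "comm_group G" and G': "comm_group G'" and h: "h \<in> hom G G'" and bal: "balanced_map R M N G f"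
    and u: "u \<in> carrier TG"
  shows "h (tensor_lift G f u) = tensor_lift G' (\<lambda>x y. h (f x y)) u"
proof (rule tensor_hom_eq[OF _ _ _ u])
  have bal': "balanced_map R M N G' (\<lambda>x y. h (f x y))"
    using bal h by (auto simp: balanced_map_def hom_mult hom_in_carrier)
  show "(\<lambda>u. h (tensor_lift G f u)) \<in> hom TG G'"
    using hom_compose[OF tensor_lift_hom[OF G bal] h] by (simp add: comp_def)
  show "tensor_lift G' (\<lambda>x y. h (f x y)) \<in> hom TG G'"
    by (rule tensor_lift_hom[OF G' bal'])
  show "h (tensor_lift G f (pt x y)) = tensor_lift G' (\<lambda>x y. h (f x y)) (pt x y)"
    if "x \<in> carrier M" "y \<in> carrier N" for x y
    using that by (simp add: tensor_lift_pure[OF G bal] tensor_lift_pure[OF G' bal'])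
qed

end

section \<open>Biadditive maps on a pair of tensor products\<close>

locale tensor_product_pair =
  T: tensor_product R M N + T': tensor_product R' M' N'
  for R :: "('r, 'm) ring_scheme" and M :: "('r, 'a) module" and N :: "('r, 'b) module"
    and R' :: "('s, 'n) ring_scheme" and M' :: "('s, 'c) module" and N' :: "('s, 'd) module" +
  fixes G :: "('e, 'l) monoid_scheme" and f :: "'a \<Rightarrow> 'b \<Rightarrow> 'c \<Rightarrow> 'd \<Rightarrow> 'e"
  assumes G: "comm_group G"
    and bal: "\<And>x y. x \<in> carrier M \<Longrightarrow> y \<in> carrier N \<Longrightarrow> balanced_map R' M' N' G (f x y)"
    and bal': "\<And>x' y'. x' \<in> carrier M' \<Longrightarrow> y' \<in> carrier N' \<Longrightarrow> balanced_map R M N G (\<lambda>x y. f x y x' y')"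
begin

interpretation G: comm_group G by (rule G)

text \<open>By induction on \<open>v\<close>: at a pure tensor this is the second balance
  assumption, and a pointwise product of balanced maps into a commutative group is balanced.\<close>

lemma balanced_inner:
  assumes "v \<in> carrier T'.TG"
  shows "balanced_map R M N G (\<lambda>x y. tensor_lift G (f x y) v)"
  using assms
proof (induction rule: T'.tensor_induct)
  case (pure x' y')
  have "tensor_lift G (f x y) (T'.pt x' y') = f x y x' y'" if "x \<in> carrier M" "y \<in> carrier N" for x y
    using T'.tensor_lift_pure[OF G bal[OF that]] pure by simp
  then show ?case
    using bal'[OF pure] T.smult_left_closed T.smult_right_closed unfolding balanced_map_def by auto
next
  case (mult u v)
  have eq: "tensor_lift G (f x y) (u \<otimes>\<^bsub>T'.TG\<^esub> v) = tensor_lift G (f x y) u \<otimes>\<^bsub>G\<^esub> tensor_lift G (f x y) v"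
    if "x \<in> carrier M" "y \<in> carrier N" for x y
    using T'.tensor_lift_mult[OF G bal[OF that]] mult by simp
  note u = balanced_mapD[OF mult(3)] and v = balanced_mapD[OF mult(4)]
  have swap: "a \<otimes>\<^bsub>G\<^esub> b \<otimes>\<^bsub>G\<^esub> (c \<otimes>\<^bsub>G\<^esub> d) = a \<otimes>\<^bsub>G\<^esub> c \<otimes>\<^bsub>G\<^esub> (b \<otimes>\<^bsub>G\<^esub> d)"
    if "a \<in> carrier G" "b \<in> carrier G" "c \<in> carrier G" "d \<in> carrier G" for a b c d
    using that by (simp add: G.m_ac)
  show ?case
    by (rule balanced_mapI) (simp_all add: eq u v swap T.smult_left_closed T.smult_right_closed)
qed

definition "lift2 u v = tensor_lift G (\<lambda>x y. tensor_lift G (f x y) v) u"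

lemma lift2_closed: "u \<in> carrier T.TG \<Longrightarrow> v \<in> carrier T'.TG \<Longrightarrow> lift2 u v \<in> carrier G"
  unfolding lift2_def by (rule T.tensor_lift_closed[OF G balanced_inner])

lemma lift2_mult_left:
  "u \<in> carrier T.TG \<Longrightarrow> u' \<in> carrier T.TG \<Longrightarrow> v \<in> carrier T'.TG \<Longrightarrow>
     lift2 (u \<otimes>\<^bsub>T.TG\<^esub> u') v = lift2 u v \<otimes>\<^bsub>G\<^esub> lift2 u' v"
  unfolding lift2_def by (rule T.tensor_lift_mult[OF G balanced_inner])

lemma lift2_pure_left:
  "x \<in> carrier M \<Longrightarrow> y \<in> carrier N \<Longrightarrow> v \<in> carrier T'.TG \<Longrightarrow> lift2 (T.pt x y) v = tensor_lift G (f x y) v"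
  unfolding lift2_def by (rule T.tensor_lift_pure[OF G balanced_inner])

lemma lift2_pure:
  "x \<in> carrier M \<Longrightarrow> y \<in> carrier N \<Longrightarrow> x' \<in> carrier M' \<Longrightarrow> y' \<in> carrier N' \<Longrightarrow>
     lift2 (T.pt x y) (T'.pt x' y') = f x y x' y'"
  by (simp add: lift2_pure_left T'.tensor_lift_pure[OF G bal])

lemma lift2_mult_right:
  assumes u: "u \<in> carrier T.TG" and v: "v \<in> carrier T'.TG" "v' \<in> carrier T'.TG"
  shows "lift2 u (v \<otimes>\<^bsub>T'.TG\<^esub> v') = lift2 u v \<otimes>\<^bsub>G\<^esub> lift2 u v'"
  using u
proof (induction rule: T.tensor_induct)
  case (pure x y)
  then show ?case using v by (simp add: lift2_pure_left T'.tensor_lift_mult[OF G bal])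
next
  case (mult u u')
  then show ?case using v by (simp add: lift2_mult_left lift2_closed G.m_ac)
qed

end

locale nonassoc_algebra =
  fixes R :: "('r, 'm) ring_scheme" and M :: "('r, 'a) module"
  assumes abelian: "abelian_group M"
    and smult_closed: "r \<in> carrier R \<Longrightarrow> x \<in> carrier M \<Longrightarrow> r \<odot>\<^bsub>M\<^esub> x \<in> carrier M"
    and mult_closed: "x \<in> carrier M \<Longrightarrow> y \<in> carrier M \<Longrightarrow> x \<otimes>\<^bsub>M\<^esub> y \<in> carrier M"
    and l_distr: "x \<in> carrier M \<Longrightarrow> x' \<in> carrier M \<Longrightarrow> y \<in> carrier M \<Longrightarrow>
      (x \<oplus>\<^bsub>M\<^esub> x') \<otimes>\<^bsub>M\<^esub> y = x \<otimes>\<^bsub>M\<^esub> y \<oplus>\<^bsub>M\<^esub> x' \<otimes>\<^bsub>M\<^esub> y"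
    and r_distr: "x \<in> carrier M \<Longrightarrow> y \<in> carrier M \<Longrightarrow> y' \<in> carrier M \<Longrightarrow>
      x \<otimes>\<^bsub>M\<^esub> (y \<oplus>\<^bsub>M\<^esub> y') = x \<otimes>\<^bsub>M\<^esub> y \<oplus>\<^bsub>M\<^esub> x \<otimes>\<^bsub>M\<^esub> y'"
    and smult_mult_left: "r \<in> carrier R \<Longrightarrow> x \<in> carrier M \<Longrightarrow> y \<in> carrier M \<Longrightarrow>
      (r \<odot>\<^bsub>M\<^esub> x) \<otimes>\<^bsub>M\<^esub> y = r \<odot>\<^bsub>M\<^esub> (x \<otimes>\<^bsub>M\<^esub> y)"
    and smult_mult_right: "r \<in> carrier R \<Longrightarrow> x \<in> carrier M \<Longrightarrow> y \<in> carrier M \<Longrightarrow>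
      x \<otimes>\<^bsub>M\<^esub> (r \<odot>\<^bsub>M\<^esub> y) = r \<odot>\<^bsub>M\<^esub> (x \<otimes>\<^bsub>M\<^esub> y)"

locale tensor_product_algebra =
  A: nonassoc_algebra R M + B: nonassoc_algebra R N
  for R :: "('r, 'm) ring_scheme" and M :: "('r, 'a) module" and N :: "('r, 'b) module"
begin

sublocale tensor_product R M N
  by (rule tensor_product.intro) (auto intro: A.abelian B.abelian A.smult_closed B.smult_closed)

sublocale mult: tensor_product_pair R M N R M N TG "\<lambda>x y x' y'. pt (x \<otimes>\<^bsub>M\<^esub> x') (y \<otimes>\<^bsub>N\<^esub> y')"
proof unfold_locales
  show "balanced_map R M N TG (\<lambda>x' y'. pt (x \<otimes>\<^bsub>M\<^esub> x') (y \<otimes>\<^bsub>N\<^esub> y'))"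
    if "x \<in> carrier M" "y \<in> carrier N" for x y
    using that by (intro balanced_mapI)
      (simp_all add: A.mult_closed B.mult_closed A.r_distr B.r_distr pt_add_left pt_add_right
        A.smult_mult_right B.smult_mult_right pt_smult)
  show "balanced_map R M N TG (\<lambda>x y. pt (x \<otimes>\<^bsub>M\<^esub> x') (y \<otimes>\<^bsub>N\<^esub> y'))"
    if "x' \<in> carrier M" "y' \<in> carrier N" for x' y'
    using that by (intro balanced_mapI)
      (simp_all add: A.mult_closed B.mult_closed A.l_distr B.l_distr pt_add_left pt_add_right
        A.smult_mult_left B.smult_mult_left pt_smult)
qed

lemma tensor_algebra_mult: "u \<otimes>\<^bsub>tensor_algebra R M N\<^esub> v = mult.lift2 u v"
  by (simp add: tensor_algebra_def mult.lift2_def Let_def)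

end

text \<open>\<open>tensor_lift\<close> wants a group in multiplicative notation. This one asks for
  addition only, so it serves elements of \<open>H\<close>, scalars and coordinate functions
  alike.\<close>

definition type_group :: "'a::ab_group_add monoid" where
  "type_group = \<lparr>carrier = UNIV, monoid.mult = (+), one = 0\<rparr>"

lemma type_group_simps [simp]:
  "carrier type_group = UNIV" "x \<otimes>\<^bsub>type_group\<^esub> y = x + y" "\<one>\<^bsub>type_group\<^esub> = 0"
  by (simp_all add: type_group_def)

lemma comm_group_type_group: "comm_group (type_group :: 'a::ab_group_add monoid)"
  by (rule comm_groupI) (auto simp: add_ac intro: exI[of _ "- x" for x] left_minus)

lemma finprod_type_group:
  fixes f :: "'b \<Rightarrow> 'a::ab_group_add"
  shows "finprod type_group f A = sum f A"
proof (cases "finite A")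
  interpret comm_group "type_group :: 'a monoid" by (rule comm_group_type_group)
  case True
  then show ?thesis by induction auto
next
  interpret comm_group "type_group :: 'a monoid" by (rule comm_group_type_group)
  case False
  then show ?thesis by (simp add: finprod_infinite)
qed

lemma tensor_sum_eq:
  fixes f :: "'a \<Rightarrow> 'b \<Rightarrow> 'c::ring_1"
  shows "tensor_sum f u = tensor_lift type_group f u"
proof -
  have "add_monoid (ring_of_type_algebra :: 'c ring) = type_group"
    by (simp add: ring_of_type_algebra_def type_group_def)
  then show ?thesis by (simp add: tensor_sum_def)
qed

lemma carrier_tensor_algebra: "carrier (tensor_algebra R M N) = carrier (tensor_group R M N)"
  and add_tensor_algebra: "u \<oplus>\<^bsub>tensor_algebra R M N\<^esub> v = u \<otimes>\<^bsub>tensor_group R M N\<^esub> v"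
  and zero_tensor_algebra: "\<zero>\<^bsub>tensor_algebra R M N\<^esub> = \<one>\<^bsub>tensor_group R M N\<^esub>"
  and one_tensor_algebra: "\<one>\<^bsub>tensor_algebra R M N\<^esub> = pure_tensor R M N \<one>\<^bsub>M\<^esub> \<one>\<^bsub>N\<^esub>"
  and smult_tensor_algebra: "r \<odot>\<^bsub>tensor_algebra R M N\<^esub> u =
    tensor_lift (tensor_group R M N) (\<lambda>x y. pure_tensor R M N (r \<odot>\<^bsub>M\<^esub> x) y) u"
  by (simp_all add: tensor_algebra_def Let_def)

lemma abelian_group_of_comm_group:
  assumes "comm_group G" "carrier M = carrier G" "\<And>x y. x \<oplus>\<^bsub>M\<^esub> y = x \<otimes>\<^bsub>G\<^esub> y" "\<zero>\<^bsub>M\<^esub> = \<one>\<^bsub>G\<^esub>"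
  shows "abelian_group M"
proof -
  interpret comm_group G by fact
  show ?thesis
    by (rule abelian_groupI) (auto simp: assms(2-4) m_ac intro!: bexI[of _ "inv\<^bsub>G\<^esub> x" for x])
qed


section \<open>A rational place of the field of fractions of a symmetric algebra\<close>

text \<open>Once the terms at \<open>m\<close> and \<open>l\<close> are split off, all other
  products of monomials lie strictly above \<open>m + l\<close>. The bounds need not be attained; a
  coefficient 0 at the bound is what later gives the residue 0.\<close>

lemma lookup_mult_lowest:
  fixes p q :: "'m::{ordered_cancel_comm_monoid_add, linorder} \<Rightarrow>\<^sub>0 'k::comm_ring_1"
  assumes p: "\<And>x. x \<in> keys p \<Longrightarrow> m \<le> x" and q: "\<And>x. x \<in> keys q \<Longrightarrow> l \<le> x"
  shows "lookup (p * q) (m + l) = lookup p m * lookup q l"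
proof -
  define p' where "p' = p - single m (lookup p m)"
  define q' where "q' = q - single l (lookup q l)"
  have p': "m < x" if "x \<in> keys p'" for x
  proof -
    have "x \<noteq> m" "x \<in> keys p"
      using that by (auto simp: p'_def in_keys_iff lookup_minus lookup_single when_def split: if_splits)
    then show ?thesis using p[of x] by simp
  qed
  have q': "l < x" if "x \<in> keys q'" for x
  proof -
    have "x \<noteq> l" "x \<in> keys q"
      using that by (auto simp: q'_def in_keys_iff lookup_minus lookup_single when_def split: if_splits)
    then show ?thesis using q[of x] by simp
  qed
  have "lookup (p' * q) (m + l) = 0"
  proof (rule ccontr)
    assume "lookup (p' * q) (m + l) \<noteq> 0"
    then have "m + l \<in> keys (p' * q)" by (simp add: in_keys_iff)
    then obtain a b where "a \<in> keys p'" "b \<in> keys q" "m + l = a + b"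
      using keys_mult[of p' q] by blast
    then show False using add_less_le_mono[OF p' q] by auto
  qed
  moreover have "lookup (single m c * q') (m + l) = 0" for c
  proof (rule ccontr)
    assume "lookup (single m c * q') (m + l) \<noteq> 0"
    then have "m + l \<in> keys (single m c * q')" by (simp add: in_keys_iff)
    then obtain a b where "a \<in> keys (single m c)" "b \<in> keys q'" "m + l = a + b"
      using keys_mult[of "single m c" q'] by blast
    then show False using q'[of b] by (auto split: if_splits)
  qed
  moreover have "p * q = p' * q + single m (lookup p m) * q'
      + single (m + l) (lookup p m * lookup q l)"
  proof -
    have "p * q = (p - a) * q + a * (q - b) + a * b" for a b by (simp add: algebra_simps)
    then show ?thesis unfolding p'_def q'_def mult_single[symmetric] by blast
  qed
  ultimately show ?thesis by (simp add: lookup_add)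
qed

text \<open>\<open>P z c\<close> reads: \<open>z\<close> is finite at the place and has residue
  \<open>c\<close>. \<open>P_total\<close> is the defining property of a valuation ring, and
  \<open>P_const\<close> makes the residue field equal to the ground field.\<close>

locale ring_place =
  fixes \<iota> :: "'k::field \<Rightarrow> 'f::field" and P :: "'f \<Rightarrow> 'k \<Rightarrow> bool"
  assumes \<iota>_0 [simp]: "\<iota> 0 = 0" and \<iota>_1 [simp]: "\<iota> 1 = 1"
    and \<iota>_add: "\<iota> (a + b) = \<iota> a + \<iota> b" and \<iota>_mult: "\<iota> (a * b) = \<iota> a * \<iota> b"
    and P_unique: "P z c \<Longrightarrow> P z d \<Longrightarrow> c = d"
    and P_add: "P z c \<Longrightarrow> P w d \<Longrightarrow> P (z + w) (c + d)"
    and P_mult: "P z c \<Longrightarrow> P w d \<Longrightarrow> P (z * w) (c * d)"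
    and P_const: "P (\<iota> c) c"
    and P_total: "z \<noteq> 0 \<Longrightarrow> (\<exists>c. P z c) \<or> (\<exists>c. P (1 / z) c)"
begin

lemma P_0: "P 0 0" and P_1: "P 1 1"
  using P_const[of 0] P_const[of 1] by simp_all

lemma P_sum: "(\<And>i. i \<in> A \<Longrightarrow> P (f i) (g i)) \<Longrightarrow> P (sum f A) (sum g A)"
  by (induction A rule: infinite_finite_induct) (auto intro: P_0 P_add)

text \<open>Divide by an entry of least value. A new entry \<open>y\<close> either stays finite
  after division by the old pivot, or the inverse ratio is finite; then \<open>y\<close> becomes the
  pivot, since finite ratios multiply.\<close>

lemma scale_into_place:
  assumes "finite A" "x \<in> A" "z x \<noteq> 0"
  shows "\<exists>x0\<in>A. z x0 \<noteq> 0 \<and> (\<forall>x\<in>A. \<exists>c. P (z x / z x0) c)"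
  using assms
proof (induction A arbitrary: x)
  case (insert y A)
  have self: "P (z x / z x) 1" if "z x \<noteq> 0" for x using that P_1 by simp
  show ?case
  proof (cases "\<exists>x\<in>A. z x \<noteq> 0")
    case False
    then have "z y \<noteq> 0" and "z x = 0" if "x \<in> A" for x using insert.prems that by auto
    then show ?thesis using P_0 self[of y] False insert.prems by (intro bexI[of _ y]) auto
  next
    case True
    then obtain x0 where x0: "x0 \<in> A" "z x0 \<noteq> 0" and P: "\<And>x. x \<in> A \<Longrightarrow> \<exists>c. P (z x / z x0) c"
      using insert.IH by blast
    show ?thesis
    proof (cases "\<exists>c. P (z y / z x0) c")
      case True
      then show ?thesis using x0 P by (intro bexI[of _ x0]) auto
    next
      case False
      then have y: "z y \<noteq> 0" using P_0 by force
      then obtain d where d: "P (z x0 / z y) d"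
        using P_total[of "z y / z x0"] x0 False by auto
      have "\<exists>c. P (z x / z y) c" if "x \<in> A" for x
        using P[OF that] P_mult[OF _ d, of "z x / z x0"] x0 by auto
      then show ?thesis using y self[OF y] by (intro bexI[of _ y]) auto
    qed
  qed
qed simp

end

text \<open>A fraction is finite if some monomial bounds the supports of numerator and denominator
  from below and occurs in the denominator; its residue is the quotient of the two coefficients
  there. Equal kernels of \<open>J\<close> and \<phi> let the coefficients of
  \<open>\<phi> a\<close> speak about \<open>J a\<close>.\<close>

lemma place_from_lowest_term:
  fixes J :: "'a::comm_ring_1 \<Rightarrow> 'f::field"
    and \<phi> :: "'a \<Rightarrow> ('m::{ordered_cancel_comm_monoid_add, linorder} \<Rightarrow>\<^sub>0 'k::field)"
    and con :: "'k \<Rightarrow> 'a"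
  assumes J: "J 1 = 1" "\<And>a b. J (a + b) = J a + J b" "\<And>a b. J (a * b) = J a * J b"
    and \<phi>: "\<phi> 1 = 1" "\<And>a b. \<phi> (a + b) = \<phi> a + \<phi> b" "\<And>a b. \<phi> (a * b) = \<phi> a * \<phi> b"
    and ker: "\<And>a. J a = 0 \<longleftrightarrow> \<phi> a = 0"
    and frac: "\<And>z. \<exists>a b. J b \<noteq> 0 \<and> z = J a / J b"
    and con: "\<And>c. \<phi> (con c) = single 0 c"
    and con_hom: "\<And>c d. J (con (c + d)) = J (con c) + J (con d)" "\<And>c d. J (con (c * d)) = J (con c) * J (con d)" "J (con 1) = 1"
  obtains P where "ring_place (\<lambda>c. J (con c)) P"
    and "\<And>a c. (\<And>x. x \<in> keys (\<phi> a) \<Longrightarrow> 0 \<le> x) \<Longrightarrow> lookup (\<phi> a) 0 = c \<Longrightarrow> P (J a) c"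
proof -
  define low where "low p m \<longleftrightarrow> (\<forall>x\<in>keys p. m \<le> x)" for p :: "'m \<Rightarrow>\<^sub>0 'k" and m
  define P where "P z c \<longleftrightarrow> (\<exists>a b m. low (\<phi> a) m \<and> low (\<phi> b) m \<and> lookup (\<phi> b) m \<noteq> 0 \<and>
      c = lookup (\<phi> a) m / lookup (\<phi> b) m \<and> z = J a / J b)" for z c
  have low_mult: "low (p * q) (m + l)" if "low p m" "low q l" for p q m l
    using that keys_mult[of p q] unfolding low_def by (fastforce intro: add_mono)
  have low_add: "low (p + q) m" if "low p m" "low q m" for p q m
    using that keys_add[of p q] unfolding low_def by blast
  have lookup: "lookup (p * q) (m + l) = lookup p m * lookup q l"
    if "low p m" "low q l" for p q m l
    using that by (intro lookup_mult_lowest) (auto simp: low_def)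
  have nz: "J b \<noteq> 0" if "lookup (\<phi> b) m \<noteq> 0" for b m using that ker[of b] by auto
  have add: "P (z + w) (c + d)" if zc: "P z c" and wd: "P w d" for z w c d
  proof -
    obtain a b m where 1: "low (\<phi> a) m" "low (\<phi> b) m" "lookup (\<phi> b) m \<noteq> 0"
      "c = lookup (\<phi> a) m / lookup (\<phi> b) m" "z = J a / J b" using zc unfolding P_def by blast
    obtain a' b' m' where 2: "low (\<phi> a') m'" "low (\<phi> b') m'" "lookup (\<phi> b') m' \<noteq> 0"
      "d = lookup (\<phi> a') m' / lookup (\<phi> b') m'" "w = J a' / J b'" using wd unfolding P_def by blast
    show ?thesis unfolding P_def
    proof (intro exI conjI)
      show "low (\<phi> (a * b' + b * a')) (m + m')" "low (\<phi> (b * b')) (m + m')"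
        using 1 2 by (simp_all add: \<phi> low_add low_mult)
      show "lookup (\<phi> (b * b')) (m + m') \<noteq> 0"
        using 1 2 by (simp add: \<phi> lookup)
      show "c + d = lookup (\<phi> (a * b' + b * a')) (m + m') / lookup (\<phi> (b * b')) (m + m')"
        unfolding \<phi> lookup_add lookup[OF 1(1) 2(2)] lookup[OF 1(2) 2(1)] lookup[OF 1(2) 2(2)] 1(4) 2(4)
        using 1(3) 2(3) by (simp add: field_simps)
      show "z + w = J (a * b' + b * a') / J (b * b')"
        using 1 2 nz[OF 1(3)] nz[OF 2(3)] by (simp add: J field_simps)
    qed
  qed
  have mult: "P (z * w) (c * d)" if zc: "P z c" and wd: "P w d" for z w c d
  proof -
    obtain a b m where 1: "low (\<phi> a) m" "low (\<phi> b) m" "lookup (\<phi> b) m \<noteq> 0"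
      "c = lookup (\<phi> a) m / lookup (\<phi> b) m" "z = J a / J b" using zc unfolding P_def by blast
    obtain a' b' m' where 2: "low (\<phi> a') m'" "low (\<phi> b') m'" "lookup (\<phi> b') m' \<noteq> 0"
      "d = lookup (\<phi> a') m' / lookup (\<phi> b') m'" "w = J a' / J b'" using wd unfolding P_def by blast
    show ?thesis unfolding P_def
      using 1 2
      by (intro exI[of _ "a * a'"] exI[of _ "b * b'"] exI[of _ "m + m'"]) (simp add: J \<phi> lookup low_mult)
  qed
  have regular: "P (J a) c" if "low (\<phi> a) 0" "lookup (\<phi> a) 0 = c" for a c
    unfolding P_def using that
    by (intro exI[of _ a] exI[of _ 1] exI[of _ 0]) (simp add: \<phi> J low_def)
  have const: "P (J (con c)) c" for c
    by (rule regular) (auto simp: con low_def)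
  have zero: "c = 0" if "P 0 c" for c
  proof -
    obtain a b m where 1: "lookup (\<phi> b) m \<noteq> 0"
      "c = lookup (\<phi> a) m / lookup (\<phi> b) m" "0 = J a / J b" using \<open>P 0 c\<close> unfolding P_def by blast
    then show ?thesis using nz[OF 1(1)] ker[of a] by simp
  qed
  \<comment> \<open>Residues are additive and multiplicative, so uniqueness reduces to the fact that
    0 has no residue but 0.\<close>
  have unique: "c = d" if "P z c" "P z d" for z c d
  proof -
    have "P (z + J (con (- 1)) * z) (c + (- 1) * d)" by (intro add mult const that)
    moreover have "J (con (- 1)) = - 1"
    proof -
      have "J (con 0) = 0" using con_hom(1)[of 0 0] by (simp only: add_0_right add_cancel_right_right)
      then show ?thesis using con_hom(1)[of "-1" 1] con_hom(3) by (simp add: eq_neg_iff_add_eq_0)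
    qed
    ultimately have "P 0 (c - d)" by simp
    then show ?thesis using zero by fastforce
  qed
  have total: "(\<exists>c. P z c) \<or> (\<exists>c. P (1 / z) c)" if "z \<noteq> 0" for z
  proof -
    obtain a b where ab: "J b \<noteq> 0" "z = J a / J b" using frac by blast
    then have "J a \<noteq> 0" using that by auto
    then have ne: "keys (\<phi> a) \<noteq> {}" "keys (\<phi> b) \<noteq> {}" using ker ab by auto
    define m where "m = Min (keys (\<phi> a))"
    define l where "l = Min (keys (\<phi> b))"
    have m: "low (\<phi> a) m" "lookup (\<phi> a) m \<noteq> 0"
      using Min_in[of "keys (\<phi> a)"] ne by (auto simp: m_def low_def in_keys_iff[symmetric])
    have l: "low (\<phi> b) l" "lookup (\<phi> b) l \<noteq> 0"
      using Min_in[of "keys (\<phi> b)"] ne by (auto simp: l_def low_def in_keys_iff[symmetric])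
    \<comment> \<open>Comparing the two lowest monomials decides whether \<open>z\<close> or its
      inverse is finite.\<close>
    have "low (\<phi> a) l \<or> low (\<phi> b) m"
      using m l unfolding low_def by (meson linear order_trans)
    then show ?thesis
    proof
      assume "low (\<phi> a) l"
      then have "\<exists>c. P z c" using l ab unfolding P_def by blast
      then show ?thesis ..
    next
      assume "low (\<phi> b) m"
      moreover have "1 / z = J b / J a" using ab by simp
      ultimately have "\<exists>c. P (1 / z) c" using m unfolding P_def by blast
      then show ?thesis ..
    qed
  qed
  have "ring_place (\<lambda>c. J (con c)) P"
  proof unfold_locales
    show "J (con 0) = 0" using con_hom(1)[of 0 0] by (simp only: add_0_right add_cancel_right_right)
  qed (use con_hom unique add mult const total in auto)
  then show ?thesis using that regular unfolding low_def by blast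
qed


section \<open>Evaluation of polynomials in several variables\<close>

lemma poly_mapping_eq_sum_single: "p = (\<Sum>m\<in>keys p. single m (lookup p m))"
proof (rule poly_mapping_eqI)
  fix k
  have "(\<Sum>m\<in>keys p. lookup (single m (lookup p m)) k)
      = (\<Sum>m\<in>keys p. if m = k then lookup p k else 0)"
    by (intro sum.cong refl) (auto simp: lookup_single when_def)
  also have "\<dots> = lookup p k" by (simp add: in_keys_iff)
  finally show "lookup p k =
      lookup (\<Sum>m\<in>keys p. single m (lookup p m)) k"
    by (simp add: lookup_sum)
qed

lemma free_comm_algebra_induct [case_names const var add mult]:
  fixes p :: "('x, 'k::field) free_comm_algebra"
  assumes const: "\<And>c. Q (free_const c)" and var: "\<And>x. Q (free_var x)"
    and add: "\<And>p q. Q p \<Longrightarrow> Q q \<Longrightarrow> Q (p + q)" and mult: "\<And>p q. Q p \<Longrightarrow> Q q \<Longrightarrow> Q (p * q)"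
  shows "Q p"
proof -
  have zero: "Q 0" and one: "Q 1" using const[of 0] const[of 1] by (simp_all add: free_const_def)
  have pow: "Q (single (single x n) 1)" for x and n :: nat
  proof (induction n)
    case (Suc n)
    have "single (single x (Suc n)) (1::'k)
        = single (single x n) 1 * free_var x"
      by (simp add: free_var_def mult_single single_add[symmetric])
    then show ?case using mult[OF Suc var] by simp
  qed (use one in simp)
  have mono: "Q (single (\<Sum>x\<in>A. single x (n x)) 1)" if "finite A" for A :: "'x set" and n :: "'x \<Rightarrow> nat"
    using that
  proof (induction A)
    case (insert x A)
    have "single (\<Sum>x\<in>insert x A. single x (n x)) (1::'k)
        = single (single x (n x)) 1 * single (\<Sum>x\<in>A. single x (n x)) 1"
      using insert by (simp add: mult_single)
    then show ?case using mult[OF pow insert.IH] by simp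
  qed (use one in simp)
  have single: "Q (single m c)" for m c
  proof -
    have "single m c = free_const c * single m 1"
      by (simp add: free_const_def mult_single)
    then show ?thesis
      using mult[OF const[of c] mono[OF finite_keys[of m], of "lookup m"]]
      by (simp flip: poly_mapping_eq_sum_single)
  qed
  have "Q (\<Sum>m\<in>A. single m (lookup p m))" if "finite A" for A
    using that by induction (auto simp: zero add single)
  from this[OF finite_keys[of p]] show ?thesis by (simp flip: poly_mapping_eq_sum_single)
qed

text \<open>Coefficients pass through \<iota>, so that the same evaluation can take values in
  another polynomial ring and in the field \<open>K\<close>.\<close>

locale ring_hom_on_types =
  fixes \<iota> :: "'k::comm_ring_1 \<Rightarrow> 'r::comm_ring_1"
  assumes hom_one [simp]: "\<iota> 1 = 1" and hom_add: "\<iota> (a + b) = \<iota> a + \<iota> b" and hom_mult: "\<iota> (a * b) = \<iota> a * \<iota> b"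
begin

lemma hom_zero [simp]: "\<iota> 0 = 0" using hom_add[of 0 0] by simp

lemma hom_minus: "\<iota> (- a) = - \<iota> a" using hom_add[of "- a" a] by (simp add: eq_neg_iff_add_eq_0)

lemma hom_sum: "\<iota> (sum f A) = (\<Sum>x\<in>A. \<iota> (f x))"
  by (induction A rule: infinite_finite_induct) (auto simp: hom_add)

definition monomial_value :: "('x \<Rightarrow> 'r) \<Rightarrow> ('x \<Rightarrow>\<^sub>0 nat) \<Rightarrow> 'r" where
  "monomial_value a m = (\<Prod>x\<in>keys m. a x ^ lookup m x)"

definition poly_value :: "('x \<Rightarrow> 'r) \<Rightarrow> (('x \<Rightarrow>\<^sub>0 nat) \<Rightarrow>\<^sub>0 'k) \<Rightarrow> 'r" where
  "poly_value a p = (\<Sum>m\<in>keys p. \<iota> (lookup p m) * monomial_value a m)"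

lemma monomial_value_superset:
  "finite A \<Longrightarrow> keys m \<subseteq> A \<Longrightarrow> monomial_value a m = (\<Prod>x\<in>A. a x ^ lookup m x)"
  unfolding monomial_value_def by (intro prod.mono_neutral_left) (auto simp: in_keys_iff)

lemma monomial_value_add: "monomial_value a (m + n) = monomial_value a m * monomial_value a n"
proof -
  let ?A = "keys m \<union> keys n"
  have "monomial_value a (m + n) = (\<Prod>x\<in>?A. a x ^ lookup (m + n) x)"
    using keys_add[of m n] by (intro monomial_value_superset) auto
  also have "\<dots> = (\<Prod>x\<in>?A. a x ^ lookup m x) * (\<Prod>x\<in>?A. a x ^ lookup n x)"
    by (simp add: lookup_add power_add prod.distrib)
  also have "\<dots> = monomial_value a m * monomial_value a n"
    by (simp add: monomial_value_superset[of ?A])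
  finally show ?thesis .
qed

lemma poly_value_superset:
  "finite A \<Longrightarrow> keys p \<subseteq> A \<Longrightarrow>
     poly_value a p = (\<Sum>m\<in>A. \<iota> (lookup p m) * monomial_value a m)"
  unfolding poly_value_def by (intro sum.mono_neutral_left) (auto simp: in_keys_iff)

lemma poly_value_add: "poly_value a (p + q) = poly_value a p + poly_value a q"
proof -
  let ?A = "keys p \<union> keys q"
  have "poly_value a (p + q) = (\<Sum>m\<in>?A. \<iota> (lookup (p + q) m) * monomial_value a m)"
    using keys_add[of p q] by (intro poly_value_superset) auto
  also have "\<dots> = poly_value a p + poly_value a q"
    by (simp add: poly_value_superset[of ?A] lookup_add hom_add distrib_right sum.distrib)
  finally show ?thesis .
qed

lemma poly_value_0 [simp]: "poly_value a 0 = 0"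
  by (simp add: poly_value_def)

lemma poly_value_sum: "poly_value a (sum f A) = (\<Sum>x\<in>A. poly_value a (f x))"
  by (induction A rule: infinite_finite_induct) (auto simp: poly_value_add)

lemma poly_value_single: "poly_value a (single m c) = \<iota> c * monomial_value a m"
  using poly_value_superset[of "{m}" "single m c" a] by (simp split: if_splits)

lemma poly_value_mult: "poly_value a (p * q) = poly_value a p * poly_value a q"
proof -
  have "p * q = (\<Sum>m\<in>keys p. \<Sum>n\<in>keys q.
      single (m + n) (lookup p m * lookup q n))"
    by (subst (1) poly_mapping_eq_sum_single[of p], subst (1) poly_mapping_eq_sum_single[of q])
      (simp add: sum_product mult_single)
  then have "poly_value a (p * q) = (\<Sum>m\<in>keys p. \<Sum>n\<in>keys q.
      \<iota> (lookup p m * lookup q n) * monomial_value a (m + n))"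
    by (simp only: poly_value_sum poly_value_single)
  also have "\<dots> = poly_value a p * poly_value a q"
    by (simp add: poly_value_def hom_mult monomial_value_add sum_product mult_ac)
  finally show ?thesis .
qed

lemma poly_value_1 [simp]: "poly_value a 1 = 1"
  using poly_value_single[of a 0 1] by (simp add: monomial_value_def)

lemma poly_value_var [simp]: "poly_value a (single (single x (Suc 0)) 1) = a x"
  by (simp add: poly_value_single monomial_value_def)

lemma poly_value_const [simp]: "poly_value a (single 0 c) = \<iota> c"
  by (simp add: poly_value_single monomial_value_def)

end

text \<open>Monomials are compared lexicographically: the first index with different exponents
  decides, and against 0 the exponent there is positive. Hence every polynomial is finite at the
  place, with its constant term as residue.\<close>

lemma zero_le_monomial: "(0 :: nat \<Rightarrow>\<^sub>0 nat) \<le> m"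
proof transfer
  fix m :: "nat \<Rightarrow> nat"
  show "less_fun (\<lambda>k. 0) m \<or> (\<lambda>k. 0) = m"
  proof (cases "\<exists>k. m k \<noteq> 0")
    case True
    then have "0 < m (LEAST k. m k \<noteq> 0)" using LeastI_ex[OF True] by simp
    then have "less_fun (\<lambda>k. 0) m"
      unfolding less_fun_def by (intro exI[of _ "LEAST k. m k \<noteq> 0"]) (auto dest: not_less_Least)
    then show ?thesis ..
  qed auto
qed

section \<open>The symmetric algebra inside its field of fractions\<close>

locale symmetric_fraction_field = vector_space scale
  for scale :: "'k::field \<Rightarrow> 'h::ab_group_add \<Rightarrow> 'h" +
  fixes j :: "('h, 'k) free_comm_algebra set \<Rightarrow> 'f::field"
  assumes fraction_field: "is_fraction_field (symmetric_algebra scale) j"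
begin

abbreviation "free_ring \<equiv> (ring_of_type_algebra :: ('h, 'k) free_comm_algebra ring)"
abbreviation "t \<equiv> t_map scale j"
abbreviation "\<iota> \<equiv> ground_map scale j"

definition J :: "('h, 'k) free_comm_algebra \<Rightarrow> 'f" where
  "J q = j (symmetric_ideal scale +>\<^bsub>free_ring\<^esub> q)"

lemma free_ring_simps:
  "carrier free_ring = UNIV" "x \<oplus>\<^bsub>free_ring\<^esub> y = x + y" "x \<otimes>\<^bsub>free_ring\<^esub> y = x * y"
  "\<zero>\<^bsub>free_ring\<^esub> = 0" "\<one>\<^bsub>free_ring\<^esub> = 1"
  by (simp_all add: ring_of_type_algebra_def)

sublocale free: cring free_ring by (rule cring_from_type_algebra)

lemma ideal_S: "ideal (symmetric_ideal scale) free_ring"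
  unfolding symmetric_ideal_def by (rule free.genideal_ideal) (simp add: free_ring_simps)

sublocale S: ideal "symmetric_ideal scale" free_ring by (rule ideal_S)

lemma J_hom: "J \<in> ring_hom free_ring ring_of_type_algebra"
proof -
  have "j \<circ> (\<lambda>q. symmetric_ideal scale +>\<^bsub>free_ring\<^esub> q) \<in> ring_hom free_ring ring_of_type_algebra"
    using S.rcos_ring_hom fraction_field
    by (intro ring_hom_trans) (auto simp: is_fraction_field_def symmetric_algebra_def)
  then show ?thesis by (simp add: J_def[abs_def] comp_def)
qed

lemma J_simps: "J 1 = 1" "J (a + b) = J a + J b" "J (a * b) = J a * J b"
  using ring_hom_one[OF J_hom] ring_hom_add[OF J_hom, of a b] ring_hom_mult[OF J_hom, of a b]
  by (simp_all add: ring_of_type_algebra_def)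

lemma J_0 [simp]: "J 0 = 0" using J_simps(2)[of 0 0] by (simp only: add_0_right add_cancel_right_right)

lemma J_minus: "J (a - b) = J a - J b" using J_simps(2)[of "a - b" b] by (simp add: algebra_simps)

lemma J_eq_0_iff: "J q = 0 \<longleftrightarrow> q \<in> symmetric_ideal scale"
proof -
  have carrier: "symmetric_ideal scale +>\<^bsub>free_ring\<^esub> q \<in> carrier (symmetric_algebra scale)" for q
    by (auto simp: symmetric_algebra_def FactRing_def A_RCOSETS_def' free_ring_simps)
  have "J q = J 0 \<longleftrightarrow> symmetric_ideal scale +>\<^bsub>free_ring\<^esub> q = symmetric_ideal scale +>\<^bsub>free_ring\<^esub> 0"
    using fraction_field carrier unfolding is_fraction_field_def J_def by (auto dest: inj_onD)
  also have "\<dots> \<longleftrightarrow> q \<in> symmetric_ideal scale"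
    using S.a_rcos_const[of q] S.a_rcos_const[of 0] S.a_rcos_self[of q] S.zero_closed
    by (auto simp: free_ring_simps)
  finally show ?thesis by simp
qed

lemma J_fraction: "\<exists>a b. J b \<noteq> 0 \<and> z = J a / J b"
proof -
  obtain A B where AB: "A \<in> carrier (symmetric_algebra scale)" "B \<in> carrier (symmetric_algebra scale)"
    "B \<noteq> \<zero>\<^bsub>symmetric_algebra scale\<^esub>" "z = j A / j B"
    using fraction_field unfolding is_fraction_field_def by blast
  then obtain a b where ab: "A = symmetric_ideal scale +>\<^bsub>free_ring\<^esub> a" "B = symmetric_ideal scale +>\<^bsub>free_ring\<^esub> b"
    by (auto simp: symmetric_algebra_def FactRing_def A_RCOSETS_def')
  have "b \<notin> symmetric_ideal scale"
    using AB(3) S.a_rcos_const[of b] by (auto simp: ab symmetric_algebra_def FactRing_def)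
  then show ?thesis using AB ab J_eq_0_iff[of b] by (auto simp: J_def)
qed

lemma t_eq: "t h = J (free_var h)" and \<iota>_eq: "\<iota> c = J (free_const c)"
  by (simp_all add: t_map_def ground_map_def J_def)

sublocale ground: ring_hom_on_types \<iota>
  by unfold_locales
    (simp_all add: \<iota>_eq J_simps(2,3)[symmetric] free_const_def mult_single single_add J_simps(1))

lemma t_add: "t (x + y) = t x + t y"
proof -
  have "free_var (x + y) - free_var x - free_var y \<in> symmetric_ideal scale"
    unfolding symmetric_ideal_def by (rule subsetD[OF free.genideal_self]) (auto simp: free_ring_simps)
  then show ?thesis unfolding J_eq_0_iff[symmetric] by (simp add: J_minus t_eq diff_eq_eq add.commute)
qed

lemma t_scale: "t (scale c x) = \<iota> c * t x"
proof -
  have "free_var (scale c x) - free_const c * free_var x \<in> symmetric_ideal scale"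
    unfolding symmetric_ideal_def by (rule subsetD[OF free.genideal_self]) (auto simp: free_ring_simps)
  then show ?thesis unfolding J_eq_0_iff[symmetric] by (simp add: J_minus J_simps t_eq \<iota>_eq)
qed

lemma t_0 [simp]: "t 0 = 0" using t_add[of 0 0] by (simp only: add_0_right add_cancel_right_right)

lemma t_sum: "t (sum f A) = (\<Sum>x\<in>A. t (f x))"
  by (induction A rule: infinite_finite_induct) (auto simp: t_add)

text \<open>
  In the coordinates \<open>t\<^sub>e - \<lambda>(e)\<close> the symmetric algebra is a polynomial ring, and the place is
  the one attached to the lowest monomial, centred at the point \<open>\<lambda>\<close> of the dual space.
\<close>
lemma place_at_point:
  assumes fin: "finite E" "independent E" "span E = UNIV" and lin: "Vector_Spaces.linear scale (*) l"
  obtains P where "ring_place \<iota> P" "\<And>h. P (t h) (l h)"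
proof -
  interpret l: Vector_Spaces.linear scale "(*)" l by (rule lin)
  define r where "r h e = representation E h e" for h e
  have expand: "h = (\<Sum>e\<in>E. scale (r h e) e)" for h
    unfolding r_def using sum_representation_eq[OF fin(2), of h E] fin by simp
  have r_add: "r (x + y) e = r x e + r y e" and r_scale: "r (scale c x) e = c * r x e" for x y c e
    unfolding r_def using fin by (simp_all add: representation_add representation_scale)
  \<comment> \<open>The variables are numbered because the order on monomials needs a linear order
    on their indices, which \<open>H\<close> does not carry.\<close>
  obtain idx :: "'h \<Rightarrow> nat" where idx: "inj_on idx E"
    using finite_imp_inj_to_nat_seg[OF fin(1)] by blast
  define con :: "'k \<Rightarrow> (nat \<Rightarrow>\<^sub>0 nat) \<Rightarrow>\<^sub>0 'k" where "con = single 0"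
  define mvar :: "nat \<Rightarrow> (nat \<Rightarrow>\<^sub>0 nat) \<Rightarrow>\<^sub>0 'k" where "mvar i = single (single i 1) 1" for i
  interpret con: ring_hom_on_types con
    by unfold_locales (simp_all add: con_def mult_single single_add)
  \<comment> \<open>The variable with number \<open>idx e\<close> stands for
    \<open>t e - \<iota> (l e)\<close>, so that the image of \<open>free_var h\<close> has constant
    term \<open>l h\<close>.\<close>
  define \<phi> where "\<phi> = con.poly_value (\<lambda>h. (\<Sum>e\<in>E. con (r h e) * mvar (idx e)) + con (l h))"
  have \<phi>_var: "\<phi> (free_var h) = (\<Sum>e\<in>E. con (r h e) * mvar (idx e)) + con (l h)" for h
    by (simp add: \<phi>_def free_var_def)
  have \<phi>_const: "\<phi> (free_const c) = con c" for c
    by (simp add: \<phi>_def free_const_def)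
  have \<phi>: "\<phi> 1 = 1" "\<phi> (a + b) = \<phi> a + \<phi> b" "\<phi> (a * b) = \<phi> a * \<phi> b" for a b
    by (simp_all add: \<phi>_def con.poly_value_add con.poly_value_mult)
  have \<phi>_diff: "\<phi> (a - b) = \<phi> a - \<phi> b" for a b using \<phi>(2)[of "a - b" b] by (simp add: algebra_simps)
  \<comment> \<open>Substituting back: \<open>\<psi>\<close> after \<open>\<phi>\<close> will be
    \<open>J\<close>, so the kernel of \<open>\<phi>\<close> lies in the kernel of
    \<open>J\<close>.\<close>
  define \<psi> where "\<psi> = ground.poly_value (\<lambda>i. t (inv_into E idx i) - \<iota> (l (inv_into E idx i)))"
  have \<psi>: "\<psi> (a + b) = \<psi> a + \<psi> b" "\<psi> (a * b) = \<psi> a * \<psi> b" "\<psi> (sum f A) = (\<Sum>x\<in>A. \<psi> (f x))" "\<psi> (con c) = \<iota> c"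
    for a b f and A :: "'h set" and c
    by (simp_all add: \<psi>_def ground.poly_value_add ground.poly_value_mult ground.poly_value_sum con_def)
  have \<psi>_mvar: "\<psi> (mvar (idx e)) = t e - \<iota> (l e)" if "e \<in> E" for e
    using that idx by (simp add: \<psi>_def mvar_def)
  have "J q = \<psi> (\<phi> q)" for q
  proof (induction q rule: free_comm_algebra_induct)
    case (const c)
    show ?case by (simp add: \<phi>_const \<psi> \<iota>_eq)
  next
    case (var h)
    have "\<psi> (\<phi> (free_var h)) = (\<Sum>e\<in>E. \<iota> (r h e) * (t e - \<iota> (l e))) + \<iota> (l h)"
      by (simp add: \<phi>_var \<psi> \<psi>_mvar)
    also have "\<dots> = t (\<Sum>e\<in>E. scale (r h e) e) - \<iota> (l (\<Sum>e\<in>E. scale (r h e) e)) + \<iota> (l h)"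
      by (simp add: right_diff_distrib sum_subtractf t_sum t_scale l.sum l.scale ground.hom_sum ground.hom_mult)
    also have "\<dots> = J (free_var h)" by (simp add: t_eq flip: expand)
    finally show ?case by simp
  qed (simp_all add: J_simps \<phi> \<psi>)
  \<comment> \<open>For the other inclusion, the kernel of \<open>\<phi>\<close> is an ideal, and it
    contains the generators of \<open>symmetric_ideal\<close> because the coordinates and
    \<open>l\<close> are linear.\<close>
  moreover have "\<phi> a = 0" if "J a = 0" for a
  proof -
    have "ring_hom_ring free_ring (ring_of_type_algebra :: ((nat \<Rightarrow>\<^sub>0 nat) \<Rightarrow>\<^sub>0 'k) ring) \<phi>"
      using \<phi> by (intro ring_hom_ringI2 ring_from_type_algebra) (auto simp: ring_hom_def ring_of_type_algebra_def)
    then have "ideal (a_kernel free_ring (ring_of_type_algebra :: ((nat \<Rightarrow>\<^sub>0 nat) \<Rightarrow>\<^sub>0 'k) ring) \<phi>) free_ring"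
      by (rule ring_hom_ring.kernel_is_ideal)
    moreover have "a_kernel free_ring (ring_of_type_algebra :: ((nat \<Rightarrow>\<^sub>0 nat) \<Rightarrow>\<^sub>0 'k) ring) \<phi> = {a. \<phi> a = 0}"
      by (simp add: a_kernel_def kernel_def ring_of_type_algebra_def)
    ultimately have "ideal {a. \<phi> a = 0} free_ring" by simp
    moreover have "\<phi> (free_var (x + y) - free_var x - free_var y) = 0" for x y
      by (simp add: \<phi>_diff \<phi>_var r_add l.add con.hom_add distrib_right sum.distrib)
    moreover have "\<phi> (free_var (scale c x) - free_const c * free_var x) = 0" for c x
      by (simp add: \<phi>_diff \<phi>(3) \<phi>_var \<phi>_const r_scale l.scale con.hom_mult distrib_left sum_distrib_left mult.assoc)
    ultimately have "symmetric_ideal scale \<subseteq> {a. \<phi> a = 0}"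
      unfolding symmetric_ideal_def by (intro free.genideal_minimal) blast+
    then show ?thesis using that by (auto simp: J_eq_0_iff)
  qed
  ultimately have ker: "J a = 0 \<longleftrightarrow> \<phi> a = 0" for a
    using ground.poly_value_0 by (auto simp: \<psi>_def)
  have phi_const_single: "\<phi> (free_const c) = single 0 c" for c by (simp add: \<phi>_const con_def)
  have const: "J (free_const (c + d)) = J (free_const c) + J (free_const d)"
    "J (free_const (c * d)) = J (free_const c) * J (free_const d)" "J (free_const 1) = 1" for c d
    using ground.hom_add[of c d] ground.hom_mult[of c d] ground.hom_one by (simp_all add: \<iota>_eq)
  obtain P where P: "ring_place (\<lambda>c. J (free_const c)) P"
    "\<And>a c. (\<And>x. x \<in> keys (\<phi> a) \<Longrightarrow> 0 \<le> x) \<Longrightarrow> lookup (\<phi> a) 0 = c \<Longrightarrow> P (J a) c"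
    using place_from_lowest_term[of J \<phi> free_const, OF J_simps \<phi> ker J_fraction phi_const_single const] by blast
  have "lookup (con c * mvar i) 0 = 0" for c i
  proof -
    have "single i (Suc 0) \<noteq> (0 :: nat \<Rightarrow>\<^sub>0 nat)"
      by (metis lookup_single_eq lookup_zero nat.simps(3))
    then show ?thesis by (simp add: con_def mvar_def mult_single lookup_single)
  qed
  then have "lookup (\<phi> (free_var h)) 0 = l h" for h
    by (simp add: \<phi>_var lookup_add lookup_sum) (simp add: con_def)
  then have "P (t h) (l h)" for h
    unfolding t_eq by (intro P(2)) (rule zero_le_monomial)
  then show ?thesis using that P(1) by (simp add: \<iota>_eq[abs_def])
qed

end


section \<open>Sweedler sums in a basis\<close>

lemma algebra_on_simps [simp]:
  "carrier (algebra_on s C) = C" "x \<oplus>\<^bsub>algebra_on s C\<^esub> y = x + y" "x \<otimes>\<^bsub>algebra_on s C\<^esub> y = x * y"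
  "\<zero>\<^bsub>algebra_on s C\<^esub> = 0" "\<one>\<^bsub>algebra_on s C\<^esub> = 1" "c \<odot>\<^bsub>algebra_on s C\<^esub> x = s c x"
  by (simp_all add: algebra_on_def)

lemma ground_ring_simps [simp]:
  "carrier ring_of_type_algebra = UNIV" "x \<oplus>\<^bsub>ring_of_type_algebra\<^esub> y = x + y"
  "x \<otimes>\<^bsub>ring_of_type_algebra\<^esub> y = x * y" "\<zero>\<^bsub>ring_of_type_algebra\<^esub> = 0" "\<one>\<^bsub>ring_of_type_algebra\<^esub> = 1"
  by (simp_all add: ring_of_type_algebra_def)

lemma nonassoc_algebra_algebra_on:
  fixes C :: "'a::ring_1 set"
  assumes "0 \<in> C" "\<And>x y. x \<in> C \<Longrightarrow> y \<in> C \<Longrightarrow> x + y \<in> C" "\<And>x. x \<in> C \<Longrightarrow> - x \<in> C"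
    "\<And>x y. x \<in> C \<Longrightarrow> y \<in> C \<Longrightarrow> x * y \<in> C" "\<And>r x. r \<in> carrier R \<Longrightarrow> x \<in> C \<Longrightarrow> s r x \<in> C"
    and s: "\<And>r x y. r \<in> carrier R \<Longrightarrow> x \<in> C \<Longrightarrow> y \<in> C \<Longrightarrow> s r x * y = s r (x * y)"
    "\<And>r x y. r \<in> carrier R \<Longrightarrow> x \<in> C \<Longrightarrow> y \<in> C \<Longrightarrow> x * s r y = s r (x * y)"
  shows "nonassoc_algebra R (algebra_on s C)"
proof (rule nonassoc_algebra.intro)
  show "abelian_group (algebra_on s C)"
    by (rule abelian_groupI) (auto simp: assms(1,2) add_ac intro: bexI[OF _ assms(3)])
qed (auto simp: assms algebra_simps)

text \<open>The scalar only crosses between the arguments, so values may lie in \<open>H\<close>, in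
  \<open>k\<close>, in \<open>K\<close> or in a function space without a scalar multiplication on
  the target being named.\<close>

definition bilinear_map :: "('k \<Rightarrow> 'h \<Rightarrow> 'h) \<Rightarrow> ('h::ab_group_add \<Rightarrow> 'h \<Rightarrow> 'c::ab_group_add) \<Rightarrow> bool" where
  "bilinear_map s f \<longleftrightarrow> (\<forall>x x' y. f (x + x') y = f x y + f x' y) \<and> (\<forall>x y y'. f x (y + y') = f x y + f x y') \<and>
     (\<forall>c x y. f (s c x) y = f x (s c y))"

definition trilinear_map :: "('k \<Rightarrow> 'h \<Rightarrow> 'h) \<Rightarrow> ('h::ab_group_add \<Rightarrow> 'h \<Rightarrow> 'h \<Rightarrow> 'c::ab_group_add) \<Rightarrow> bool" where
  "trilinear_map s f \<longleftrightarrow> (\<forall>x. bilinear_map s (f x)) \<and> (\<forall>y. bilinear_map s (\<lambda>x z. f x y z)) \<and> (\<forall>z. bilinear_map s (\<lambda>x y. f x y z))"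

locale finite_hopf_algebra = hopf_algebra scale \<Delta> \<epsilon> antipode
  for scale :: "'k::field \<Rightarrow> 'h::ring_1 \<Rightarrow> 'h" and \<Delta> \<epsilon> antipode +
  fixes E :: "'h set"
  assumes finite_E: "finite E" and independent_E: "independent E" and span_E: "span E = UNIV"
begin

definition coord :: "'h \<Rightarrow> 'h \<Rightarrow> 'k" where "coord e x = representation E x e"

lemma coord_expand: "(\<Sum>e\<in>E. scale (coord e x) e) = x"
  unfolding coord_def using sum_representation_eq[OF independent_E, of x E] finite_E span_E by simp

lemma coord_add: "coord e (x + y) = coord e x + coord e y"
  and coord_scale: "coord e (scale c x) = c * coord e x"
  unfolding coord_def using independent_E span_E by (simp_all add: representation_add representation_scale)

lemma coord_basis: "e \<in> E \<Longrightarrow> coord e' e = (if e' = e then 1 else 0)"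
  unfolding coord_def using representation_basis[OF independent_E] by simp

lemma coord_outside: "e \<notin> E \<Longrightarrow> coord e x = 0"
  unfolding coord_def using representation_ne_zero by blast

abbreviation "Hm \<equiv> algebra_on scale (UNIV :: 'h set) :: ('k, 'h) module"
abbreviation "G0 \<equiv> ring_of_type_algebra :: 'k ring"

lemma nonassoc_algebra_H: "nonassoc_algebra G0 Hm"
  by (rule nonassoc_algebra_algebra_on) (auto simp: scale_mult_left scale_mult_right)

sublocale HH: tensor_product_algebra G0 Hm Hm
  by (intro tensor_product_algebra.intro nonassoc_algebra_H)

lemma balanced_map_H:
  assumes "bilinear_map scale f"
  shows "balanced_map G0 Hm Hm type_group f"
  using assms by (intro balanced_mapI) (simp_all add: bilinear_map_def)

lemma comult_closed: "\<Delta> x \<in> carrier HH.TG"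
  using ring_hom_closed[OF comult_ring_hom, of x] by (simp add: carrier_tensor_algebra)

lemma comult_add: "\<Delta> (x + y) = \<Delta> x \<otimes>\<^bsub>HH.TG\<^esub> \<Delta> y"
  using ring_hom_add[OF comult_ring_hom, of x y] by (simp add: add_tensor_algebra)

text \<open>Coordinates of the comultiplication: \<Delta> x is the sum over the basis of the tensors
  of \<open>e\<close> with \<open>D e x\<close>. Sweedler sums thereby become finite sums over
  \<open>E\<close>, which can be interchanged freely.\<close>

definition D :: "'h \<Rightarrow> 'h \<Rightarrow> 'h" where
  "D e x = tensor_lift type_group (\<lambda>x1 x2. scale (coord e x1) x2) (\<Delta> x)"

lemma bilinear_D: "bilinear_map scale (\<lambda>x1 x2. scale (coord e x1) x2)"
  by (simp add: bilinear_map_def coord_add coord_scale scale_left_distrib scale_right_distrib mult.commute)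

lemma D_add: "D e (x + y) = D e x + D e y"
  unfolding D_def comult_add
  using HH.tensor_lift_mult[OF comm_group_type_group balanced_map_H[OF bilinear_D]] comult_closed by simp

lemma D_0 [simp]: "D e 0 = 0" using D_add[of e 0 0] by (simp only: add_0_right add_cancel_right_right)

lemma finprod_sum:
  assumes G: "comm_group G" and add: "\<And>x y. f (x + y) = f x \<otimes>\<^bsub>G\<^esub> f y" and closed: "\<And>x. f x \<in> carrier G"
    and A: "finite A"
  shows "f (sum g A) = finprod G (\<lambda>x. f (g x)) A"
proof -
  interpret comm_group G by fact
  have "f 0 = \<one>\<^bsub>G\<^esub>" using add[of 0 0] closed[of 0] by (simp add: l_cancel_one')
  with A show ?thesis by induction (auto simp: add closed)
qed

text \<open>The first leg is expanded in the basis. The target is an arbitrary commutative group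
  because \<Delta> is also lifted into tensor groups.\<close>

lemma tensor_lift_basis:
  fixes G :: "('c, 'n) monoid_scheme"
  assumes G: "comm_group G" and bal: "balanced_map G0 Hm Hm G f" and u: "u \<in> carrier HH.TG"
  shows "tensor_lift G f u = finprod G (\<lambda>e. f e (tensor_lift type_group (\<lambda>x1 x2. scale (coord e x1) x2) u)) E"
proof -
  interpret comm_group G by fact
  note f = balanced_mapD[OF bal, simplified]
  have closed: "f x y \<in> carrier G" for x y by (rule f)
  note d = balanced_map_H[OF bilinear_D]
  show ?thesis using u
  proof (induction rule: HH.tensor_induct)
    case (pure x y)
    have "f x y = f (\<Sum>e\<in>E. scale (coord e x) e) y" by (simp add: coord_expand)
    also have "\<dots> = finprod G (\<lambda>e. f (scale (coord e x) e) y) E"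
      by (rule finprod_sum[OF G, of "\<lambda>x. f x y"]) (auto simp: f finite_E)
    finally show ?case
      by (simp add: HH.tensor_lift_pure[OF G bal] HH.tensor_lift_pure[OF comm_group_type_group d] f)
  next
    case (mult u v)
    then show ?case
      by (simp add: HH.tensor_lift_mult[OF G bal] HH.tensor_lift_mult[OF comm_group_type_group d] f finprod_multf closed)
  qed
qed

lemma tensor_lift_comult:
  "comm_group G \<Longrightarrow> balanced_map G0 Hm Hm G f \<Longrightarrow> tensor_lift G f (\<Delta> x) = finprod G (\<lambda>e. f e (D e x)) E"
  unfolding D_def by (rule tensor_lift_basis[OF _ _ comult_closed])

definition sw :: "('h \<Rightarrow> 'h \<Rightarrow> 'c::ab_group_add) \<Rightarrow> 'h \<Rightarrow> 'c" where
  "sw f x = (\<Sum>e\<in>E. f e (D e x))"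

lemma tensor_lift_sw: "bilinear_map scale f \<Longrightarrow> tensor_lift type_group f (\<Delta> x) = sw f x"
  by (simp add: tensor_lift_comult[OF comm_group_type_group balanced_map_H] finprod_type_group sw_def)

lemma sweedler2_sw: "bilinear_map scale f \<Longrightarrow> sweedler2 \<Delta> f x = sw f x"
  by (simp add: sweedler2_def tensor_sum_eq tensor_lift_sw)

lemma smult_HH:
  "c \<odot>\<^bsub>HH scale\<^esub> u = tensor_lift HH.TG (\<lambda>x y. HH.pt (scale c x) y) u"
  by (simp add: smult_tensor_algebra)

lemma balanced_smult_HH: "balanced_map G0 Hm Hm HH.TG (\<lambda>x y. HH.pt (scale c x) y)"
proof (rule balanced_mapI)
  show "HH.pt (scale c (r \<odot>\<^bsub>Hm\<^esub> x)) y = HH.pt (scale c x) (r \<odot>\<^bsub>Hm\<^esub> y)" for r x y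
    using HH.pt_smult[of r "scale c x" y] by (simp add: mult.commute)
qed (simp_all add: scale_right_distrib HH.pt_add_left[simplified] HH.pt_add_right[simplified])

lemma smult_HH_pure: "c \<odot>\<^bsub>HH scale\<^esub> HH.pt x y = HH.pt (scale c x) y"
  by (simp add: smult_HH HH.tensor_lift_pure[OF HH.comm_group_TG balanced_smult_HH])

lemma smult_HH_mult: "u \<in> carrier HH.TG \<Longrightarrow> v \<in> carrier HH.TG \<Longrightarrow>
    c \<odot>\<^bsub>HH scale\<^esub> (u \<otimes>\<^bsub>HH.TG\<^esub> v) = (c \<odot>\<^bsub>HH scale\<^esub> u) \<otimes>\<^bsub>HH.TG\<^esub> (c \<odot>\<^bsub>HH scale\<^esub> v)"
  unfolding smult_HH by (rule HH.tensor_lift_mult[OF HH.comm_group_TG balanced_smult_HH])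

lemma smult_HH_closed: "u \<in> carrier HH.TG \<Longrightarrow> c \<odot>\<^bsub>HH scale\<^esub> u \<in> carrier HH.TG"
  unfolding smult_HH by (rule HH.tensor_lift_closed[OF HH.comm_group_TG balanced_smult_HH])

lemma D_scale: "D e (scale c x) = scale c (D e x)"
proof -
  have "D e (scale c x) = tensor_lift type_group (\<lambda>x1 x2. scale (coord e x1) x2)
      (tensor_lift HH.TG (\<lambda>x y. HH.pt (scale c x) y) (\<Delta> x))"
    by (simp add: D_def comult_scale smult_HH)
  also have "\<dots> = tensor_lift type_group (\<lambda>x y. tensor_lift type_group (\<lambda>x1 x2. scale (coord e x1) x2) (HH.pt (scale c x) y)) (\<Delta> x)"
    by (rule HH.tensor_lift_comp[OF HH.comm_group_TG comm_group_type_group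
          HH.tensor_lift_hom[OF comm_group_type_group balanced_map_H[OF bilinear_D]] balanced_smult_HH comult_closed])
  also have "\<dots> = tensor_lift type_group (\<lambda>x y. scale c (scale (coord e x) y)) (\<Delta> x)"
    by (simp add: HH.tensor_lift_pure[OF comm_group_type_group balanced_map_H[OF bilinear_D]] coord_scale)
  also have "\<dots> = scale c (D e x)"
    unfolding D_def
    by (rule HH.tensor_lift_comp[OF comm_group_type_group comm_group_type_group _ balanced_map_H[OF bilinear_D] comult_closed, symmetric])
      (simp add: hom_def scale_right_distrib)
  finally show ?thesis .
qed

lemma sw_swap: "sw (\<lambda>x1 x2. sw (\<lambda>y1 y2. f x1 x2 y1 y2) y) x = sw (\<lambda>y1 y2. sw (\<lambda>x1 x2. f x1 x2 y1 y2) x) y"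
  unfolding sw_def by (rule sum.swap)

text \<open>The multiplicativity of \<Delta>, pushed forward along the homomorphism that
  \<open>f\<close> induces on tensors.\<close>

lemma sw_mult:
  assumes f: "bilinear_map scale f"
  shows "sw f (x * y) = sw (\<lambda>x1 x2. sw (\<lambda>y1 y2. f (x1 * y1) (x2 * y2)) y) x"
proof -
  let ?L = "tensor_lift type_group f"
  have L: "?L \<in> hom HH.TG type_group"
    by (rule HH.tensor_lift_hom[OF comm_group_type_group balanced_map_H[OF f]])
  have pt: "?L (HH.pt x y) = f x y" for x y
    by (simp add: HH.tensor_lift_pure[OF comm_group_type_group balanced_map_H[OF f]])
  have inner: "?L (tensor_lift HH.TG (\<lambda>y1 y2. HH.pt (x1 * y1) (x2 * y2)) (\<Delta> y)) = sw (\<lambda>y1 y2. f (x1 * y1) (x2 * y2)) y" for x1 x2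
  proof -
    have bil: "bilinear_map scale (\<lambda>y1 y2. f (x1 * y1) (x2 * y2))"
      using f by (simp add: bilinear_map_def distrib_left scale_mult_right)
    have "balanced_map G0 Hm Hm HH.TG (\<lambda>y1 y2. HH.pt (x1 * y1) (x2 * y2))"
      using HH.mult.bal[of x1 x2] by simp
    from HH.tensor_lift_comp[OF HH.comm_group_TG comm_group_type_group L this comult_closed]
    show ?thesis by (simp add: pt tensor_lift_sw[OF bil])
  qed
  have "\<Delta> (x * y) = HH.mult.lift2 (\<Delta> x) (\<Delta> y)"
    using ring_hom_mult[OF comult_ring_hom, of x y] by (simp add: HH.tensor_algebra_mult)
  then have "sw f (x * y) = ?L (HH.mult.lift2 (\<Delta> x) (\<Delta> y))"
    by (simp flip: tensor_lift_sw[OF f])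
  also have "\<dots> = tensor_lift type_group (\<lambda>x1 x2. ?L (tensor_lift HH.TG (\<lambda>y1 y2. HH.pt (x1 * y1) (x2 * y2)) (\<Delta> y))) (\<Delta> x)"
    unfolding HH.mult.lift2_def
    using HH.tensor_lift_comp[OF HH.comm_group_TG comm_group_type_group L HH.mult.balanced_inner[OF comult_closed] comult_closed] by simp
  also have "\<dots> = sw (\<lambda>x1 x2. sw (\<lambda>y1 y2. f (x1 * y1) (x2 * y2)) y) x"
  proof -
    have "bilinear_map scale (\<lambda>x1 x2. sw (\<lambda>y1 y2. f (x1 * y1) (x2 * y2)) y)"
      using f by (simp add: bilinear_map_def sw_def distrib_right sum.distrib scale_mult_left)
    then show ?thesis by (simp add: inner tensor_lift_sw)
  qed
  finally show ?thesis .
qed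

lemma sw_one:
  assumes f: "bilinear_map scale f"
  shows "sw f 1 = f 1 1"
proof -
  have "\<Delta> 1 = HH.pt 1 1"
    using ring_hom_one[OF comult_ring_hom] by (simp add: one_tensor_algebra)
  then show ?thesis
    using tensor_lift_sw[OF f, of 1] HH.tensor_lift_pure[OF comm_group_type_group balanced_map_H[OF f], of 1 1] by simp
qed

lemma \<epsilon>_add: "\<epsilon> (x + y) = \<epsilon> x + \<epsilon> y" and \<epsilon>_scale: "\<epsilon> (scale c x) = c * \<epsilon> x"
proof -
  interpret Vector_Spaces.linear scale "(*)" \<epsilon> by (rule counit_linear)
  show "\<epsilon> (x + y) = \<epsilon> x + \<epsilon> y" "\<epsilon> (scale c x) = c * \<epsilon> x" by (simp_all add: add scale)
qed

lemma sw_counit_left: "sw (\<lambda>x1 x2. scale (\<epsilon> x1) x2) x = x"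
proof -
  have "bilinear_map scale (\<lambda>x1 x2. scale (\<epsilon> x1) x2)"
    by (simp add: bilinear_map_def \<epsilon>_add \<epsilon>_scale scale_left_distrib scale_right_distrib mult.commute)
  then show ?thesis using counit_left[of x] by (simp add: tensor_sum_eq tensor_lift_sw)
qed

lemma sw_counit_right: "sw (\<lambda>x1 x2. scale (\<epsilon> x2) x1) x = x"
proof -
  have "bilinear_map scale (\<lambda>x1 x2. scale (\<epsilon> x2) x1)"
    by (simp add: bilinear_map_def \<epsilon>_add \<epsilon>_scale scale_left_distrib scale_right_distrib mult.commute)
  then show ?thesis using counit_right[of x] by (simp add: tensor_sum_eq tensor_lift_sw)
qed

lemma abelian_group_HH: "abelian_group (HH scale)"
  by (rule abelian_group_of_comm_group[OF HH.comm_group_TG])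
    (simp_all add: carrier_tensor_algebra add_tensor_algebra zero_tensor_algebra)

sublocale HHH: tensor_product G0 Hm "HH scale"
  using nonassoc_algebra.abelian[OF nonassoc_algebra_H]
  by (intro tensor_product.intro abelian_group_HH) (auto simp: carrier_tensor_algebra smult_HH_closed)

text \<open>Coassociativity is an equation in the threefold tensor product. The homomorphism
  \<open>L\<close> induced by the trilinear \<open>f\<close> turns its two sides into the two
  iterated sums.\<close>

lemma sw_coassoc:
  assumes f: "trilinear_map scale f"
  shows "sw (\<lambda>x' x3. sw (\<lambda>x1 x2. f x1 x2 x3) x') x = sw (\<lambda>x1 x'. sw (\<lambda>x2 x3. f x1 x2 x3) x') x"
proof -
  let ?G = "add_monoid (HHH scale)"
  have abelian: "abelian_group (HHH scale)"
    by (rule abelian_group_of_comm_group[OF HHH.comm_group_TG])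
      (simp_all add: carrier_tensor_algebra add_tensor_algebra zero_tensor_algebra)
  then interpret G: comm_group ?G by (rule abelian_group.a_comm_group)
  have G: "comm_group ?G" ..
  have G_mult: "a \<otimes>\<^bsub>?G\<^esub> b = a \<otimes>\<^bsub>HHH.TG\<^esub> b" and G_carrier: "carrier ?G = carrier HHH.TG" for a b
    by (simp_all add: add_tensor_algebra carrier_tensor_algebra)
  have f1: "bilinear_map scale (f x)" and f2: "bilinear_map scale (\<lambda>x z. f x y z)"
    and f3: "bilinear_map scale (\<lambda>x y. f x y z)" for x y z
    using f by (auto simp: trilinear_map_def)
  define g where "g x1 u = tensor_lift type_group (f x1) u" for x1 u
  have g_pt: "g x1 (HH.pt x2 x3) = f x1 x2 x3" for x1 x2 x3
    using HH.tensor_lift_pure[OF comm_group_type_group balanced_map_H[OF f1]] by (simp add: g_def)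
  have g_mult: "g x1 (u \<otimes>\<^bsub>HH.TG\<^esub> v) = g x1 u + g x1 v" if "u \<in> carrier HH.TG" "v \<in> carrier HH.TG" for x1 u v
    using HH.tensor_lift_mult[OF comm_group_type_group balanced_map_H[OF f1] that] by (simp add: g_def)
  have g: "balanced_map G0 Hm (HH scale) type_group g"
  proof (rule balanced_mapI)
    show "g (x \<oplus>\<^bsub>Hm\<^esub> x') u = g x u \<otimes>\<^bsub>type_group\<^esub> g x' u" if "u \<in> carrier (HH scale)" for x x' u
    proof -
      have "u \<in> carrier HH.TG" using that by (simp add: carrier_tensor_algebra)
      then show ?thesis
        by (induction rule: HH.tensor_induct) (use f2 in \<open>auto simp: g_pt g_mult bilinear_map_def\<close>)
    qed
    show "g (r \<odot>\<^bsub>Hm\<^esub> x) u = g x (r \<odot>\<^bsub>HH scale\<^esub> u)" if "u \<in> carrier (HH scale)" for r x u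
    proof -
      have "u \<in> carrier HH.TG" using that by (simp add: carrier_tensor_algebra)
      then show ?thesis
        by (induction rule: HH.tensor_induct)
          (use f3 in \<open>auto simp: g_pt g_mult bilinear_map_def smult_HH_pure smult_HH_mult smult_HH_closed\<close>)
    qed
    show "g x (u \<oplus>\<^bsub>HH scale\<^esub> v) = g x u \<otimes>\<^bsub>type_group\<^esub> g x v"
      if "u \<in> carrier (HH scale)" "v \<in> carrier (HH scale)" for x u v
      using that by (simp add: g_mult carrier_tensor_algebra add_tensor_algebra)
  qed simp
  define L where "L = tensor_lift type_group g"
  have "L \<in> hom HHH.TG type_group"
    unfolding L_def by (rule HHH.tensor_lift_hom[OF comm_group_type_group g])
  then have L: "L \<in> hom ?G type_group"
    unfolding hom_def G_mult G_carrier .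
  have L_pt: "L (HHH.pt x1 u) = g x1 u" if "u \<in> carrier HH.TG" for x1 u
    using HHH.tensor_lift_pure[OF comm_group_type_group g] that by (simp add: L_def carrier_tensor_algebra)
  have pt_add_right: "HHH.pt x (u \<otimes>\<^bsub>HH.TG\<^esub> v) = HHH.pt x u \<otimes>\<^bsub>?G\<^esub> HHH.pt x v"
    if "u \<in> carrier HH.TG" "v \<in> carrier HH.TG" for x u v
    using HHH.pt_add_right[of x u v] that by (simp add: carrier_tensor_algebra add_tensor_algebra)
  have pt_add_left: "HHH.pt (x + x') u = HHH.pt x u \<otimes>\<^bsub>?G\<^esub> HHH.pt x' u" if "u \<in> carrier HH.TG" for x x' u
    using HHH.pt_add_left[of x x' u] that by (simp add: carrier_tensor_algebra add_tensor_algebra)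
  have pt_smult: "HHH.pt (scale c x) u = HHH.pt x (c \<odot>\<^bsub>HH scale\<^esub> u)" if "u \<in> carrier HH.TG" for c x u
    using HHH.pt_smult[of c x u] that by (simp add: carrier_tensor_algebra)
  have pt_closed: "HHH.pt x u \<in> carrier ?G" if "u \<in> carrier HH.TG" for x u
    using HHH.pt_closed[of x u] that by (simp add: carrier_tensor_algebra)
  have R_bal: "balanced_map G0 Hm Hm ?G (\<lambda>x1 x'. HHH.pt x1 (\<Delta> x'))"
    by (rule balanced_mapI)
      (simp_all only: algebra_on_simps pt_closed pt_add_left pt_add_right pt_smult comult_closed comult_add comult_scale)
  have R: "L (tensor_lift ?G (\<lambda>x1 x'. HHH.pt x1 (\<Delta> x')) (\<Delta> x)) = sw (\<lambda>x1 x'. sw (\<lambda>x2 x3. f x1 x2 x3) x') x"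
  proof -
    have bil: "bilinear_map scale (\<lambda>x1 x'. sw (\<lambda>x2 x3. f x1 x2 x3) x')"
      using f1 f2 f3 by (simp add: bilinear_map_def sw_def D_add D_scale sum.distrib)
    show ?thesis
      using HH.tensor_lift_comp[OF G comm_group_type_group L R_bal comult_closed]
      by (simp add: L_pt comult_closed g_def tensor_lift_sw f1 bil)
  qed
  have M_bal: "balanced_map G0 Hm Hm ?G (\<lambda>x1 x2. HHH.pt x1 (HH.pt x2 x3))" for x3
    by (rule balanced_mapI)
      (simp_all only: algebra_on_simps pt_closed pt_add_left pt_add_right pt_smult HH.pt_closed UNIV_I
        HH.pt_add_left[simplified] smult_HH_pure)
  have M: "L (tensor_lift ?G (\<lambda>x1 x2. HHH.pt x1 (HH.pt x2 x3)) (\<Delta> x')) = sw (\<lambda>x1 x2. f x1 x2 x3) x'" for x' x3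
    using HH.tensor_lift_comp[OF G comm_group_type_group L M_bal comult_closed]
    by (simp add: L_pt g_pt tensor_lift_sw f3)
  \<comment> \<open>In this form the inner lift is a product of terms that are visibly balanced in
    \<open>x'\<close> and \<open>x3\<close>, which is what the outer lift requires.\<close>
  have M_eq: "tensor_lift ?G (\<lambda>x1 x2. HHH.pt x1 (HH.pt x2 x3)) (\<Delta> x') =
      finprod ?G (\<lambda>e. HHH.pt e (HH.pt (D e x') x3)) E" for x' x3
    by (rule tensor_lift_comult[OF G M_bal])
  have HH_pt: "HH.pt x y \<in> carrier HH.TG" for x y by simp
  have L_bal: "balanced_map G0 Hm Hm ?G (\<lambda>x' x3. tensor_lift ?G (\<lambda>x1 x2. HHH.pt x1 (HH.pt x2 x3)) (\<Delta> x'))"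
    unfolding M_eq
  proof (rule balanced_mapI)
    show "finprod ?G (\<lambda>e. HHH.pt e (HH.pt (D e x) y)) E \<in> carrier ?G" for x y
      by (rule G.finprod_closed) (rule funcsetI, rule pt_closed[OF HH_pt])
    show "finprod ?G (\<lambda>e. HHH.pt e (HH.pt (D e (x \<oplus>\<^bsub>Hm\<^esub> x')) y)) E =
        finprod ?G (\<lambda>e. HHH.pt e (HH.pt (D e x) y)) E \<otimes>\<^bsub>?G\<^esub> finprod ?G (\<lambda>e. HHH.pt e (HH.pt (D e x') y)) E" for x x' y
      using G.finprod_multf[of "\<lambda>e. HHH.pt e (HH.pt (D e x) y)" E "\<lambda>e. HHH.pt e (HH.pt (D e x') y)",
          OF funcsetI funcsetI, OF pt_closed[OF HH_pt] pt_closed[OF HH_pt]]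
      by (simp only: algebra_on_simps D_add HH.pt_add_left[simplified] pt_add_right HH_pt)
    show "finprod ?G (\<lambda>e. HHH.pt e (HH.pt (D e x) (y \<oplus>\<^bsub>Hm\<^esub> y'))) E =
        finprod ?G (\<lambda>e. HHH.pt e (HH.pt (D e x) y)) E \<otimes>\<^bsub>?G\<^esub> finprod ?G (\<lambda>e. HHH.pt e (HH.pt (D e x) y')) E" for x y y'
      using G.finprod_multf[of "\<lambda>e. HHH.pt e (HH.pt (D e x) y)" E "\<lambda>e. HHH.pt e (HH.pt (D e x) y')",
          OF funcsetI funcsetI, OF pt_closed[OF HH_pt] pt_closed[OF HH_pt]]
      by (simp only: algebra_on_simps HH.pt_add_right[simplified] pt_add_right HH_pt)
    show "finprod ?G (\<lambda>e. HHH.pt e (HH.pt (D e (r \<odot>\<^bsub>Hm\<^esub> x)) y)) E =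
        finprod ?G (\<lambda>e. HHH.pt e (HH.pt (D e x) (r \<odot>\<^bsub>Hm\<^esub> y))) E" for r x y
      by (simp add: D_scale HH.pt_smult[simplified])
  qed
  have Lh: "L (tensor_lift ?G (\<lambda>x' x3. tensor_lift ?G (\<lambda>x1 x2. HHH.pt x1 (HH.pt x2 x3)) (\<Delta> x')) (\<Delta> x)) =
      sw (\<lambda>x' x3. sw (\<lambda>x1 x2. f x1 x2 x3) x') x"
  proof -
    have bil: "bilinear_map scale (\<lambda>x' x3. sw (\<lambda>x1 x2. f x1 x2 x3) x')"
      using f1 f2 f3 by (simp add: bilinear_map_def sw_def D_add D_scale sum.distrib)
    show ?thesis
      using HH.tensor_lift_comp[OF G comm_group_type_group L L_bal comult_closed]
      by (simp add: M tensor_lift_sw bil)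
  qed
  show ?thesis using Lh R coassoc[of x] by simp
qed

end


section \<open>Convolution of functionals and bilinear forms\<close>

text \<open>Dimension count: if \<open>w\<close> were missed, the image of a basis together with
  \<open>w\<close> would be an independent subset of the span with more elements than the
  basis.\<close>

lemma (in vector_space) linear_injective_on_span_surj:
  assumes L: "Vector_Spaces.linear scale scale L" and S: "finite S" and stable: "L ` span S \<subseteq> span S"
    and inj: "\<And>v. v \<in> span S \<Longrightarrow> L v = 0 \<Longrightarrow> v = 0" and w: "w \<in> span S"
  shows "\<exists>v\<in>span S. L v = w"
proof (rule ccontr)
  assume no: "\<not> ?thesis"
  interpret L: Vector_Spaces.linear scale scale L by (rule L)
  obtain B where B: "B \<subseteq> span S" "independent B" "span S \<subseteq> span B"
    using basis_exists[of "span S"] by metis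
  have span_B: "span B = span S"
    using B span_mono[OF B(1)] by (auto simp: span_span)
  have finite_B: "finite B" using independent_span_bound[OF S B(2,1)] by simp
  have inj_on: "inj_on L (span B)"
    unfolding L.inj_on_iff_eq_0[OF subspace_span] using inj by (auto simp: span_B)
  have ind: "independent (L ` B)"
    by (rule L.independent_injective_image[OF B(2) inj_on])
  have "w \<notin> span (L ` B)"
    using no unfolding L.span_image span_B by auto
  then have "independent (insert w (L ` B))" using ind by (simp add: independent_insert)
  moreover have "insert w (L ` B) \<subseteq> span B"
    using stable B(1) w unfolding span_B by auto
  ultimately have "card (insert w (L ` B)) \<le> card B"
    using independent_span_bound[OF finite_B] by blast
  moreover have "w \<notin> L ` B" using \<open>w \<notin> span (L ` B)\<close> span_base by blast
  moreover have "card (L ` B) = card B"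
    using inj_on_subset[OF inj_on span_superset] by (rule card_image)
  ultimately show False using finite_B by simp
qed

text \<open>All coordinate vectors live in one large function space over the field; the spaces of
  interest are spans inside it.\<close>

definition fun_scale :: "'f::field \<Rightarrow> ('i \<Rightarrow> 'f) \<Rightarrow> 'i \<Rightarrow> 'f" where
  "fun_scale c v = (\<lambda>x. c * v x)"

interpretation fun_space: vector_space fun_scale
  by unfold_locales (auto simp: fun_scale_def fun_eq_iff algebra_simps)

lemma fun_sum_apply: "(\<Sum>i\<in>A. f i) x = (\<Sum>i\<in>A. f i x)" for f :: "'a \<Rightarrow> 'i \<Rightarrow> 'f::comm_monoid_add"
  by (induction A rule: infinite_finite_induct) auto

text \<open>
  An operator that reduces to the identity modulo the place is invertible: a kernel element,
  rescaled so that its residue is nonzero, would have zero residue.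
\<close>
lemma (in ring_place) surj_of_residue_identity:
  fixes S :: "('i \<Rightarrow> 'f) set"
  assumes L: "Vector_Spaces.linear fun_scale fun_scale L" and S: "finite S"
    and stable: "L ` fun_space.span S \<subseteq> fun_space.span S" and A: "finite A"
    and ext: "\<And>v. v \<in> fun_space.span S \<Longrightarrow> (\<And>x. x \<in> A \<Longrightarrow> \<exists>c. P (v x) c) \<Longrightarrow> \<forall>x. \<exists>c. P (v x) c"
    and nonzero: "\<And>v. v \<in> fun_space.span S \<Longrightarrow> (\<And>x. x \<in> A \<Longrightarrow> v x = 0) \<Longrightarrow> v = 0"
    and red: "\<And>v r x. v \<in> fun_space.span S \<Longrightarrow> (\<And>x. P (v x) (r x)) \<Longrightarrow> P (L v x) (r x)"
    and w: "w \<in> fun_space.span S"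
  shows "\<exists>v\<in>fun_space.span S. L v = w"
proof (rule fun_space.linear_injective_on_span_surj[OF L S stable _ w])
  interpret L: Vector_Spaces.linear fun_scale fun_scale L by (rule L)
  fix v assume v: "v \<in> fun_space.span S" and Lv: "L v = 0"
  show "v = 0"
  proof (rule ccontr)
    assume "v \<noteq> 0"
    then obtain x where "x \<in> A" "v x \<noteq> 0" using nonzero[OF v] by blast
    then obtain x0 where x0: "x0 \<in> A" "v x0 \<noteq> 0" "\<And>x. x \<in> A \<Longrightarrow> \<exists>c. P (v x / v x0) c"
      using scale_into_place[OF A] by blast
    let ?v = "fun_scale (1 / v x0) v"
    have v': "?v \<in> fun_space.span S" using v by (rule fun_space.span_scale)
    have "\<forall>x. \<exists>c. P (?v x) c" using x0(3) by (intro ext[OF v']) (simp add: fun_scale_def)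
    then obtain r where r: "\<And>x. P (?v x) (r x)" by metis
    have "L ?v = 0" by (simp add: L.scale Lv)
    then have "P 0 (r x0)" using red[OF v' r, of x0] by simp
    then have "r x0 = 0" using P_0 P_unique by blast
    moreover have "P 1 (r x0)" using r[of x0] x0(2) by (simp add: fun_scale_def)
    ultimately show False using P_1 P_unique by fastforce
  qed
qed

lemma (in finite_hopf_algebra) sweedler3_sw:
  assumes "trilinear_map scale f"
  shows "sweedler3 \<Delta> f x = sw (\<lambda>x1 x'. sw (\<lambda>x2 x3. f x1 x2 x3) x') x"
proof -
  have f: "bilinear_map scale (f x)" "bilinear_map scale (\<lambda>x z. f x y z)" "bilinear_map scale (\<lambda>x y. f x y z)" for x y z
    using assms by (auto simp: trilinear_map_def)
  have "bilinear_map scale (\<lambda>x1 x'. sw (\<lambda>x2 x3. f x1 x2 x3) x')"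
    using f by (simp add: bilinear_map_def sw_def D_add D_scale sum.distrib)
  then show ?thesis using f by (simp add: sweedler3_def sweedler2_sw)
qed

text \<open>The parameter \<iota> lets one convolution calculus serve forms over \<open>k\<close>,
  where it is the identity, and forms over \<open>K\<close>.\<close>

locale hopf_functionals =
  finite_hopf_algebra scale \<Delta> \<epsilon> antipode E + ring_hom_on_types \<iota>
  for scale :: "'k::field \<Rightarrow> 'h::ring_1 \<Rightarrow> 'h" and \<Delta> \<epsilon> antipode E and \<iota> :: "'k \<Rightarrow> 'c::comm_ring_1"
begin

definition functional :: "('h \<Rightarrow> 'c) \<Rightarrow> bool" where
  "functional u \<longleftrightarrow> (\<forall>x y. u (x + y) = u x + u y) \<and> (\<forall>c x. u (scale c x) = \<iota> c * u x)"

definition form :: "('h \<Rightarrow> 'h \<Rightarrow> 'c) \<Rightarrow> bool" where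
  "form a \<longleftrightarrow> (\<forall>y. functional (\<lambda>x. a x y)) \<and> (\<forall>x. functional (a x))"

definition conv :: "('h \<Rightarrow> 'c) \<Rightarrow> ('h \<Rightarrow> 'c) \<Rightarrow> 'h \<Rightarrow> 'c" where
  "conv u w x = sw (\<lambda>x1 x2. u x1 * w x2) x"

text \<open>Convolution for the coalgebra H tensor H, with linear maps out of it written as forms in
  two arguments.\<close>

definition conv2 :: "('h \<Rightarrow> 'h \<Rightarrow> 'c) \<Rightarrow> ('h \<Rightarrow> 'h \<Rightarrow> 'c) \<Rightarrow> 'h \<Rightarrow> 'h \<Rightarrow> 'c" where
  "conv2 a b x y = sw (\<lambda>x1 x2. sw (\<lambda>y1 y2. a x1 y1 * b x2 y2) y) x"

abbreviation "counit \<equiv> \<lambda>x. \<iota> (\<epsilon> x)"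
abbreviation "counit2 \<equiv> \<lambda>x y. \<iota> (\<epsilon> x) * \<iota> (\<epsilon> y)"

lemma functional_add: "functional u \<Longrightarrow> u (x + y) = u x + u y"
  and functional_scale: "functional u \<Longrightarrow> u (scale c x) = \<iota> c * u x"
  by (simp_all add: functional_def)

lemma functional_sum: assumes "functional u" shows "u (sum f A) = (\<Sum>i\<in>A. u (f i))"
proof -
  have "u 0 = 0" using functional_add[OF assms, of 0 0] by (simp only: add_0_right add_cancel_right_right)
  then show ?thesis by (induction A rule: infinite_finite_induct) (auto simp: functional_add[OF assms])
qed

lemma functional_expand: "functional u \<Longrightarrow> u x = (\<Sum>e\<in>E. \<iota> (coord e x) * u e)"
  using arg_cong[OF coord_expand[of x], of u] by (simp add: functional_sum functional_scale)

lemma functional_mult_left: "functional u \<Longrightarrow> functional (\<lambda>x. c * u x)"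
  and functional_mult_right: "functional u \<Longrightarrow> functional (\<lambda>x. u x * c)"
  and functional_counit: "functional counit"
  and functional_coord: "functional (\<lambda>x. \<iota> (coord e x))"
  by (simp_all add: functional_def algebra_simps \<epsilon>_add \<epsilon>_scale coord_add coord_scale hom_add hom_mult)

lemma functional_sum': "(\<And>i. i \<in> A \<Longrightarrow> functional (f i)) \<Longrightarrow> functional (\<lambda>x. \<Sum>i\<in>A. f i x)"
  by (simp add: functional_def sum.distrib sum_distrib_left)

lemma functional_sw_param: "(\<And>x1 x2. functional (\<lambda>z. f z x1 x2)) \<Longrightarrow> functional (\<lambda>z. sw (f z) x)"
  unfolding sw_def by (rule functional_sum')

lemma functional_D: "functional u \<Longrightarrow> functional (\<lambda>x. u (D e x))"
  by (simp add: functional_def D_add D_scale)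

lemma functional_sw: "(\<And>x1. functional (f x1)) \<Longrightarrow> functional (sw f)"
  unfolding sw_def[abs_def] by (intro functional_sum' functional_D)

lemma functional_translate: "functional u \<Longrightarrow> functional (\<lambda>x. u (x * y))"
  "functional u \<Longrightarrow> functional (\<lambda>y. u (x * y))"
  by (simp_all add: functional_def algebra_simps scale_mult_left scale_mult_right)

lemma form_left: "form a \<Longrightarrow> functional (\<lambda>x. a x y)" and form_right: "form a \<Longrightarrow> functional (a x)"
  by (simp_all add: form_def)

lemmas functional_intros = functional_mult_left functional_mult_right functional_counit functional_coord
  functional_sw_param functional_sw

lemma bilinear_mapI: "(\<And>y. functional (\<lambda>x. f x y)) \<Longrightarrow> (\<And>x. functional (f x)) \<Longrightarrow> bilinear_map scale f"
  by (simp add: functional_def bilinear_map_def)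

lemma trilinear_mapI:
  "(\<And>y z. functional (\<lambda>x. f x y z)) \<Longrightarrow> (\<And>x z. functional (\<lambda>y. f x y z)) \<Longrightarrow> (\<And>x y. functional (f x y)) \<Longrightarrow>
     trilinear_map scale f"
  unfolding trilinear_map_def by (intro conjI allI bilinear_mapI)

lemma functional_conv: "functional w \<Longrightarrow> functional (conv u w)"
  unfolding conv_def[abs_def] by (intro functional_intros)

lemma conv_assoc:
  assumes "functional u" "functional v" "functional w"
  shows "conv (conv u v) w = conv u (conv v w)"
proof
  fix x
  have "trilinear_map scale (\<lambda>x1 x2 x3. u x1 * v x2 * w x3)"
    using assms by (intro trilinear_mapI functional_intros)
  from sw_coassoc[OF this, of x] show "conv (conv u v) w x = conv u (conv v w) x"
    by (simp add: conv_def sw_def sum_distrib_left sum_distrib_right mult.assoc)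
qed

lemma conv_counit_left: assumes "functional u" shows "conv counit u = u"
proof
  fix x
  show "conv counit u x = u x"
    using arg_cong[OF sw_counit_left[of x], of u]
    by (simp add: conv_def sw_def functional_sum[OF assms] functional_scale[OF assms])
qed

lemma conv_counit_right: assumes "functional u" shows "conv u counit = u"
proof
  fix x
  show "conv u counit x = u x"
    using arg_cong[OF sw_counit_right[of x], of u]
    by (simp add: conv_def sw_def functional_sum[OF assms] functional_scale[OF assms] mult.commute)
qed

lemma form_conv2: assumes "form b" shows "form (conv2 a b)"
  unfolding form_def conv2_def[abs_def]
  by (intro conjI allI functional_intros form_left[OF assms] form_right[OF assms])

text \<open>Coassociativity is applied in each argument by itself; \<open>sw_swap\<close> brings the
  two sums that belong to one argument next to each other.\<close>

lemma conv2_assoc: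
  assumes a: "form a" and b: "form b" and c: "form c"
  shows "conv2 (conv2 a b) c = conv2 a (conv2 b c)"
proof (intro ext)
  fix x y
  have y: "sw (\<lambda>y' y3. sw (\<lambda>y1 y2. a x1 y1 * b x2 y2 * c x3 y3) y') y
      = sw (\<lambda>y1 y'. sw (\<lambda>y2 y3. a x1 y1 * b x2 y2 * c x3 y3) y') y" for x1 x2 x3
    by (intro sw_coassoc trilinear_mapI functional_intros form_left[OF a] form_right[OF a]
      form_left[OF b] form_right[OF b] form_left[OF c] form_right[OF c])
  have x: "sw (\<lambda>x' x3. sw (\<lambda>x1 x2. sw (\<lambda>y1 y'. sw (\<lambda>y2 y3. a x1 y1 * b x2 y2 * c x3 y3) y') y) x') x
      = sw (\<lambda>x1 x'. sw (\<lambda>x2 x3. sw (\<lambda>y1 y'. sw (\<lambda>y2 y3. a x1 y1 * b x2 y2 * c x3 y3) y') y) x') x"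
    by (intro sw_coassoc trilinear_mapI functional_intros form_left[OF a] form_right[OF a]
      form_left[OF b] form_right[OF b] form_left[OF c] form_right[OF c])
  have "conv2 (conv2 a b) c x y = sw (\<lambda>x' x3. sw (\<lambda>y' y3. sw (\<lambda>x1 x2. sw (\<lambda>y1 y2. a x1 y1 * b x2 y2 * c x3 y3) y') x') y) x"
    by (simp add: conv2_def sw_def sum_distrib_right)
  also have "\<dots> = sw (\<lambda>x' x3. sw (\<lambda>x1 x2. sw (\<lambda>y1 y'. sw (\<lambda>y2 y3. a x1 y1 * b x2 y2 * c x3 y3) y') y) x') x"
    unfolding y[symmetric] by (subst sw_swap) (rule refl)
  also have "\<dots> = sw (\<lambda>x1 x'. sw (\<lambda>y1 y'. sw (\<lambda>x2 x3. sw (\<lambda>y2 y3. a x1 y1 * b x2 y2 * c x3 y3) y') x') y) x"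
    unfolding x by (subst sw_swap) (rule refl)
  also have "\<dots> = conv2 a (conv2 b c) x y"
    by (simp add: conv2_def sw_def sum_distrib_left mult.assoc)
  finally show "conv2 (conv2 a b) c x y = conv2 a (conv2 b c) x y" .
qed

lemma conv2_counit2_left: assumes "form a" shows "conv2 counit2 a = a"
proof (intro ext)
  fix x y
  have "conv2 counit2 a x y = conv counit (\<lambda>x2. conv counit (a x2) y) x"
    by (simp add: conv2_def conv_def sw_def sum_distrib_left mult.assoc)
  then show "conv2 counit2 a x y = a x y"
    using assms by (simp add: conv_counit_left form_left form_right)
qed

lemma conv2_counit2_right: assumes "form a" shows "conv2 a counit2 = a"
proof (intro ext)
  fix x y
  have "conv2 a counit2 x y = conv (\<lambda>x1. conv (a x1) counit y) counit x"
    by (simp add: conv2_def conv_def sw_def sum_distrib_left sum_distrib_right mult_ac)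
  then show "conv2 a counit2 x y = a x y"
    using assms by (simp add: conv_counit_right form_left form_right)
qed

definition pull :: "('h \<Rightarrow> 'c) \<Rightarrow> 'h \<Rightarrow> 'h \<Rightarrow> 'c" where "pull u x y = u (x * y)"

lemma form_pull: "functional u \<Longrightarrow> form (pull u)"
  unfolding form_def pull_def[abs_def] by (intro conjI allI functional_translate)

text \<open>Multiplication is a coalgebra map, so composing with it is a homomorphism of convolution
  algebras.\<close>

lemma conv2_pull:
  assumes "functional u" "functional w"
  shows "conv2 (pull u) (pull w) = pull (conv u w)"
proof (intro ext)
  fix x y
  have "bilinear_map scale (\<lambda>x1 x2. u x1 * w x2)" using assms by (intro bilinear_mapI functional_intros)
  from sw_mult[OF this, of x y] show "conv2 (pull u) (pull w) x y = pull (conv u w) x y"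
    by (simp add: conv2_def pull_def conv_def)
qed

lemma pull_counit: "pull counit = counit2"
  by (simp add: pull_def counit_mult hom_mult fun_eq_iff)

lemma conv2_inverse_unique:
  assumes "form a" "form b" "form b'" "conv2 b a = counit2" "conv2 a b' = counit2"
  shows "b = b'"
proof -
  have "b = conv2 b (conv2 a b')" using assms by (simp add: conv2_counit2_right)
  also have "\<dots> = b'"
    unfolding conv2_assoc[OF assms(2,1,3), symmetric] assms(4) by (rule conv2_counit2_left[OF assms(3)])
  finally show ?thesis .
qed

lemma conv_inverse_unique:
  assumes "functional a" "functional b" "functional b'" "conv b a = counit" "conv a b' = counit"
  shows "b = b'"
proof -
  have "b = conv b (conv a b')" using assms by (simp add: conv_counit_right)
  also have "\<dots> = b'"
    unfolding conv_assoc[OF assms(2,1,3), symmetric] assms(4) by (rule conv_counit_left[OF assms(3)])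
  finally show ?thesis .
qed

end

section \<open>Functionals and convolution inverses at a place\<close>

locale hopf_place =
  hopf_functionals scale \<Delta> \<epsilon> antipode E \<iota> + ring_place \<iota> P
  for scale :: "'k::field \<Rightarrow> 'h::ring_1 \<Rightarrow> 'h" and \<Delta> \<epsilon> antipode E and \<iota> :: "'k \<Rightarrow> 'f::field" and P
begin

definition dual_basis :: "('h \<Rightarrow> 'f) set" where "dual_basis = (\<lambda>e x. \<iota> (coord e x)) ` E"

lemma span_dual_basis: "fun_space.span dual_basis = {u. functional u}"
proof
  have "fun_space.subspace {u. functional u}"
    unfolding fun_space.subspace_def
    by (auto simp: functional_def fun_scale_def algebra_simps)
  then show "fun_space.span dual_basis \<subseteq> {u. functional u}"
    by (intro fun_space.span_minimal) (auto simp: dual_basis_def functional_coord)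
  show "{u. functional u} \<subseteq> fun_space.span dual_basis"
  proof clarify
    fix u assume u: "functional u"
    have "u = (\<Sum>e\<in>E. fun_scale (u e) (\<lambda>x. \<iota> (coord e x)))"
    proof
      fix x show "u x = (\<Sum>e\<in>E. fun_scale (u e) (\<lambda>x. \<iota> (coord e x))) x"
        by (subst functional_expand[OF u]) (simp add: fun_sum_apply fun_scale_def mult.commute)
    qed
    also have "\<dots> \<in> fun_space.span dual_basis"
      by (intro fun_space.span_sum fun_space.span_scale fun_space.span_base) (auto simp: dual_basis_def)
    finally show "u \<in> fun_space.span dual_basis" .
  qed
qed

lemma residue_linear:
  assumes "functional u" and r: "\<And>x. P (u x) (r x)"
  shows "r (x + y) = r x + r y" "r (scale c x) = c * r x"
proof -
  show "r (x + y) = r x + r y"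
    using P_add[OF r[of x] r[of y]] by (intro P_unique[OF r]) (simp add: functional_add[OF assms(1)])
  show "r (scale c x) = c * r x"
    using P_mult[OF P_const[of c] r[of x]] by (intro P_unique[OF r]) (simp add: functional_scale[OF assms(1)])
qed

lemma residue_sum:
  assumes "functional u" and r: "\<And>x. P (u x) (r x)"
  shows "r (sum f A) = (\<Sum>i\<in>A. r (f i))"
proof -
  have "r 0 = 0" using residue_linear(1)[OF assms, of 0 0] by (simp only: add_0_right add_cancel_right_right)
  then show ?thesis by (induction A rule: infinite_finite_induct) (auto simp: residue_linear(1)[OF assms])
qed

lemma residue_exists:
  assumes u: "functional u" and E: "\<And>e. e \<in> E \<Longrightarrow> \<exists>c. P (u e) c"
  shows "\<exists>c. P (u x) c"
proof -
  from E obtain r where "\<And>e. e \<in> E \<Longrightarrow> P (u e) (r e)" by metis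
  then have "P (u x) (\<Sum>e\<in>E. coord e x * r e)"
    unfolding functional_expand[OF u, of x] by (intro P_sum P_mult P_const)
  then show ?thesis ..
qed

text \<open>Functionals form the span of the dual basis, and both finiteness and vanishing of a
  functional can be tested on \<open>E\<close>; so the residue criterion applies with
  \<open>A\<close> taken to be \<open>E\<close>.\<close>

lemma operator_surj:
  assumes L: "Vector_Spaces.linear fun_scale fun_scale L" and stable: "\<And>u. functional u \<Longrightarrow> functional (L u)"
    and red: "\<And>u r x. functional u \<Longrightarrow> (\<And>x. P (u x) (r x)) \<Longrightarrow> P (L u x) (r x)"
    and w: "functional w"
  shows "\<exists>u. functional u \<and> L u = w"
proof -
  have "\<exists>u\<in>fun_space.span dual_basis. L u = w"
  proof (rule surj_of_residue_identity[OF L _ _ finite_E])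
    show "finite dual_basis" by (simp add: dual_basis_def finite_E)
    show "L ` fun_space.span dual_basis \<subseteq> fun_space.span dual_basis"
      unfolding span_dual_basis using stable by auto
    show "\<forall>x. \<exists>c. P (v x) c" if "v \<in> fun_space.span dual_basis" "\<And>x. x \<in> E \<Longrightarrow> \<exists>c. P (v x) c" for v
      using that residue_exists unfolding span_dual_basis by blast
    show "v = 0" if "v \<in> fun_space.span dual_basis" "\<And>x. x \<in> E \<Longrightarrow> v x = 0" for v
    proof
      fix x have v: "functional v" using that(1) by (simp add: span_dual_basis)
      show "v x = 0 x" by (subst functional_expand[OF v]) (simp add: that(2))
    qed
    show "P (L v x) (r x)" if "v \<in> fun_space.span dual_basis" "\<And>x. P (v x) (r x)" for v r x
      using that red unfolding span_dual_basis by blast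
  qed (use w in \<open>simp add: span_dual_basis\<close>)
  then show ?thesis by (auto simp: span_dual_basis)
qed

text \<open>Since \<epsilon> is the unit for convolution, left and right convolution with
  \<open>u\<close> both reduce to the identity, hence are onto. The one-sided inverses obtained in
  this way agree by associativity.\<close>

lemma conv_inverse_exists:
  assumes u: "functional u" and P: "\<And>x. P (u x) (\<epsilon> x)"
  shows "\<exists>w. functional w \<and> conv u w = counit \<and> conv w u = counit"
proof -
  have lin1: "Vector_Spaces.linear fun_scale fun_scale (conv u)"
    by (simp add: Vector_Spaces.linear_iff fun_space.vector_space_axioms conv_def sw_def fun_scale_def
        fun_eq_iff algebra_simps sum.distrib sum_distrib_left)
  have lin2: "Vector_Spaces.linear fun_scale fun_scale (\<lambda>w. conv w u)"
    by (simp add: Vector_Spaces.linear_iff fun_space.vector_space_axioms conv_def sw_def fun_scale_def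
        fun_eq_iff algebra_simps sum.distrib sum_distrib_left)
  have "P (conv u v x) (r x)" if v: "functional v" and r: "\<And>x. P (v x) (r x)" for v r x
  proof -
    have "P (conv u v x) (\<Sum>e\<in>E. \<epsilon> e * r (D e x))"
      unfolding conv_def sw_def by (intro P_sum P_mult P r)
    \<comment> \<open>The counit law, read through the linear form \<open>r\<close> of
      residues.\<close>
    also have "(\<Sum>e\<in>E. \<epsilon> e * r (D e x)) = r x"
      using arg_cong[OF sw_counit_left[of x], of r]
      by (simp add: sw_def residue_sum[OF v r] residue_linear(2)[OF v r])
    finally show ?thesis .
  qed
  then obtain w where w: "functional w" "conv u w = counit"
    using operator_surj[OF lin1 functional_conv _ functional_counit] by blast
  have "P (conv v u x) (r x)" if v: "functional v" and r: "\<And>x. P (v x) (r x)" for v r x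
  proof -
    have "P (conv v u x) (\<Sum>e\<in>E. r e * \<epsilon> (D e x))"
      unfolding conv_def sw_def by (intro P_sum P_mult P r)
    also have "(\<Sum>e\<in>E. r e * \<epsilon> (D e x)) = r x"
      using arg_cong[OF sw_counit_right[of x], of r]
      by (simp add: sw_def residue_sum[OF v r] residue_linear(2)[OF v r] mult.commute)
    finally show ?thesis .
  qed
  then obtain w' where w': "functional w'" "conv w' u = counit"
    using operator_surj[OF lin2 functional_conv[OF u] _ functional_counit] by blast
  have "w' = w" by (rule conv_inverse_unique[OF u w'(1) w(1) w'(2) w(2)])
  then show ?thesis using w w' by blast
qed

end


section \<open>The universal cocycle\<close>

context hopf_functionals
begin

lemma sweedler2_conv2:
  assumes a: "form a" and b: "form b"
  shows "sweedler2 \<Delta> (\<lambda>x1 x2. sweedler2 \<Delta> (\<lambda>y1 y2. a x1 y1 * b x2 y2) y) x = conv2 a b x y"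
proof -
  have "bilinear_map scale (\<lambda>y1 y2. a x1 y1 * b x2 y2)" for x1 x2
    by (intro bilinear_mapI functional_intros form_right[OF a] form_right[OF b])
  moreover have "bilinear_map scale (\<lambda>x1 x2. sw (\<lambda>y1 y2. a x1 y1 * b x2 y2) y)"
    by (intro bilinear_mapI functional_intros form_left[OF a] form_left[OF b])
  ultimately show ?thesis by (simp add: sweedler2_sw conv2_def)
qed

lemma sweedler2_conv:
  assumes "functional u" "functional w"
  shows "sweedler2 \<Delta> (\<lambda>x1 x2. u x1 * w x2) x = conv u w x"
proof -
  have "bilinear_map scale (\<lambda>x1 x2. u x1 * w x2)" by (intro bilinear_mapI functional_intros assms)
  then show ?thesis by (simp add: sweedler2_sw conv_def)
qed

lemma conv_one: assumes "functional u" "functional w" shows "conv u w 1 = u 1 * w 1"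
proof -
  have "bilinear_map scale (\<lambda>x1 x2. u x1 * w x2)" by (intro bilinear_mapI functional_intros assms)
  then show ?thesis by (simp add: conv_def sw_one)
qed

lemma conv2_one: assumes a: "form a" and b: "form b" shows "conv2 a b 1 1 = a 1 1 * b 1 1"
proof -
  have "bilinear_map scale (\<lambda>y1 y2. a x1 y1 * b x2 y2)" for x1 x2
    by (intro bilinear_mapI functional_intros form_right[OF a] form_right[OF b])
  moreover have "bilinear_map scale (\<lambda>x1 x2. a x1 1 * b x2 1)"
    by (intro bilinear_mapI functional_intros form_left[OF a] form_left[OF b])
  ultimately show ?thesis by (simp add: conv2_def sw_one)
qed

lemma sweedler3_one:
  assumes f: "\<And>y z. functional (\<lambda>x. f x y z)" "\<And>x z. functional (\<lambda>y. f x y z)" "\<And>x y. functional (f x y)"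
  shows "sweedler3 \<Delta> f 1 = f 1 1 1"
proof -
  have "bilinear_map scale (\<lambda>x1 x'. sw (f x1) x')"
    by (intro bilinear_mapI functional_sw_param functional_sw f)
  moreover have "bilinear_map scale (f 1)" by (intro bilinear_mapI f)
  ultimately show ?thesis
    using sweedler3_sw[OF trilinear_mapI[OF f], of 1] by (simp add: sw_one)
qed

end

locale universal_twist =
  finite_hopf_algebra scale \<Delta> \<epsilon> antipode E + symmetric_fraction_field scale j
  for scale :: "'k::field \<Rightarrow> 'h::ring_1 \<Rightarrow> 'h" and \<Delta> \<epsilon> antipode E
    and j :: "('h, 'k) free_comm_algebra set \<Rightarrow> 'f::field" +
  fixes \<alpha> :: "'h \<Rightarrow> 'h \<Rightarrow> 'k"
  assumes bilinear_\<alpha>: "bilinear_form scale \<alpha>" and normalized_\<alpha>: "normalized \<epsilon> \<alpha>"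
    and invertible_\<alpha>: "convolution_invertible scale \<Delta> \<epsilon> \<alpha>"
begin

text \<open>Chosen once, so that the inversion of \<open>t\<close> and the reduction of ideals refer
  to the same place.\<close>

definition place :: "'f \<Rightarrow> 'k \<Rightarrow> bool" where
  "place = (SOME P. ring_place \<iota> P \<and> (\<forall>h. P (t h) (\<epsilon> h)))"

lemma place: "ring_place \<iota> place" "place (t h) (\<epsilon> h)"
proof -
  have "\<exists>P. ring_place \<iota> P \<and> (\<forall>h. P (t h) (\<epsilon> h))"
    using place_at_point[OF finite_E independent_E span_E counit_linear] by metis
  from someI_ex[OF this] show "ring_place \<iota> place" "place (t h) (\<epsilon> h)"
    unfolding place_def by blast+
qed

sublocale F: hopf_functionals scale \<Delta> \<epsilon> antipode E \<iota> ..

sublocale F: hopf_place scale \<Delta> \<epsilon> antipode E \<iota> place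
  by (intro hopf_place.intro place F.hopf_functionals_axioms)

sublocale K: hopf_functionals scale \<Delta> \<epsilon> antipode E id
  by unfold_locales auto

abbreviation "tinv \<equiv> t_inv scale \<Delta> \<epsilon> j"
abbreviation "\<beta> \<equiv> convolution_inverse scale \<Delta> \<epsilon> \<alpha>"
abbreviation "\<sigma> \<equiv> universal_cocycle scale \<Delta> \<epsilon> \<alpha> j"
abbreviation "\<sigma>inv \<equiv> universal_cocycle_inv scale \<Delta> \<epsilon> \<alpha> j"

lemma functional_t: "F.functional t"
  by (simp add: F.functional_def t_add t_scale)

lemma linear_iff_functional: "Vector_Spaces.linear scale (K_scale scale j) u \<longleftrightarrow> F.functional u"
proof -
  have "vector_space (K_scale scale j)"
    by unfold_locales (simp_all add: K_scale_def algebra_simps ground.hom_add ground.hom_mult)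
  then show ?thesis
    by (simp add: Vector_Spaces.linear_iff vector_space_axioms F.functional_def K_scale_def)
qed

text \<open>Existence comes from the place centred at the counit, uniqueness from the associativity
  of convolution; together they evaluate the \<open>THE\<close> in \<open>t_inv\<close>.\<close>

lemma tinv: "F.functional tinv" "F.conv t tinv = F.counit" "F.conv tinv t = F.counit"
proof -
  let ?Q = "\<lambda>u. F.functional u \<and> F.conv t u = F.counit \<and> F.conv u t = F.counit"
  have eq: "(Vector_Spaces.linear scale (K_scale scale j) u \<and>
        (\<forall>h. sweedler2 \<Delta> (\<lambda>h1 h2. t h1 * u h2) h = \<iota> (\<epsilon> h) \<and> sweedler2 \<Delta> (\<lambda>h1 h2. u h1 * t h2) h = \<iota> (\<epsilon> h))) = ?Q u" for u
    by (auto simp: linear_iff_functional F.sweedler2_conv functional_t fun_eq_iff)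
  obtain u where u: "?Q u" using F.conv_inverse_exists[OF functional_t place(2)] by blast
  have "?Q (THE u. ?Q u)"
  proof (rule theI[of ?Q u])
    show "v = u" if "?Q v" for v
      using that u by (intro F.conv_inverse_unique[OF functional_t, of v u]) auto
  qed (rule u)
  then have "?Q tinv" unfolding t_inv_def eq .
  then show "F.functional tinv" "F.conv t tinv = F.counit" "F.conv tinv t = F.counit" by auto
qed

lemma t_1_tinv_1: "t 1 * tinv 1 = 1"
  using F.conv_one[OF functional_t tinv(1)] by (simp add: tinv(2) counit_one)

lemma form_iff: "bilinear_form scale a \<longleftrightarrow> K.form a"
proof -
  have "Vector_Spaces.linear scale (*) u \<longleftrightarrow> K.functional u" for u :: "'h \<Rightarrow> 'k"
  proof -
    have "vector_space ((*) :: 'k \<Rightarrow> 'k \<Rightarrow> 'k)" by unfold_locales (simp_all add: algebra_simps)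
    then show ?thesis by (simp add: Vector_Spaces.linear_iff vector_space_axioms K.functional_def)
  qed
  then show ?thesis by (auto simp: bilinear_form_def K.form_def)
qed

lemma form_\<alpha>: "K.form \<alpha>" using bilinear_\<alpha> by (simp add: form_iff)

lemma \<beta>: "K.form \<beta>" "K.conv2 \<alpha> \<beta> = K.counit2"
proof -
  let ?Q = "\<lambda>b. K.form b \<and> K.conv2 \<alpha> b = K.counit2 \<and> K.conv2 b \<alpha> = K.counit2"
  have eq: "is_convolution_inverse scale \<Delta> \<epsilon> \<alpha> b = ?Q b" for b
    unfolding is_convolution_inverse_def
    by (auto simp: form_iff K.sweedler2_conv2 form_\<alpha> fun_eq_iff)
  obtain b where b: "?Q b" using invertible_\<alpha> by (auto simp: convolution_invertible_def eq)
  have "?Q (THE b. ?Q b)"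
  proof (rule theI[of ?Q b])
    show "c = b" if "?Q c" for c
      using that b by (intro K.conv2_inverse_unique[OF form_\<alpha>, of c b]) auto
  qed (rule b)
  then have "?Q \<beta>" unfolding convolution_inverse_def eq .
  then show "K.form \<beta>" "K.conv2 \<alpha> \<beta> = K.counit2" by auto
qed

lemma \<beta>_1: "\<beta> 1 1 = 1"
proof -
  have "\<alpha> 1 1 * \<beta> 1 1 = 1"
    using K.conv2_one[OF form_\<alpha> \<beta>(1)] by (simp add: \<beta>(2) counit_one)
  moreover have "\<alpha> 1 1 = 1" using normalized_\<alpha> by (simp add: normalized_def counit_one)
  ultimately show ?thesis by simp
qed

lemma functional_ground: "K.functional u \<Longrightarrow> F.functional (\<lambda>x. \<iota> (u x))"
  by (simp add: K.functional_def F.functional_def ground.hom_add ground.hom_mult)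

lemma form_ground: "K.form a \<Longrightarrow> F.form (\<lambda>x y. \<iota> (a x y))"
  by (simp add: K.form_def F.form_def functional_ground)

definition tt :: "'h \<Rightarrow> 'h \<Rightarrow> 'f" where "tt x y = t x * t y"

lemma form_tt: "F.form tt"
  unfolding F.form_def tt_def[abs_def] by (intro conjI allI F.functional_intros functional_t)

lemmas form_\<iota>\<alpha> = form_ground[OF form_\<alpha>]

text \<open>In the convolution algebra of forms \<sigma> is a product of three factors:
  \<open>t\<close> in both arguments, \<alpha>, and the inverse of \<open>t\<close> after
  multiplication. From here on associativity replaces the handling of Sweedler indices.\<close>

lemma \<sigma>_eq: "\<sigma> = F.conv2 tt (F.conv2 (\<lambda>x y. \<iota> (\<alpha> x y)) (F.pull tinv))"
proof (intro ext)
  fix x y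
  note intros = F.functional_intros functional_t F.form_left[OF form_\<iota>\<alpha>] F.form_right[OF form_\<iota>\<alpha>]
    F.functional_translate[OF tinv(1)]
  let ?f = "\<lambda>x1 x2 x3 y1 y2 y3. t x1 * t y1 * \<iota> (\<alpha> x2 y2) * tinv (x3 * y3)"
  have "sweedler3 \<Delta> (?f x1 x2 x3) y = sw (\<lambda>y1 y'. sw (\<lambda>y2 y3. ?f x1 x2 x3 y1 y2 y3) y') y" for x1 x2 x3
    by (intro sweedler3_sw F.trilinear_mapI intros)
  then have "\<sigma> x y = sweedler3 \<Delta> (\<lambda>x1 x2 x3. sw (\<lambda>y1 y'. sw (\<lambda>y2 y3. ?f x1 x2 x3 y1 y2 y3) y') y) x"
    by (simp add: universal_cocycle_def)
  also have "\<dots> = sw (\<lambda>x1 x'. sw (\<lambda>x2 x3. sw (\<lambda>y1 y'. sw (\<lambda>y2 y3. ?f x1 x2 x3 y1 y2 y3) y') y) x') x"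
    by (intro sweedler3_sw F.trilinear_mapI intros)
  also have "\<dots> = sw (\<lambda>x1 x'. sw (\<lambda>y1 y'. sw (\<lambda>x2 x3. sw (\<lambda>y2 y3. ?f x1 x2 x3 y1 y2 y3) y') x') y) x"
    by (subst sw_swap) (rule refl)
  also have "\<dots> = F.conv2 tt (F.conv2 (\<lambda>x y. \<iota> (\<alpha> x y)) (F.pull tinv)) x y"
    by (simp add: F.conv2_def tt_def F.pull_def sw_def sum_distrib_left mult.assoc)
  finally show "\<sigma> x y = F.conv2 tt (F.conv2 (\<lambda>x y. \<iota> (\<alpha> x y)) (F.pull tinv)) x y" .
qed

lemma form_\<sigma>: "F.form \<sigma>"
  unfolding \<sigma>_eq by (intro F.form_conv2 F.form_pull tinv)

text \<open>This is the sense in which \<sigma> is cohomologous to \<alpha>. With the last factor of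
  \<sigma> moved to the other side, the identity contains no inverse and has the shape that makes
  the embedding multiplicative.\<close>

lemma \<sigma>_pull_t: "F.conv2 \<sigma> (F.pull t) = F.conv2 tt (\<lambda>x y. \<iota> (\<alpha> x y))"
proof -
  note forms = form_tt form_\<iota>\<alpha> F.form_pull[OF tinv(1)] F.form_pull[OF functional_t]
  have "F.conv2 \<sigma> (F.pull t) = F.conv2 tt (F.conv2 (\<lambda>x y. \<iota> (\<alpha> x y)) (F.conv2 (F.pull tinv) (F.pull t)))"
    unfolding \<sigma>_eq by (simp only: F.conv2_assoc F.form_conv2 forms)
  also have "F.conv2 (F.pull tinv) (F.pull t) = F.counit2"
    by (simp only: F.conv2_pull[OF tinv(1) functional_t] tinv(3) F.pull_counit)
  finally show ?thesis by (simp only: F.conv2_counit2_right[OF form_\<iota>\<alpha>])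
qed

text \<open>It shows that the coefficient \<open>tinv 1\<close> of the unit lies in
  \<open>B\<close>. With both arguments 1 the Sweedler sums collapse, and normalization of \<alpha>
  gives \<open>\<beta> 1 1 = 1\<close>.\<close>

lemma \<sigma>inv_1: "\<sigma>inv 1 1 = tinv 1"
proof -
  note form_\<iota>\<beta> = form_ground[OF \<beta>(1)]
  note intros = F.functional_intros functional_t F.form_left[OF form_\<iota>\<beta>] F.form_right[OF form_\<iota>\<beta>]
    F.functional_translate[OF functional_t] tinv(1)
  let ?f = "\<lambda>x1 x2 x3 y1 y2 y3. t (x1 * y1) * \<iota> (\<beta> x2 y2) * tinv x3 * tinv y3"
  have 1: "sweedler3 \<Delta> (?f x1 x2 x3) 1 = ?f x1 x2 x3 1 1 1" for x1 x2 x3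
    by (intro F.sweedler3_one intros)
  have "sweedler3 \<Delta> (\<lambda>x1 x2 x3. ?f x1 x2 x3 1 1 1) 1 = ?f 1 1 1 1 1 1"
    by (intro F.sweedler3_one intros)
  then have "\<sigma>inv 1 1 = t 1 * tinv 1 * tinv 1"
    by (simp add: universal_cocycle_inv_def 1 \<beta>_1)
  then show ?thesis by (simp add: t_1_tinv_1)
qed

section \<open>The algebra \<open>B\<close> and its field of fractions\<close>

abbreviation "B \<equiv> B_set scale \<Delta> \<epsilon> \<alpha> j"

lemma generators_in_B: "\<sigma> x y \<in> B" "\<sigma>inv x y \<in> B"
  unfolding B_set_def generated_subalgebra_def hull_def by blast+

lemma B_1: "1 \<in> B" and B_scale: "z \<in> B \<Longrightarrow> \<iota> c * z \<in> B"
  and B_add: "z \<in> B \<Longrightarrow> w \<in> B \<Longrightarrow> z + w \<in> B" and B_mult: "z \<in> B \<Longrightarrow> w \<in> B \<Longrightarrow> z * w \<in> B"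
  unfolding B_set_def generated_subalgebra_def hull_def K_scale_def[symmetric] by blast+

lemma B_minus: "z \<in> B \<Longrightarrow> - z \<in> B"
  using B_scale[of z "-1"] by (simp add: ground.hom_minus)

lemma B_0: "0 \<in> B"
  using B_add[OF B_1 B_minus[OF B_1]] by simp

lemma tinv_1_in_B: "tinv 1 \<in> B"
  using generators_in_B(2)[of 1 1] by (simp add: \<sigma>inv_1)

definition Frac :: "'f set" where "Frac = {a / b | a b. a \<in> B \<and> b \<in> B \<and> b \<noteq> 0}"

lemma FracI: "a \<in> B \<Longrightarrow> b \<in> B \<Longrightarrow> b \<noteq> 0 \<Longrightarrow> a / b \<in> Frac"
  by (auto simp: Frac_def)

lemma B_subset_Frac: "z \<in> B \<Longrightarrow> z \<in> Frac"
  using FracI[of z 1] B_1 by simp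

lemma Frac_add: assumes "z \<in> Frac" "w \<in> Frac" shows "z + w \<in> Frac"
proof -
  obtain a b c d where "z = a / b" "w = c / d" and *: "a \<in> B" "b \<in> B" "b \<noteq> 0" "c \<in> B" "d \<in> B" "d \<noteq> 0"
    using assms by (auto simp: Frac_def)
  then have "z + w = (a * d + c * b) / (b * d)" by (simp add: add_frac_eq)
  then show ?thesis using * by (auto intro!: FracI B_add B_mult)
qed

lemma Frac_mult: assumes "z \<in> Frac" "w \<in> Frac" shows "z * w \<in> Frac"
proof -
  obtain a b c d where "z = a / b" "w = c / d" and *: "a \<in> B" "b \<in> B" "b \<noteq> 0" "c \<in> B" "d \<in> B" "d \<noteq> 0"
    using assms by (auto simp: Frac_def)
  then have "z * w = (a * c) / (b * d)" by simp
  then show ?thesis using * by (auto intro!: FracI B_mult)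
qed

lemma Frac_minus: "z \<in> Frac \<Longrightarrow> - z \<in> Frac"
  using Frac_mult[OF B_subset_Frac[OF B_minus[OF B_1]]] by simp

lemma Frac_divide: assumes "z \<in> Frac" "w \<in> Frac" shows "z / w \<in> Frac"
proof (cases "w = 0")
  case True
  then show ?thesis using B_subset_Frac[OF B_0] by simp
next
  case False
  then obtain c d where "w = c / d" "c \<in> B" "d \<in> B" "c \<noteq> 0"
    using assms(2) by (auto simp: Frac_def)
  then have dc: "d / c \<in> Frac" and eq: "z / w = z * (d / c)" by (auto intro: FracI)
  show ?thesis unfolding eq using assms(1) dc by (rule Frac_mult)
qed

end


section \<open>Twisted algebras\<close>

lemma hom_finprod:
  assumes G: "comm_group G" and G': "comm_group G'" and h: "h \<in> hom G G'" and f: "\<And>x. x \<in> A \<Longrightarrow> f x \<in> carrier G"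
  shows "h (finprod G f A) = finprod G' (\<lambda>x. h (f x)) A"
proof -
  interpret G: comm_group G by fact
  interpret G': comm_group G' by fact
  have one: "h \<one>\<^bsub>G\<^esub> = \<one>\<^bsub>G'\<^esub>" by (rule hom_one[OF h]) unfold_locales
  show ?thesis
  proof (cases "finite A")
    case True
    then show ?thesis using f
    proof (induction A)
      case (insert x A)
      have "finprod G f A \<in> carrier G" using insert.prems by (intro G.finprod_closed) auto
      moreover have "(\<lambda>x. h (f x)) \<in> A \<rightarrow> carrier G'" "h (f x) \<in> carrier G'"
        using insert.prems hom_in_carrier[OF h] by auto
      ultimately show ?case using insert by (simp add: G.finprod_insert G'.finprod_insert hom_mult[OF h] Pi_iff)
    qed (simp add: one)
  qed (simp add: G.finprod_infinite G'.finprod_infinite one)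
qed

text \<open>One construction for both twisted algebras: over \<open>k\<close> with \<alpha>, and
  over the subring \<open>B\<close> of \<open>K\<close> with \<sigma>. The coefficients form a
  subset \<open>C\<close> because \<open>B\<close> is not a type of its own.\<close>

locale twisted_by_form =
  hopf_functionals scale \<Delta> \<epsilon> antipode E \<iota>
  for scale :: "'k::field \<Rightarrow> 'h::ring_1 \<Rightarrow> 'h" and \<Delta> \<epsilon> antipode E and \<iota> :: "'k \<Rightarrow> 'c::comm_ring_1" +
  fixes s :: "'k \<Rightarrow> 'c \<Rightarrow> 'c" and C :: "'c set" and a :: "'h \<Rightarrow> 'h \<Rightarrow> 'c" and unit :: 'c
  assumes s: "s c z = \<iota> c * z"
    and C_0: "0 \<in> C" and C_add: "z \<in> C \<Longrightarrow> w \<in> C \<Longrightarrow> z + w \<in> C" and C_minus: "z \<in> C \<Longrightarrow> - z \<in> C"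
    and C_mult: "z \<in> C \<Longrightarrow> w \<in> C \<Longrightarrow> z * w \<in> C" and C_scale: "z \<in> C \<Longrightarrow> \<iota> c * z \<in> C"
    and form: "form a" and a_closed: "a x y \<in> C"
begin

abbreviation "R \<equiv> algebra_on s C"
abbreviation "A \<equiv> twisted_algebra scale \<Delta> R a unit"

lemma nonassoc_algebra_R: "nonassoc_algebra G0 R"
  by (rule nonassoc_algebra_algebra_on) (auto simp: s C_0 C_add C_minus C_mult C_scale mult.assoc mult.left_commute)

sublocale RH: tensor_product G0 R Hm
  using nonassoc_algebra.abelian[OF nonassoc_algebra_R] nonassoc_algebra.abelian[OF nonassoc_algebra_H]
  by (intro tensor_product.intro) (auto simp: s C_scale)

lemma a_add_left: "a (x + x') y = a x y + a x' y" and a_add_right: "a x (y + y') = a x y + a x y'"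
  and a_scale_left: "a (scale c x) y = \<iota> c * a x y" and a_scale_right: "a x (scale c y) = \<iota> c * a x y"
  using functional_add[OF form_left[OF form]] functional_add[OF form_right[OF form]]
    functional_scale[OF form_left[OF form]] functional_scale[OF form_right[OF form]] by auto

lemma pt_add_left: "b \<in> C \<Longrightarrow> b' \<in> C \<Longrightarrow> RH.pt (b + b') x = RH.pt b x \<otimes>\<^bsub>RH.TG\<^esub> RH.pt b' x"
  and pt_add_right: "b \<in> C \<Longrightarrow> RH.pt b (x + x') = RH.pt b x \<otimes>\<^bsub>RH.TG\<^esub> RH.pt b x'"
  and pt_scale: "b \<in> C \<Longrightarrow> RH.pt (\<iota> c * b) x = RH.pt b (scale c x)"
  and pt_closed: "b \<in> C \<Longrightarrow> RH.pt b x \<in> carrier RH.TG"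
  using RH.pt_add_left[of b b' x] RH.pt_add_right[of b x x'] RH.pt_smult[of c b x] RH.pt_closed[of b x] by (simp_all add: s)

definition pure_mult :: "'c \<Rightarrow> 'h \<Rightarrow> 'c \<Rightarrow> 'h \<Rightarrow> ('c \<times> 'h \<Rightarrow>\<^sub>0 int) set" where
  "pure_mult b x c y = tensor_lift RH.TG (\<lambda>x1 x2. tensor_lift RH.TG (\<lambda>y1 y2. RH.pt (b * c * a x1 y1) (x2 * y2)) (\<Delta> y)) (\<Delta> x)"

text \<open>The nested lifts over \<Delta> become a double product over the basis, in the
  multiplicative notation of the tensor group. Closure, additivity and balance can then be checked
  factor by factor.\<close>

lemma pure_mult_eq:
  assumes b: "b \<in> C" and c: "c \<in> C"
  shows "pure_mult b x c y =
    finprod RH.TG (\<lambda>e. finprod RH.TG (\<lambda>e'. RH.pt (b * c * a e e') (D e x * D e' y)) E) E"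
proof -
  have bca: "b * c * a x1 y1 \<in> C" for x1 y1 using b c a_closed C_mult by blast
  have inner_bal: "balanced_map G0 Hm Hm RH.TG (\<lambda>y1 y2. RH.pt (b * c * a x1 y1) (x2 * y2))" for x1 x2
  proof (rule balanced_mapI)
    show "RH.pt (b * c * a x1 (r \<odot>\<^bsub>Hm\<^esub> y1)) (x2 * y2) = RH.pt (b * c * a x1 y1) (x2 * (r \<odot>\<^bsub>Hm\<^esub> y2))" for r y1 y2
      using pt_scale[OF bca[of x1 y1], of r "x2 * y2"] by (simp add: a_scale_right scale_mult_right mult_ac)
  qed (simp_all add: bca a_add_right distrib_left pt_add_left pt_add_right pt_closed)
  have inner: "tensor_lift RH.TG (\<lambda>y1 y2. RH.pt (b * c * a x1 y1) (x2 * y2)) (\<Delta> y) =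
      finprod RH.TG (\<lambda>e'. RH.pt (b * c * a x1 e') (x2 * D e' y)) E" for x1 x2
    by (rule tensor_lift_comult[OF RH.comm_group_TG inner_bal])
  have "balanced_map G0 Hm Hm RH.TG (\<lambda>x1 x2. finprod RH.TG (\<lambda>e'. RH.pt (b * c * a x1 e') (x2 * D e' y)) E)"
  proof (rule balanced_mapI)
    show "finprod RH.TG (\<lambda>e'. RH.pt (b * c * a x1 e') (x2 * D e' y)) E \<in> carrier RH.TG" for x1 x2
      by (rule RH.TG.finprod_closed) (rule funcsetI, rule pt_closed[OF bca])
    show "finprod RH.TG (\<lambda>e'. RH.pt (b * c * a (x1 \<oplus>\<^bsub>Hm\<^esub> x1') e') (x2 * D e' y)) E =
        finprod RH.TG (\<lambda>e'. RH.pt (b * c * a x1 e') (x2 * D e' y)) E \<otimes>\<^bsub>RH.TG\<^esub>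
        finprod RH.TG (\<lambda>e'. RH.pt (b * c * a x1' e') (x2 * D e' y)) E" for x1 x1' x2
      using RH.TG.finprod_multf[of "\<lambda>e'. RH.pt (b * c * a x1 e') (x2 * D e' y)" E "\<lambda>e'. RH.pt (b * c * a x1' e') (x2 * D e' y)",
          OF funcsetI funcsetI, OF pt_closed[OF bca] pt_closed[OF bca]]
      by (simp add: a_add_left distrib_left pt_add_left bca)
    show "finprod RH.TG (\<lambda>e'. RH.pt (b * c * a x1 e') ((x2 \<oplus>\<^bsub>Hm\<^esub> x2') * D e' y)) E =
        finprod RH.TG (\<lambda>e'. RH.pt (b * c * a x1 e') (x2 * D e' y)) E \<otimes>\<^bsub>RH.TG\<^esub>
        finprod RH.TG (\<lambda>e'. RH.pt (b * c * a x1 e') (x2' * D e' y)) E" for x1 x2 x2'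
      using RH.TG.finprod_multf[of "\<lambda>e'. RH.pt (b * c * a x1 e') (x2 * D e' y)" E "\<lambda>e'. RH.pt (b * c * a x1 e') (x2' * D e' y)",
          OF funcsetI funcsetI, OF pt_closed[OF bca] pt_closed[OF bca]]
      by (simp add: distrib_right pt_add_right bca)
    show "finprod RH.TG (\<lambda>e'. RH.pt (b * c * a (r \<odot>\<^bsub>Hm\<^esub> x1) e') (x2 * D e' y)) E =
        finprod RH.TG (\<lambda>e'. RH.pt (b * c * a x1 e') ((r \<odot>\<^bsub>Hm\<^esub> x2) * D e' y)) E" for r x1 x2
    proof -
      have "RH.pt (b * c * a (scale r x1) e') (x2 * D e' y) = RH.pt (b * c * a x1 e') (scale r x2 * D e' y)" for e'
        using pt_scale[OF bca[of x1 e'], of r "x2 * D e' y"] by (simp add: a_scale_left scale_mult_left mult_ac)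
      then show ?thesis by simp
    qed
  qed
  from tensor_lift_comult[OF RH.comm_group_TG this] show ?thesis
    unfolding pure_mult_def inner .
qed

lemma pure_mult_closed:
  assumes "b \<in> C" "c \<in> C"
  shows "pure_mult b x c y \<in> carrier RH.TG"
  unfolding pure_mult_eq[OF assms]
  by (intro RH.TG.finprod_closed funcsetI pt_closed C_mult a_closed assms)

lemma finprod2_mult:
  assumes "\<And>e e'. f e e' \<in> carrier RH.TG" "\<And>e e'. g e e' \<in> carrier RH.TG"
  shows "finprod RH.TG (\<lambda>e. finprod RH.TG (\<lambda>e'. f e e' \<otimes>\<^bsub>RH.TG\<^esub> g e e') E) E =
    finprod RH.TG (\<lambda>e. finprod RH.TG (f e) E) E \<otimes>\<^bsub>RH.TG\<^esub> finprod RH.TG (\<lambda>e. finprod RH.TG (g e) E) E"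
  using assms by (simp add: RH.TG.finprod_multf funcsetI RH.TG.finprod_closed)

sublocale mult: tensor_product_pair G0 R Hm G0 R Hm RH.TG pure_mult
proof unfold_locales
  have closed: "RH.pt (b * c * a e e') z \<in> carrier RH.TG" if "b \<in> C" "c \<in> C" for b c e e' z
    using that by (intro pt_closed C_mult a_closed)
  show "balanced_map G0 R Hm RH.TG (pure_mult b x)" if "b \<in> carrier R" for b x
  proof (rule balanced_mapI)
    show "pure_mult b x (c \<oplus>\<^bsub>R\<^esub> c') y = pure_mult b x c y \<otimes>\<^bsub>RH.TG\<^esub> pure_mult b x c' y"
      if "c \<in> carrier R" "c' \<in> carrier R" for c c' y
    proof -
      have C: "b \<in> C" "c \<in> C" "c' \<in> C" using that \<open>b \<in> carrier R\<close> by simp_all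
      have "RH.pt (b * (c + c') * a e e') z = RH.pt (b * c * a e e') z \<otimes>\<^bsub>RH.TG\<^esub> RH.pt (b * c' * a e e') z" for e e' z
        unfolding distrib_left distrib_right using C by (intro pt_add_left C_mult a_closed)
      then show ?thesis
        by (simp only: algebra_on_simps pure_mult_eq C C_add finprod2_mult closed)
    qed
    show "pure_mult b x c (y \<oplus>\<^bsub>Hm\<^esub> y') = pure_mult b x c y \<otimes>\<^bsub>RH.TG\<^esub> pure_mult b x c y'"
      if "c \<in> carrier R" for c y y'
    proof -
      have C: "b \<in> C" "c \<in> C" using that \<open>b \<in> carrier R\<close> by simp_all
      have "RH.pt (b * c * a e e') (z * D e' (y + y')) =
          RH.pt (b * c * a e e') (z * D e' y) \<otimes>\<^bsub>RH.TG\<^esub> RH.pt (b * c * a e e') (z * D e' y')" for e e' z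
        unfolding distrib_left D_add using C by (intro pt_add_right C_mult a_closed)
      then show ?thesis
        by (simp only: algebra_on_simps pure_mult_eq C finprod2_mult closed)
    qed
    show "pure_mult b x (r \<odot>\<^bsub>R\<^esub> c) y = pure_mult b x c (r \<odot>\<^bsub>Hm\<^esub> y)" if "c \<in> carrier R" for r c y
    proof -
      have "RH.pt (b * (\<iota> r * c) * a e e') (D e x * D e' y) = RH.pt (b * c * a e e') (D e x * scale r (D e' y))" for e e'
        using pt_scale[of "b * c * a e e'" r "D e x * D e' y"] that \<open>b \<in> carrier R\<close>
        by (simp add: scale_mult_right C_mult a_closed mult_ac)
      then show ?thesis using that \<open>b \<in> carrier R\<close> by (simp add: pure_mult_eq s C_scale D_scale)
    qed
  qed (use that in \<open>simp add: pure_mult_closed\<close>)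
  show "balanced_map G0 R Hm RH.TG (\<lambda>b x. pure_mult b x c y)" if "c \<in> carrier R" for c y
  proof (rule balanced_mapI)
    show "pure_mult (b \<oplus>\<^bsub>R\<^esub> b') x c y = pure_mult b x c y \<otimes>\<^bsub>RH.TG\<^esub> pure_mult b' x c y"
      if "b \<in> carrier R" "b' \<in> carrier R" for b b' x
    proof -
      have C: "b \<in> C" "b' \<in> C" "c \<in> C" using that \<open>c \<in> carrier R\<close> by simp_all
      have "RH.pt ((b + b') * c * a e e') z = RH.pt (b * c * a e e') z \<otimes>\<^bsub>RH.TG\<^esub> RH.pt (b' * c * a e e') z" for e e' z
        unfolding distrib_left distrib_right using C by (intro pt_add_left C_mult a_closed)
      then show ?thesis
        by (simp only: algebra_on_simps pure_mult_eq C C_add finprod2_mult closed)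
    qed
    show "pure_mult b (x \<oplus>\<^bsub>Hm\<^esub> x') c y = pure_mult b x c y \<otimes>\<^bsub>RH.TG\<^esub> pure_mult b x' c y"
      if "b \<in> carrier R" for b x x'
    proof -
      have C: "b \<in> C" "c \<in> C" using that \<open>c \<in> carrier R\<close> by simp_all
      have "RH.pt (b * c * a e e') (D e (x + x') * z) =
          RH.pt (b * c * a e e') (D e x * z) \<otimes>\<^bsub>RH.TG\<^esub> RH.pt (b * c * a e e') (D e x' * z)" for e e' z
        unfolding distrib_right D_add using C by (intro pt_add_right C_mult a_closed)
      then show ?thesis
        by (simp only: algebra_on_simps pure_mult_eq C finprod2_mult closed)
    qed
    show "pure_mult (r \<odot>\<^bsub>R\<^esub> b) x c y = pure_mult b (r \<odot>\<^bsub>Hm\<^esub> x) c y" if "b \<in> carrier R" for r b x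
    proof -
      have "RH.pt (\<iota> r * b * c * a e e') (D e x * D e' y) = RH.pt (b * c * a e e') (scale r (D e x) * D e' y)" for e e'
        using pt_scale[of "b * c * a e e'" r "D e x * D e' y"] that \<open>c \<in> carrier R\<close>
        by (simp add: scale_mult_left C_mult a_closed mult_ac)
      then show ?thesis using that \<open>c \<in> carrier R\<close> by (simp add: pure_mult_eq s C_scale D_scale)
    qed
  qed (use that in \<open>simp add: pure_mult_closed\<close>)
qed

lemma twisted_simps:
  "carrier A = carrier RH.TG" "u \<oplus>\<^bsub>A\<^esub> v = u \<otimes>\<^bsub>RH.TG\<^esub> v" "\<zero>\<^bsub>A\<^esub> = \<one>\<^bsub>RH.TG\<^esub>" "\<one>\<^bsub>A\<^esub> = RH.pt unit 1"
  "b \<odot>\<^bsub>A\<^esub> u = tensor_lift RH.TG (\<lambda>c x. RH.pt (b * c) x) u"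
  by (simp_all add: twisted_algebra_def Let_def)

lemma twisted_mult: "u \<otimes>\<^bsub>A\<^esub> v = mult.lift2 u v"
  unfolding mult.lift2_def unfolding pure_mult_def[abs_def] by (simp add: twisted_algebra_def Let_def)

lemma smult_balanced: "b \<in> C \<Longrightarrow> balanced_map G0 R Hm RH.TG (\<lambda>c x. RH.pt (b * c) x)"
proof (rule balanced_mapI)
  show "RH.pt (b * (r \<odot>\<^bsub>R\<^esub> c)) x = RH.pt (b * c) (r \<odot>\<^bsub>Hm\<^esub> x)" if "b \<in> C" "c \<in> carrier R" for r c x
    using pt_scale[of "b * c" r x] that by (simp add: s C_mult mult_ac)
qed (simp_all add: C_mult distrib_left pt_add_left pt_add_right pt_closed)

lemma smult_pure: "b \<in> C \<Longrightarrow> c \<in> C \<Longrightarrow> b \<odot>\<^bsub>A\<^esub> RH.pt c x = RH.pt (b * c) x"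
  using RH.tensor_lift_pure[OF RH.comm_group_TG smult_balanced, of b c x] by (simp add: twisted_simps)

lemma smult_hom: "b \<in> C \<Longrightarrow> (\<lambda>u. b \<odot>\<^bsub>A\<^esub> u) \<in> hom RH.TG RH.TG"
  using RH.tensor_lift_hom[OF RH.comm_group_TG smult_balanced, of b] by (simp add: twisted_simps(5)[abs_def])

text \<open>In the expansion over the basis \<open>b\<close> and \<open>c\<close> occur only through
  \<open>b * c\<close>, so a scalar may be absorbed by either of them.\<close>

lemma smult_pure_mult:
  assumes "d \<in> C" "b \<in> C" "c \<in> C"
  shows "d \<odot>\<^bsub>A\<^esub> pure_mult b x c y = pure_mult (d * b) x c y" "d \<odot>\<^bsub>A\<^esub> pure_mult b x c y = pure_mult b x (d * c) y"
proof -
  have closed: "RH.pt (b * c * a e e') z \<in> carrier RH.TG" for e e' z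
    using assms by (intro pt_closed C_mult a_closed)
  have "d \<odot>\<^bsub>A\<^esub> pure_mult b x c y =
      finprod RH.TG (\<lambda>e. finprod RH.TG (\<lambda>e'. RH.pt (d * (b * c * a e e')) (D e x * D e' y)) E) E"
    unfolding pure_mult_eq[OF assms(2,3)]
      hom_finprod[OF RH.comm_group_TG RH.comm_group_TG smult_hom[OF assms(1)] RH.TG.finprod_closed[OF funcsetI, OF closed]]
      hom_finprod[OF RH.comm_group_TG RH.comm_group_TG smult_hom[OF assms(1)] closed]
    by (simp add: smult_pure assms C_mult a_closed)
  then show "d \<odot>\<^bsub>A\<^esub> pure_mult b x c y = pure_mult (d * b) x c y" "d \<odot>\<^bsub>A\<^esub> pure_mult b x c y = pure_mult b x (d * c) y"
    using assms by (simp_all add: pure_mult_eq C_mult mult_ac)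
qed

lemma nonassoc_algebra_A: "nonassoc_algebra R A"
proof (rule nonassoc_algebra.intro)
  show "abelian_group A"
    by (rule abelian_group_of_comm_group[OF RH.comm_group_TG]) (simp_all add: twisted_simps)
  have smult_closed: "r \<odot>\<^bsub>A\<^esub> u \<in> carrier RH.TG" if "r \<in> C" "u \<in> carrier RH.TG" for r u
    using hom_in_carrier[OF smult_hom] that by blast
  then show "r \<odot>\<^bsub>A\<^esub> u \<in> carrier A" if "r \<in> carrier R" "u \<in> carrier A" for r u
    using that by (simp add: twisted_simps(1))
  have smult_mult: "r \<odot>\<^bsub>A\<^esub> (u \<otimes>\<^bsub>RH.TG\<^esub> v) = (r \<odot>\<^bsub>A\<^esub> u) \<otimes>\<^bsub>RH.TG\<^esub> (r \<odot>\<^bsub>A\<^esub> v)"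
    if "r \<in> C" "u \<in> carrier RH.TG" "v \<in> carrier RH.TG" for r u v
    using Group.hom_mult[OF smult_hom] that by blast
  show "u \<otimes>\<^bsub>A\<^esub> v \<in> carrier A" if "u \<in> carrier A" "v \<in> carrier A" for u v
    using that mult.lift2_closed[of u v] by (simp add: twisted_simps twisted_mult)
  show "(u \<oplus>\<^bsub>A\<^esub> u') \<otimes>\<^bsub>A\<^esub> v = u \<otimes>\<^bsub>A\<^esub> v \<oplus>\<^bsub>A\<^esub> u' \<otimes>\<^bsub>A\<^esub> v"
    if "u \<in> carrier A" "u' \<in> carrier A" "v \<in> carrier A" for u u' v
    using that mult.lift2_mult_left[of u u' v] by (simp add: twisted_simps twisted_mult)
  show "u \<otimes>\<^bsub>A\<^esub> (v \<oplus>\<^bsub>A\<^esub> v') = u \<otimes>\<^bsub>A\<^esub> v \<oplus>\<^bsub>A\<^esub> u \<otimes>\<^bsub>A\<^esub> v'"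
    if "u \<in> carrier A" "v \<in> carrier A" "v' \<in> carrier A" for u v v'
    using that mult.lift2_mult_right[of u v v'] by (simp add: twisted_simps twisted_mult)
  have left: "mult.lift2 (r \<odot>\<^bsub>A\<^esub> u) v = r \<odot>\<^bsub>A\<^esub> mult.lift2 u v \<and> mult.lift2 u (r \<odot>\<^bsub>A\<^esub> v) = r \<odot>\<^bsub>A\<^esub> mult.lift2 u v"
    if r: "r \<in> C" and u: "u \<in> carrier RH.TG" and v: "v \<in> carrier RH.TG" for r u v
    using u
  proof (induction rule: RH.tensor_induct)
    case (pure b x)
    from v show ?case
    proof (induction rule: RH.tensor_induct)
      case (pure c y)
      then show ?case using \<open>b \<in> carrier R\<close> r
        by (simp add: smult_pure mult.lift2_pure smult_pure_mult(1)[of r b c] smult_pure_mult(2)[of r b c, symmetric] C_mult)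
    next
      case (mult v v')
      moreover have "RH.pt b x \<in> carrier RH.TG" using pure by simp
      ultimately show ?case using r by (simp add: mult.lift2_mult_right smult_mult smult_closed mult.lift2_closed)
    qed
  next
    case (mult u u')
    then show ?case using r v by (simp add: mult.lift2_mult_left smult_mult smult_closed mult.lift2_closed)
  qed
  show "(r \<odot>\<^bsub>A\<^esub> u) \<otimes>\<^bsub>A\<^esub> v = r \<odot>\<^bsub>A\<^esub> (u \<otimes>\<^bsub>A\<^esub> v)"
    if "r \<in> carrier R" "u \<in> carrier A" "v \<in> carrier A" for r u v
    using left[of r u v] that by (simp add: twisted_simps(1) twisted_mult)
  show "u \<otimes>\<^bsub>A\<^esub> (r \<odot>\<^bsub>A\<^esub> v) = r \<odot>\<^bsub>A\<^esub> (u \<otimes>\<^bsub>A\<^esub> v)"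
    if "r \<in> carrier R" "u \<in> carrier A" "v \<in> carrier A" for r u v
    using left[of r u v] that by (simp add: twisted_simps(1) twisted_mult)
qed

lemma tensor_lift_pure_mult:
  fixes q :: "'c \<Rightarrow> 'h \<Rightarrow> 'w::ab_group_add"
  assumes q: "balanced_map G0 R Hm type_group q" and bc: "b \<in> C" "c \<in> C"
  shows "tensor_lift type_group q (pure_mult b x c y) = (\<Sum>e\<in>E. \<Sum>e'\<in>E. q (b * c * a e e') (D e x * D e' y))"
proof -
  have C: "b * c * a e e' \<in> C" for e e' using bc by (intro C_mult a_closed)
  have closed: "RH.pt (b * c * a e e') z \<in> carrier RH.TG" for e e' z
    by (intro pt_closed C)
  note hom = RH.tensor_lift_hom[OF comm_group_type_group q]
  show ?thesis
    unfolding pure_mult_eq[OF bc]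
      hom_finprod[OF RH.comm_group_TG comm_group_type_group hom RH.TG.finprod_closed[OF funcsetI, OF closed]]
      hom_finprod[OF RH.comm_group_TG comm_group_type_group hom closed]
    using C by (simp add: RH.tensor_lift_pure[OF comm_group_type_group q] finprod_type_group)
qed

end


section \<open>Simplicity after extension of scalars\<close>

text \<open>Gaussian elimination: each step removes one vector from a representation of
  \<open>w\<close> over the large field, while the remaining vectors stay in \<open>I\<close> and
  \<open>w\<close> keeps its entries in \<open>K\<close>.\<close>

lemma subfield_descent:
  fixes K :: "'f::field set" and I :: "('i \<Rightarrow> 'f) set"
  assumes K: "\<And>z w. z \<in> K \<Longrightarrow> w \<in> K \<Longrightarrow> z - w \<in> K" "\<And>z w. z \<in> K \<Longrightarrow> w \<in> K \<Longrightarrow> z * w \<in> K"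
      "\<And>z w. z \<in> K \<Longrightarrow> w \<in> K \<Longrightarrow> z / w \<in> K" "\<And>z. z \<in> K \<Longrightarrow> - z \<in> K"
    and I: "0 \<in> I" "\<And>v w. v \<in> I \<Longrightarrow> w \<in> I \<Longrightarrow> v + w \<in> I" "\<And>c v. c \<in> K \<Longrightarrow> v \<in> I \<Longrightarrow> fun_scale c v \<in> I"
      "\<And>v x. v \<in> I \<Longrightarrow> v x \<in> K"
    and w: "w \<in> fun_space.span I" "\<And>x. w x \<in> K"
  shows "w \<in> I"
proof -
  have *: "w \<in> I" if "\<And>i. i < n \<Longrightarrow> v i \<in> I" "w = (\<Sum>i<n. fun_scale (f i) (v i))" "\<And>x. w x \<in> K" for n :: nat and v f w
    using that
  proof (induction n arbitrary: v w)
    case 0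
    have "w = 0" using 0(2) by (simp only: lessThan_0 sum.empty)
    then show ?case using I(1) by (simp only:)
  next
    case (Suc n)
    show ?case
    proof (cases "v n = 0")
      case True
      then have "w = (\<Sum>i<n. fun_scale (f i) (v i))" using Suc.prems(2) by simp
      then show ?thesis using Suc.prems by (intro Suc.IH[of v w]) auto
    next
      case False
      then obtain x where x: "v n x \<noteq> 0" by (auto simp: fun_eq_iff)
      let ?c = "\<lambda>u. u x / v n x"
      \<comment> \<open>The pivot coordinate \<open>x\<close> is cleared with multiples of
        \<open>v n\<close>; the multipliers are quotients of entries and so lie in \<open>K\<close>.
        The coefficient of \<open>v n\<close> drops out of the representation of \<open>w'\<close>,
        and the other \<open>f i\<close>, which may lie outside \<open>K\<close>, are
        unchanged.\<close>
      define v' where "v' i = v i + fun_scale (- ?c (v i)) (v n)" for i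
      define w' where "w' = w + fun_scale (- ?c w) (v n)"
      have vn: "v n \<in> I" using Suc.prems by simp
      have cK: "- ?c u \<in> K" if "u x \<in> K" for u using that I(4)[OF vn] by (intro K)
      have "w' \<in> I"
      proof (rule Suc.IH)
        show "v' i \<in> I" if "i < n" for i
          unfolding v'_def using Suc.prems(1)[of i] that vn I(4) by (intro I(2,3) cK) auto
        have "w' y \<in> K" for y
        proof -
          have "w' y = w y - (w x / v n x) * v n y" by (simp add: w'_def fun_scale_def)
          then show ?thesis using Suc.prems(3) I(4)[OF vn] by (simp add: K)
        qed
        then show "w' y \<in> K" for y .
        show "w' = (\<Sum>i<n. fun_scale (f i) (v' i))"
        proof
          fix y
          have w: "w y = (\<Sum>i<n. f i * v i y) + f n * v n y" for y
            using Suc.prems(2) by (simp add: fun_sum_apply fun_scale_def)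
          have sum: "(\<Sum>i<n. f i * v i y) = w y - f n * v n y" for y using w by simp
          have "(\<Sum>i<n. fun_scale (f i) (v' i)) y = (\<Sum>i<n. f i * v i y) - (\<Sum>i<n. f i * v i x) * (v n y / v n x)"
            by (simp add: fun_sum_apply fun_scale_def v'_def right_diff_distrib sum_subtractf sum_distrib_left sum_divide_distrib mult_ac)
          then show "w' y = (\<Sum>i<n. fun_scale (f i) (v' i)) y"
            unfolding sum using x by (simp add: w'_def fun_scale_def field_simps)
        qed
      qed
      moreover have "w = w' + fun_scale (?c w) (v n)" by (simp add: w'_def fun_scale_def fun_eq_iff)
      moreover have "?c w \<in> K" using Suc.prems(3) I(4)[OF vn] by (intro K)
      ultimately show ?thesis using I(2) I(3)[OF _ vn] by metis
    qed
  qed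
  obtain S f where S: "finite S" "S \<subseteq> I" "w = (\<Sum>a\<in>S. fun_scale (f a) a)"
    using w(1) unfolding fun_space.span_explicit by blast
  obtain b where b: "bij_betw b {..<card S} S"
    using ex_bij_betw_nat_finite[OF S(1)] by (auto simp: atLeast0LessThan)
  show ?thesis
  proof (rule *[of "card S" b w "f \<circ> b"])
    show "b i \<in> I" if "i < card S" for i using b S(2) that by (auto simp: bij_betw_def)
    show "w = (\<Sum>i<card S. fun_scale ((f \<circ> b) i) (b i))"
      unfolding S(3) using sum.reindex_bij_betw[OF b, of "\<lambda>a. fun_scale (f a) a"] by simp
  qed (rule w)
qed

locale universal_twist_simple = universal_twist scale \<Delta> \<epsilon> antipode E j \<alpha>
  for scale :: "'k::field \<Rightarrow> 'h::ring_1 \<Rightarrow> 'h" and \<Delta> \<epsilon> antipode E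
    and j :: "('h, 'k) free_comm_algebra set \<Rightarrow> 'f::field" and \<alpha> +
  assumes simple: "simple_algebra (twisted_hopf_algebra scale \<Delta> \<alpha>)"
begin

section \<open>The twisted algebra of \<alpha>, carried by \<open>H\<close> itself\<close>

sublocale TK: twisted_by_form scale \<Delta> \<epsilon> antipode E id "(*)" UNIV \<alpha> 1
  by unfold_locales (auto simp: form_\<alpha>)

lemma twisted_hopf_algebra_eq: "twisted_hopf_algebra scale \<Delta> \<alpha> = TK.A"
  by (simp add: twisted_hopf_algebra_def)

text \<open>The product of the twisted algebra of \<alpha> after the tensor of 1 and
  \<open>x\<close> has been identified with \<open>x\<close>.\<close>

definition star :: "'h \<Rightarrow> 'h \<Rightarrow> 'h" where
  "star x y = (\<Sum>e\<in>E. \<Sum>e'\<in>E. scale (\<alpha> e e') (D e x * D e' y))"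

lemma star_add_left: "star (x + x') y = star x y + star x' y"
  and star_add_right: "star x (y + y') = star x y + star x y'"
  and star_scale_left: "star (scale c x) y = scale c (star x y)"
  and star_scale_right: "star x (scale c y) = scale c (star x y)"
  by (simp_all add: star_def D_add D_scale distrib_left distrib_right scale_right_distrib sum.distrib
      scale_mult_left scale_mult_right scale_sum_right mult.commute)

lemma star_0_left [simp]: "star 0 y = 0" and star_0_right [simp]: "star x 0 = 0"
  using star_add_left[of 0 0 y] star_add_right[of x 0 0] by (simp_all only: add_0_right add_cancel_right_right)

lemma star_sum_left: "star (sum f A) y = (\<Sum>i\<in>A. star (f i) y)"
  and star_sum_right: "star x (sum f A) = (\<Sum>i\<in>A. star x (f i))"
  by (induction A rule: infinite_finite_induct) (auto simp: star_add_left star_add_right)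

definition \<theta> :: "('k \<times> 'h \<Rightarrow>\<^sub>0 int) set \<Rightarrow> 'h" where "\<theta> = tensor_lift type_group scale"

lemma balanced_scale: "balanced_map G0 TK.R Hm type_group scale"
  by (rule balanced_mapI) (simp_all add: scale_left_distrib scale_right_distrib mult.commute)

lemma \<theta>_pure: "\<theta> (TK.RH.pt c x) = scale c x"
  unfolding \<theta>_def using TK.RH.tensor_lift_pure[OF comm_group_type_group balanced_scale, of c x] by simp

lemma \<theta>_add: "u \<in> carrier TK.A \<Longrightarrow> v \<in> carrier TK.A \<Longrightarrow> \<theta> (u \<oplus>\<^bsub>TK.A\<^esub> v) = \<theta> u + \<theta> v"
  unfolding \<theta>_def using TK.RH.tensor_lift_mult[OF comm_group_type_group balanced_scale, of u v]
  by (simp add: TK.twisted_simps)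

lemma \<theta>_pure_mult: "\<theta> (TK.pure_mult b x c y) = star (scale b x) (scale c y)"
proof -
  have "\<theta> (TK.pure_mult b x c y) = (\<Sum>e\<in>E. \<Sum>e'\<in>E. scale (b * c * \<alpha> e e') (D e x * D e' y))"
    unfolding \<theta>_def using TK.tensor_lift_pure_mult[OF balanced_scale, of b c x y] by simp
  then show ?thesis
    by (simp add: star_def D_scale scale_mult_left scale_mult_right mult_ac)
qed

lemma \<theta>_mult:
  assumes u: "u \<in> carrier TK.A" and v: "v \<in> carrier TK.A"
  shows "\<theta> (u \<otimes>\<^bsub>TK.A\<^esub> v) = star (\<theta> u) (\<theta> v)"
proof -
  note add = \<theta>_add[unfolded TK.twisted_simps]
  have u: "u \<in> carrier TK.RH.TG" and v: "v \<in> carrier TK.RH.TG" using u v by (simp_all add: TK.twisted_simps)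
  from u show ?thesis unfolding TK.twisted_mult
  proof (induction rule: TK.RH.tensor_induct)
    case (pure b x)
    from v show ?case
    proof (induction rule: TK.RH.tensor_induct)
      case (pure c y)
      then show ?case by (simp add: TK.mult.lift2_pure \<theta>_pure_mult \<theta>_pure)
    next
      case (mult v v')
      moreover have "TK.RH.pt b x \<in> carrier TK.RH.TG" by simp
      ultimately show ?case
        by (simp add: TK.mult.lift2_mult_right TK.mult.lift2_closed add star_add_right)
    qed
  next
    case (mult u u')
    then show ?case using v by (simp add: TK.mult.lift2_mult_left TK.mult.lift2_closed add star_add_left)
  qed
qed

lemma lift_closed: "TK.RH.pt 1 x \<in> carrier TK.A"
  using TK.pt_closed[of 1 x] by (simp add: TK.twisted_simps)

lemma ring_TK: "ring TK.A"
  using simple by (simp add: simple_algebra_def twisted_hopf_algebra_eq)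

text \<open>Transported by \<open>\<theta>\<close> from the ring laws contained in
  \<open>simple_algebra\<close>: \<open>\<theta>\<close> is multiplicative and sends the tensor of 1
  and \<open>x\<close> to \<open>x\<close>.\<close>

lemma star_assoc: "star (star x y) z = star x (star y z)"
proof -
  interpret A: ring TK.A by (rule ring_TK)
  have "\<theta> (TK.RH.pt 1 x \<otimes>\<^bsub>TK.A\<^esub> TK.RH.pt 1 y \<otimes>\<^bsub>TK.A\<^esub> TK.RH.pt 1 z) =
      \<theta> (TK.RH.pt 1 x \<otimes>\<^bsub>TK.A\<^esub> (TK.RH.pt 1 y \<otimes>\<^bsub>TK.A\<^esub> TK.RH.pt 1 z))"
    using A.m_assoc lift_closed by simp
  then show ?thesis by (simp add: \<theta>_mult lift_closed \<theta>_pure)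
qed

lemma star_one: "star 1 x = x" "star x 1 = x"
proof -
  interpret A: ring TK.A by (rule ring_TK)
  have "\<theta> (\<one>\<^bsub>TK.A\<^esub> \<otimes>\<^bsub>TK.A\<^esub> TK.RH.pt 1 x) = x" "\<theta> (TK.RH.pt 1 x \<otimes>\<^bsub>TK.A\<^esub> \<one>\<^bsub>TK.A\<^esub>) = x"
    using lift_closed by (simp_all add: \<theta>_pure)
  then show "star 1 x = x" "star x 1 = x"
    using lift_closed by (simp_all only: \<theta>_mult A.one_closed \<theta>_pure TK.twisted_simps(4) lift_closed) (simp_all add: \<theta>_pure)
qed

text \<open>The preimage of \<open>L\<close> under \<open>\<theta>\<close> is an ideal; it is closed
  under negatives because \<open>L\<close> is closed under products with minus the unit. It is not
  zero, since the tensor of 1 and \<open>h\<close> has image \<open>h\<close>.\<close>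

lemma star_simple:
  assumes L: "0 \<in> L" "\<And>x y. x \<in> L \<Longrightarrow> y \<in> L \<Longrightarrow> x + y \<in> L"
      "\<And>x y. x \<in> L \<Longrightarrow> star y x \<in> L" "\<And>x y. x \<in> L \<Longrightarrow> star x y \<in> L"
    and h: "h \<in> L" "h \<noteq> 0"
  shows "x \<in> L"
proof -
  interpret A: ring TK.A by (rule ring_TK)
  let ?I = "{u \<in> carrier TK.A. \<theta> u \<in> L}"
  have zero: "\<theta> \<zero>\<^bsub>TK.A\<^esub> = 0" using \<theta>_add[of "\<zero>\<^bsub>TK.A\<^esub>" "\<zero>\<^bsub>TK.A\<^esub>"] by simp
  have minus: "- x \<in> L" if "x \<in> L" for x
  proof -
    have "star (scale (-1) 1) x = - x" unfolding star_scale_left star_one by simp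
    then show ?thesis using L(3)[OF that, of "scale (-1) 1"] by (simp only:)
  qed
  have "ideal ?I TK.A"
  proof (rule idealI)
    show "subgroup ?I (add_monoid TK.A)"
    proof (rule A.add.subgroupI)
      have "\<zero>\<^bsub>TK.A\<^esub> \<in> ?I" using zero L(1) by simp
      then show "?I \<noteq> {}" by (metis empty_iff)
      show "\<ominus>\<^bsub>TK.A\<^esub> u \<in> ?I" if "u \<in> ?I" for u
      proof -
        have u: "u \<in> carrier TK.A" "\<theta> u \<in> L" using that by simp_all
        have "\<theta> u + \<theta> (\<ominus>\<^bsub>TK.A\<^esub> u) = 0"
          using \<theta>_add[OF u(1) A.a_inv_closed[OF u(1)]] u(1) by (simp add: A.r_neg zero)
        then have "\<theta> (\<ominus>\<^bsub>TK.A\<^esub> u) = - \<theta> u" by (metis add_eq_0_iff)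
        then show ?thesis using A.a_inv_closed[OF u(1)] minus[OF u(2)] by simp
      qed
      show "u \<oplus>\<^bsub>TK.A\<^esub> v \<in> ?I" if "u \<in> ?I" "v \<in> ?I" for u v
        using that \<theta>_add[of u v] L(2)[of "\<theta> u" "\<theta> v"] by simp
    qed simp
    show "v \<otimes>\<^bsub>TK.A\<^esub> u \<in> ?I" "u \<otimes>\<^bsub>TK.A\<^esub> v \<in> ?I" if "u \<in> ?I" "v \<in> carrier TK.A" for u v
      using that \<theta>_mult[of u v] \<theta>_mult[of v u] L(3)[of "\<theta> u" "\<theta> v"] L(4)[of "\<theta> u" "\<theta> v"] by simp_all
  qed (rule ring_TK)
  then have "?I = {\<zero>\<^bsub>TK.A\<^esub>} \<or> ?I = carrier TK.A"
    using simple unfolding simple_algebra_def twisted_hopf_algebra_eq by blast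
  moreover have "TK.RH.pt 1 h \<in> ?I" using h lift_closed by (simp add: \<theta>_pure)
  moreover have "TK.RH.pt 1 h \<noteq> \<zero>\<^bsub>TK.A\<^esub>"
  proof
    assume eq: "TK.RH.pt 1 h = \<zero>\<^bsub>TK.A\<^esub>"
    show False using zero h(2) unfolding eq[symmetric] by (simp add: \<theta>_pure)
  qed
  ultimately have "TK.RH.pt 1 x \<in> ?I" using lift_closed by blast
  then show ?thesis by (simp add: \<theta>_pure)
qed

text \<open>
  The algebra obtained from \<open>\<^sup>\<alpha>H\<close> by extending scalars to \<open>K\<^sub>H\<close>, in coordinates with respect to
  the basis \<open>E\<close>: functions that vanish outside \<open>E\<close>.
\<close>
definition mulW :: "('h \<Rightarrow> 'f) \<Rightarrow> ('h \<Rightarrow> 'f) \<Rightarrow> 'h \<Rightarrow> 'f" where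
  "mulW v w = (\<lambda>e. \<Sum>x\<in>E. \<Sum>y\<in>E. v x * w y * \<iota> (coord e (star x y)))"

definition emb :: "'h \<Rightarrow> 'h \<Rightarrow> 'f" where "emb x = (\<lambda>e. \<iota> (coord e x))"

definition W :: "('h \<Rightarrow> 'f) set" where "W = {v. \<forall>e. e \<notin> E \<longrightarrow> v e = 0}"

lemma emb_in_W: "emb x \<in> W" by (simp add: W_def emb_def coord_outside)

lemma mulW_in_W: "mulW v w \<in> W" by (simp add: W_def mulW_def coord_outside)

lemma W_expand: assumes "v \<in> W" shows "v = (\<Sum>e\<in>E. fun_scale (v e) (emb e))"
proof
  fix x
  have "(\<Sum>e\<in>E. fun_scale (v e) (emb e)) x = (\<Sum>e\<in>E. if x = e then v e else 0)"
    unfolding fun_sum_apply fun_scale_def emb_def by (intro sum.cong refl) (simp add: coord_basis)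
  then show "v x = (\<Sum>e\<in>E. fun_scale (v e) (emb e)) x"
    using assms finite_E by (auto simp: W_def)
qed

lemma subspace_W: "fun_space.subspace W"
  by (auto simp: fun_space.subspace_def W_def fun_scale_def)

lemma span_emb: "fun_space.span (emb ` E) = W"
proof
  show "fun_space.span (emb ` E) \<subseteq> W"
    by (rule fun_space.span_minimal[OF _ subspace_W]) (auto simp: emb_in_W)
  show "W \<subseteq> fun_space.span (emb ` E)"
  proof
    fix v assume v: "v \<in> W"
    have "(\<Sum>e\<in>E. fun_scale (v e) (emb e)) \<in> fun_space.span (emb ` E)"
      by (intro fun_space.span_sum fun_space.span_scale fun_space.span_base imageI)
    then show "v \<in> fun_space.span (emb ` E)" by (simp only: W_expand[OF v, symmetric])
  qed
qed

lemma mulW_add_left: "mulW (v + v') w = mulW v w + mulW v' w"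
  and mulW_add_right: "mulW v (w + w') = mulW v w + mulW v w'"
  and mulW_scale_left: "mulW (fun_scale c v) w = fun_scale c (mulW v w)"
  and mulW_scale_right: "mulW v (fun_scale c w) = fun_scale c (mulW v w)"
  by (simp_all add: mulW_def fun_scale_def fun_eq_iff distrib_left distrib_right sum.distrib sum_distrib_left mult_ac)

lemma mulW_0 [simp]: "mulW 0 w = 0" "mulW v 0 = 0"
  by (simp_all add: mulW_def fun_eq_iff)

lemma coord_0 [simp]: "coord e 0 = 0"
  using coord_add[of e 0 0] by (simp only: add_0_right add_cancel_right_right)

lemma coord_sum: "coord e (sum f A) = (\<Sum>i\<in>A. coord e (f i))"
  by (induction A rule: infinite_finite_induct) (auto simp: coord_add)

lemma coord_star: "coord e (star x y) = (\<Sum>p\<in>E. \<Sum>q\<in>E. coord p x * coord q y * coord e (star p q))"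
proof -
  have "star x y = star (\<Sum>p\<in>E. scale (coord p x) p) (\<Sum>q\<in>E. scale (coord q y) q)"
    by (simp only: coord_expand)
  also have "\<dots> = (\<Sum>p\<in>E. star (scale (coord p x) p) (\<Sum>q\<in>E. scale (coord q y) q))"
    by (rule star_sum_left)
  also have "\<dots> = (\<Sum>p\<in>E. \<Sum>q\<in>E. scale (coord p x) (scale (coord q y) (star p q)))"
    by (simp add: star_sum_right star_scale_left star_scale_right mult.commute)
  finally show ?thesis by (simp add: coord_sum coord_scale mult.assoc)
qed

lemma mulW_emb: "mulW (emb x) (emb y) = emb (star x y)"
  unfolding mulW_def emb_def
  by (subst coord_star) (simp add: ground.hom_sum ground.hom_mult)

lemma W_induct [consumes 1, case_names base add scale]:
  assumes v: "v \<in> W" and base: "\<And>x. Q (emb x)"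
    and add: "\<And>v w. v \<in> W \<Longrightarrow> w \<in> W \<Longrightarrow> Q v \<Longrightarrow> Q w \<Longrightarrow> Q (v + w)"
    and scale: "\<And>c v. v \<in> W \<Longrightarrow> Q v \<Longrightarrow> Q (fun_scale c v)"
  shows "Q v"
proof -
  have "emb 0 = 0" by (simp add: emb_def fun_eq_iff)
  then have zero: "Q 0" using base[of 0] by simp
  have "v \<in> W \<and> Q v" if "v \<in> fun_space.span (emb ` E)" for v
    using that
  proof (rule fun_space.span_induct)
    show "fun_space.subspace {v. v \<in> W \<and> Q v}"
      using subspace_W zero add scale unfolding fun_space.subspace_def by auto
  qed (auto simp: emb_in_W base)
  then show ?thesis using v span_emb by auto
qed

lemma mulW_assoc:
  assumes "u \<in> W" "v \<in> W" "w \<in> W"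
  shows "mulW (mulW u v) w = mulW u (mulW v w)"
  using assms(1)
proof (induction rule: W_induct)
  case (base x)
  from assms(2) show ?case
  proof (induction rule: W_induct)
    case (base y)
    from assms(3) show ?case
      by (induction rule: W_induct)
        (simp_all only: mulW_emb star_assoc mulW_add_right mulW_scale_right)
  qed (simp_all only: mulW_add_left mulW_scale_left mulW_add_right mulW_scale_right)
qed (simp_all only: mulW_add_left mulW_scale_left)

lemma mulW_one_left: "v \<in> W \<Longrightarrow> mulW (emb 1) v = v"
  by (induction rule: W_induct) (simp_all only: mulW_emb star_one mulW_add_right mulW_scale_right)

lemma mulW_one_right: "v \<in> W \<Longrightarrow> mulW v (emb 1) = v"
  by (induction rule: W_induct) (simp_all only: mulW_emb star_one mulW_add_left mulW_scale_left)

lemma coord_of_residues: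
  assumes r: "\<And>e. e \<notin> E \<Longrightarrow> r e = 0"
  shows "coord e (\<Sum>x\<in>E. scale (r x) x) = r e"
proof -
  have "coord e (\<Sum>x\<in>E. scale (r x) x) = (\<Sum>x\<in>E. if e = x then r x else 0)"
    unfolding coord_sum coord_scale by (intro sum.cong refl) (simp add: coord_basis)
  then show ?thesis using finite_E r by auto
qed

lemma residue_outside: "v \<in> W \<Longrightarrow> place (v e) c \<Longrightarrow> e \<notin> E \<Longrightarrow> c = 0"
  using F.P_unique[OF F.P_0] by (auto simp: W_def)

text \<open>The structure constants of \<open>mulW\<close> come from \<open>k\<close> and are their
  own residues, so reduction at the place respects products.\<close>

lemma residue_mulW:
  assumes "\<And>e. place (v e) (coord e x)" "\<And>e. place (w e) (coord e y)"
  shows "place (mulW v w e) (coord e (star x y))"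
  unfolding mulW_def by (subst coord_star) (intro F.P_sum F.P_mult F.P_const assms)

lemma place_emb: "place (emb x e) (coord e x)"
  by (simp add: emb_def F.P_const)

lemma W_simple:
  assumes I: "fun_space.subspace I" "I \<subseteq> W"
      "\<And>v w. v \<in> W \<Longrightarrow> w \<in> I \<Longrightarrow> mulW v w \<in> I" "\<And>v w. v \<in> W \<Longrightarrow> w \<in> I \<Longrightarrow> mulW w v \<in> I"
    and v: "v \<in> I" "v \<noteq> 0"
  shows "emb 1 \<in> I"
proof -
  define L where "L = {h. \<exists>w\<in>I. \<forall>e. place (w e) (coord e h)}"
  have vW: "v \<in> W" using v I by blast
  obtain x where "x \<in> E" "v x \<noteq> 0" using v vW by (force simp: W_def fun_eq_iff)
  then obtain x0 where x0: "x0 \<in> E" "v x0 \<noteq> 0" "\<And>x. x \<in> E \<Longrightarrow> \<exists>c. place (v x / v x0) c"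
    using F.scale_into_place[OF finite_E] by blast
  define v' where "v' = fun_scale (1 / v x0) v"
  have v': "v' \<in> I" unfolding v'_def using v I by (intro fun_space.subspace_scale)
  then have v'W: "v' \<in> W" using I by blast
  have "\<exists>c. place (v' x) c" for x
    using x0(2) x0(3)[of x] v'W F.P_0 by (cases "x \<in> E") (auto simp: v'_def fun_scale_def W_def)
  then obtain r where r: "\<And>x. place (v' x) (r x)" by metis
  let ?h = "\<Sum>x\<in>E. scale (r x) x"
  have coord_h: "coord e ?h = r e" for e
    by (rule coord_of_residues) (rule residue_outside[OF v'W r])
  have h_in: "?h \<in> L" unfolding L_def using v' r coord_h by auto
  have h_nz: "?h \<noteq> 0"
  proof
    assume h0: "?h = 0"
    have "r x0 = 0" using coord_h[of x0] unfolding h0 by simp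
    \<comment> \<open>The rescaling made the coordinate at the pivot equal to 1, whose only residue
      is 1.\<close>
    moreover have "place 1 (r x0)" using r[of x0] x0(2) by (simp add: v'_def fun_scale_def)
    ultimately show False using F.P_1 F.P_unique by fastforce
  qed
  have L_0: "0 \<in> L" unfolding L_def
    using fun_space.subspace_0[OF I(1)] F.P_0 by (auto intro!: bexI[of _ 0])
  have L_add: "x + y \<in> L" if xy: "x \<in> L" "y \<in> L" for x y
  proof -
    obtain a b where "a \<in> I" "b \<in> I" "\<And>e. place (a e) (coord e x)" "\<And>e. place (b e) (coord e y)"
      using xy unfolding L_def by blast
    then show ?thesis unfolding L_def
      by (auto intro!: bexI[of _ "a + b"] fun_space.subspace_add[OF I(1)] F.P_add simp: coord_add)
  qed
  have L_star: "star y x \<in> L" "star x y \<in> L" if x: "x \<in> L" for x y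
  proof -
    obtain a where a: "a \<in> I" "\<And>e. place (a e) (coord e x)" using x unfolding L_def by blast
    have "mulW (emb y) a \<in> I" "mulW a (emb y) \<in> I" using I(3,4) a(1) emb_in_W by blast+
    then show "star y x \<in> L" "star x y \<in> L"
      unfolding L_def using residue_mulW[OF place_emb a(2)] residue_mulW[OF a(2) place_emb] by blast+
  qed
  have "1 \<in> L" by (rule star_simple[OF L_0 L_add L_star h_in h_nz])
  then obtain w where w: "w \<in> I" "\<And>e. place (w e) (coord e 1)" unfolding L_def by blast
  have "\<exists>g\<in>fun_space.span (emb ` E). mulW g w = emb 1"
  proof (rule F.surj_of_residue_identity[OF _ _ _ finite_E])
    show "Vector_Spaces.linear fun_scale fun_scale (\<lambda>g. mulW g w)"
      by (simp add: Vector_Spaces.linear_iff fun_space.vector_space_axioms mulW_add_left mulW_scale_left)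
    show "finite (emb ` E)" using finite_E by simp
    show "(\<lambda>g. mulW g w) ` fun_space.span (emb ` E) \<subseteq> fun_space.span (emb ` E)"
      unfolding span_emb by (auto simp: mulW_in_W)
    show "\<forall>x. \<exists>c. place (v x) c" if "v \<in> fun_space.span (emb ` E)" "\<And>x. x \<in> E \<Longrightarrow> \<exists>c. place (v x) c" for v
      using that F.P_0 unfolding span_emb W_def by force
    show "v = 0" if "v \<in> fun_space.span (emb ` E)" "\<And>x. x \<in> E \<Longrightarrow> v x = 0" for v
      using that unfolding span_emb by (force simp: W_def fun_eq_iff)
    show "emb 1 \<in> fun_space.span (emb ` E)" unfolding span_emb by (rule emb_in_W)
    show "place (mulW v w e) (r e)" if v: "v \<in> fun_space.span (emb ` E)" and r: "\<And>x. place (v x) (r x)" for v r e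
    proof -
      have coord: "coord e (\<Sum>x\<in>E. scale (r x) x) = r e" for e
        using v unfolding span_emb by (intro coord_of_residues) (rule residue_outside[OF _ r])
      \<comment> \<open>Since \<open>w\<close> reduces to the unit, the product reduces to the
        residue vector of \<open>v\<close>. Hence \<open>w\<close> has a left inverse
        \<open>g\<close>.\<close>
      have "place (mulW v w e) (coord e (star (\<Sum>x\<in>E. scale (r x) x) 1))"
        by (rule residue_mulW[OF _ w(2)]) (simp only: coord r)
      then show ?thesis by (simp only: star_one coord)
    qed
  qed
  then obtain g where "g \<in> W" "mulW g w = emb 1" unfolding span_emb by blast
  then show ?thesis using I(3)[OF _ w(1)] by metis
qed

end


section \<open>The generic Galois algebra over the field of fractions\<close>

lemma fun_linear_span_image:
  assumes "Vector_Spaces.linear fun_scale fun_scale L"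
  shows "L ` fun_space.span S = fun_space.span (L ` S)"
proof -
  interpret L: Vector_Spaces.linear fun_scale fun_scale L by (rule assms)
  show ?thesis by (rule L.span_image[symmetric])
qed

text \<open>As rewrite rules these are eta-contracted and would unfold every sum of functions.\<close>
declare plus_fun_apply [simp del] zero_fun_apply [simp del]

context universal_twist_simple
begin

sublocale TF: twisted_by_form scale \<Delta> \<epsilon> antipode E \<iota> "K_scale scale j" B \<sigma> "tinv 1"
  by (intro twisted_by_form.intro F.hopf_functionals_axioms twisted_by_form_axioms.intro)
    (auto simp: K_scale_def B_0 B_add B_minus B_mult B_scale form_\<sigma> generators_in_B)

abbreviation "KF \<equiv> algebra_on (*) Frac :: ('f, 'f) module"

lemma algebra_eqs: "B_algebra scale \<Delta> \<epsilon> \<alpha> j = TF.R" "A_algebra scale \<Delta> \<epsilon> \<alpha> j = TF.A" "frac_B scale \<Delta> \<epsilon> \<alpha> j = KF"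
  by (simp_all add: B_algebra_def A_algebra_def frac_B_def Frac_def)

lemma nonassoc_algebra_KF: "nonassoc_algebra TF.R KF"
  by (rule nonassoc_algebra_algebra_on)
    (auto simp: B_subset_Frac B_0 Frac_add Frac_minus Frac_mult mult.assoc mult.left_commute)

sublocale T: tensor_product_algebra TF.R KF TF.A
  by (intro tensor_product_algebra.intro nonassoc_algebra_KF TF.nonassoc_algebra_A)

abbreviation "TA \<equiv> tensor_algebra TF.R KF TF.A"

section \<open>Extension of scalars for linear maps on \<open>H\<close>\<close>

lemma B_scalar_balanced:
  assumes G: "\<And>x y. G (x + y) = G x + G y" "\<And>c x. G (scale c x) = fun_scale (\<iota> c) (G x)"
  shows "balanced_map G0 TF.R Hm type_group (\<lambda>b x. fun_scale b (G x))"
  by (rule balanced_mapI) (simp_all add: G K_scale_def fun_space.scale_left_distrib fun_space.scale_right_distrib mult.commute)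

text \<open>The extension of a linear map \<open>G\<close> on \<open>H\<close> to the twisted
  algebra over \<open>B\<close>; \<open>liftT\<close> carries it on to fractions. \<open>G\<close>
  stays general because \<open>emb\<close> and \<open>\<Phi>0\<close> are both extended in this
  way.\<close>

definition liftA :: "('h \<Rightarrow> 'h \<Rightarrow> 'f) \<Rightarrow> ('f \<times> 'h \<Rightarrow>\<^sub>0 int) set \<Rightarrow> 'h \<Rightarrow> 'f" where
  "liftA G = tensor_lift type_group (\<lambda>b x. fun_scale b (G x))"

definition liftT :: "('h \<Rightarrow> 'h \<Rightarrow> 'f) \<Rightarrow> ('f \<times> ('f \<times> 'h \<Rightarrow>\<^sub>0 int) set \<Rightarrow>\<^sub>0 int) set \<Rightarrow> 'h \<Rightarrow> 'f" where
  "liftT G = tensor_lift type_group (\<lambda>z a. fun_scale z (liftA G a))"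

context
  fixes G :: "'h \<Rightarrow> 'h \<Rightarrow> 'f"
  assumes G: "\<And>x y. G (x + y) = G x + G y" "\<And>c x. G (scale c x) = fun_scale (\<iota> c) (G x)"
begin

lemma liftA_pure: "b \<in> B \<Longrightarrow> liftA G (TF.RH.pt b x) = fun_scale b (G x)"
  unfolding liftA_def
  using TF.RH.tensor_lift_pure[OF comm_group_type_group B_scalar_balanced[OF G], of b x] by simp

lemma liftA_add: "a \<in> carrier TF.RH.TG \<Longrightarrow> a' \<in> carrier TF.RH.TG \<Longrightarrow>
    liftA G (a \<otimes>\<^bsub>TF.RH.TG\<^esub> a') = liftA G a + liftA G a'"
  unfolding liftA_def
  using TF.RH.tensor_lift_mult[OF comm_group_type_group B_scalar_balanced[OF G], of a a'] by simp

lemma liftA_smult: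
  assumes b: "b \<in> B" and a: "a \<in> carrier TF.RH.TG"
  shows "liftA G (b \<odot>\<^bsub>TF.A\<^esub> a) = fun_scale b (liftA G a)"
  using a
proof (induction rule: TF.RH.tensor_induct)
  case (pure c x)
  then show ?case using b by (simp add: TF.smult_pure liftA_pure B_mult)
next
  case (mult a a')
  moreover have "b \<odot>\<^bsub>TF.A\<^esub> (a \<otimes>\<^bsub>TF.RH.TG\<^esub> a') = (b \<odot>\<^bsub>TF.A\<^esub> a) \<otimes>\<^bsub>TF.RH.TG\<^esub> (b \<odot>\<^bsub>TF.A\<^esub> a')"
    using Group.hom_mult[OF TF.smult_hom[OF b]] mult by blast
  moreover have "b \<odot>\<^bsub>TF.A\<^esub> a \<in> carrier TF.RH.TG" "b \<odot>\<^bsub>TF.A\<^esub> a' \<in> carrier TF.RH.TG"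
    using hom_in_carrier[OF TF.smult_hom[OF b]] mult by blast+
  ultimately show ?case by (simp add: liftA_add fun_space.scale_right_distrib)
qed

lemma liftT_balanced: "balanced_map TF.R KF TF.A type_group (\<lambda>z a. fun_scale z (liftA G a))"
  by (rule balanced_mapI)
    (simp_all add: TF.twisted_simps(1,2) liftA_add liftA_smult fun_space.scale_left_distrib fun_space.scale_right_distrib mult.commute)

lemma liftT_pure: "z \<in> Frac \<Longrightarrow> a \<in> carrier TF.RH.TG \<Longrightarrow> liftT G (T.pt z a) = fun_scale z (liftA G a)"
  unfolding liftT_def
  using T.tensor_lift_pure[OF comm_group_type_group liftT_balanced, of z a] by (simp add: TF.twisted_simps(1))

lemma liftT_add: "u \<in> carrier T.TG \<Longrightarrow> v \<in> carrier T.TG \<Longrightarrow> liftT G (u \<otimes>\<^bsub>T.TG\<^esub> v) = liftT G u + liftT G v"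
  unfolding liftT_def
  using T.tensor_lift_mult[OF comm_group_type_group liftT_balanced, of u v] by simp

end

lemma emb_add: "emb (x + y) = emb x + emb y" and emb_scale: "emb (scale c x) = fun_scale (\<iota> c) (emb x)"
  by (simp_all add: emb_def fun_scale_def fun_eq_iff plus_fun_apply coord_add coord_scale ground.hom_add ground.hom_mult)

text \<open>
  \<open>\<kappa>\<close> gives the coordinates in the basis \<open>1 \<otimes> (1 \<otimes> e)\<close>, and \<open>\<Phi> = shear t \<circ> \<kappa>\<close> is the
  embedding into \<open>K\<^sub>H \<otimes> \<^sup>\<alpha>H\<close>.
\<close>
definition \<kappa> :: "('f \<times> ('f \<times> 'h \<Rightarrow>\<^sub>0 int) set \<Rightarrow>\<^sub>0 int) set \<Rightarrow> 'h \<Rightarrow> 'f" where "\<kappa> = liftT emb"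

definition \<Phi>0 :: "'h \<Rightarrow> 'h \<Rightarrow> 'f" where "\<Phi>0 x = (\<lambda>p. F.conv t (\<lambda>y. \<iota> (coord p y)) x)"

definition \<Phi> :: "('f \<times> ('f \<times> 'h \<Rightarrow>\<^sub>0 int) set \<Rightarrow>\<^sub>0 int) set \<Rightarrow> 'h \<Rightarrow> 'f" where "\<Phi> = liftT \<Phi>0"

text \<open>A functional \<open>u\<close> acts on coordinate vectors through the left leg of
  \<Delta>: \<open>emb x\<close> goes to the coordinates of the sum of \<open>u x1\<close> times
  \<open>x2\<close>.\<close>

definition shear :: "('h \<Rightarrow> 'f) \<Rightarrow> ('h \<Rightarrow> 'f) \<Rightarrow> 'h \<Rightarrow> 'f" where
  "shear u v = (\<lambda>p. \<Sum>e\<in>E. v e * F.conv u (\<lambda>y. \<iota> (coord p y)) e)"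

lemma functional_conv_coord: "F.functional (F.conv u (\<lambda>y. \<iota> (coord p y)))"
  by (intro F.functional_conv F.functional_coord)

lemma \<Phi>0_add: "\<Phi>0 (x + y) = \<Phi>0 x + \<Phi>0 y" and \<Phi>0_scale: "\<Phi>0 (scale c x) = fun_scale (\<iota> c) (\<Phi>0 x)"
  using F.functional_add[OF functional_conv_coord] F.functional_scale[OF functional_conv_coord]
  by (simp_all add: \<Phi>0_def fun_scale_def fun_eq_iff plus_fun_apply)

lemmas \<kappa>_pure = liftT_pure[of emb, OF emb_add emb_scale, folded \<kappa>_def]
  and \<kappa>_add = liftT_add[of emb, OF emb_add emb_scale, folded \<kappa>_def]
  and liftA_emb_pure = liftA_pure[of emb, OF emb_add emb_scale]
  and liftA_emb_add = liftA_add[of emb, OF emb_add emb_scale]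
  and \<Phi>_pure = liftT_pure[of \<Phi>0, OF \<Phi>0_add \<Phi>0_scale, folded \<Phi>_def]
  and \<Phi>_add = liftT_add[of \<Phi>0, OF \<Phi>0_add \<Phi>0_scale, folded \<Phi>_def]
  and liftA_\<Phi>0_pure = liftA_pure[of \<Phi>0, OF \<Phi>0_add \<Phi>0_scale]
  and liftA_\<Phi>0_add = liftA_add[of \<Phi>0, OF \<Phi>0_add \<Phi>0_scale]

lemma shear_linear: "Vector_Spaces.linear fun_scale fun_scale (shear u)"
  by (simp add: Vector_Spaces.linear_iff fun_space.vector_space_axioms shear_def fun_scale_def fun_eq_iff plus_fun_apply
      distrib_right sum.distrib sum_distrib_left mult.assoc)

lemma shear_add: "shear u (v + w) = shear u v + shear u w" and shear_scale: "shear u (fun_scale c v) = fun_scale c (shear u v)"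
  using shear_linear[of u] by (simp_all only: Vector_Spaces.linear_iff)

lemma shear_0: "shear u 0 = 0"
  by (simp add: shear_def fun_eq_iff zero_fun_apply)

lemma shear_emb: "shear t (emb x) = \<Phi>0 x"
proof
  fix p
  show "shear t (emb x) p = \<Phi>0 x p"
    unfolding shear_def \<Phi>0_def emb_def by (rule F.functional_expand[OF functional_conv_coord, symmetric])
qed

text \<open>Acting through the left leg reverses the order: by coassociativity,
  \<open>shear u\<close> after \<open>shear w\<close> is the action of
  \<open>conv w u\<close>.\<close>

lemma shear_shear:
  assumes u: "F.functional u" and w: "F.functional w" and uw: "F.conv w u = F.counit" and v: "v \<in> W"
  shows "shear u (shear w v) = v"
proof
  fix p
  let ?c = "\<lambda>p y. \<iota> (coord p y)"
  have c: "F.functional (?c p)" for p by (rule F.functional_coord)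
  have *: "(\<Sum>q\<in>E. F.conv w (?c q) e * F.conv u (?c p) q) = ?c p e" for e
  proof -
    have "(\<Sum>q\<in>E. F.conv w (?c q) e * F.conv u (?c p) q) = F.conv w (\<lambda>y. \<Sum>q\<in>E. ?c q y * F.conv u (?c p) q) e"
      unfolding F.conv_def[of w] sw_def sum_distrib_left sum_distrib_right mult.assoc by (rule sum.swap)
    also have "(\<lambda>y. \<Sum>q\<in>E. ?c q y * F.conv u (?c p) q) = F.conv u (?c p)"
      by (rule ext) (rule F.functional_expand[OF functional_conv_coord, symmetric])
    also have "F.conv w (F.conv u (?c p)) = ?c p"
      by (simp only: F.conv_assoc[OF w u c, symmetric] uw F.conv_counit_left[OF c])
    finally show ?thesis .
  qed
  have "shear u (shear w v) p = (\<Sum>e\<in>E. v e * (\<Sum>q\<in>E. F.conv w (?c q) e * F.conv u (?c p) q))"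
    unfolding shear_def sum_distrib_left sum_distrib_right mult.assoc by (rule sum.swap)
  also have "\<dots> = (\<Sum>e\<in>E. fun_scale (v e) (emb e)) p"
    unfolding * by (simp add: fun_sum_apply fun_scale_def emb_def)
  also have "\<dots> = v p" by (simp only: W_expand[OF v, symmetric])
  finally show "shear u (shear w v) p = v p" .
qed

lemma shear_in_W: "shear u v \<in> W"
proof -
  have "F.conv u (\<lambda>y. \<iota> (coord p y)) e = 0" if "p \<notin> E" for p e
    using that by (simp add: F.conv_def sw_def coord_outside)
  then show ?thesis by (simp add: W_def shear_def)
qed

lemmas shear_t_tinv = shear_shear[OF functional_t tinv(1,3)] and shear_tinv_t = shear_shear[OF tinv(1) functional_t tinv(2)]

lemma \<Phi>_eq: assumes u: "u \<in> carrier T.TG" shows "\<Phi> u = shear t (\<kappa> u)"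
  using u
proof (induction rule: T.tensor_induct)
  case (pure z a)
  have "a \<in> carrier TF.RH.TG" using pure by (simp add: TF.twisted_simps(1))
  then have "liftA \<Phi>0 a = shear t (liftA emb a)"
    by (induction rule: TF.RH.tensor_induct)
      (simp_all add: liftA_\<Phi>0_pure liftA_emb_pure shear_scale shear_emb liftA_\<Phi>0_add liftA_emb_add shear_add)
  then show ?case using pure
    by (simp add: \<Phi>_pure \<kappa>_pure TF.twisted_simps(1) shear_scale)
next
  case (mult u v)
  then show ?case by (simp add: \<Phi>_add \<kappa>_add shear_add)
qed

text \<open>The elements of \<open>H\<close> have coordinates in \<open>k\<close>, and
  \<open>\<kappa>\<close> only multiplies these by scalars from \<open>B\<close> and
  \<open>Frac\<close> and adds the results.\<close>

lemma \<kappa>_values: assumes u: "u \<in> carrier T.TG" shows "\<kappa> u e \<in> Frac" "\<kappa> u \<in> W"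
proof -
  have "\<kappa> u e \<in> Frac \<and> \<kappa> u \<in> W"
    using u
  proof (induction rule: T.tensor_induct)
    case (pure z a)
    then have z: "z \<in> Frac" by simp
    have a: "a \<in> carrier TF.RH.TG" using pure by (simp add: TF.twisted_simps(1))
    then have "liftA emb a e \<in> Frac \<and> liftA emb a \<in> W"
    proof (induction rule: TF.RH.tensor_induct)
      case (pure b x)
      have "b * \<iota> (coord e x) \<in> B" using B_scale[of b "coord e x"] pure by (simp add: mult.commute)
      then show ?case using pure fun_space.subspace_scale[OF subspace_W emb_in_W[of x], of b]
        by (simp add: liftA_emb_pure) (simp add: fun_scale_def emb_def B_subset_Frac)
    next
      case (mult a a')
      then show ?case using fun_space.subspace_add[OF subspace_W, of "liftA emb a" "liftA emb a'"]
        by (simp add: liftA_emb_add plus_fun_apply[of "liftA emb a" "liftA emb a'" e] Frac_add)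
    qed
    then show ?case using fun_space.subspace_scale[OF subspace_W, of "liftA emb a" z] z a
      by (simp add: \<kappa>_pure) (simp add: fun_scale_def Frac_mult)
  next
    case (mult u v)
    then show ?case using fun_space.subspace_add[OF subspace_W, of "\<kappa> u" "\<kappa> v"]
      by (simp add: \<kappa>_add plus_fun_apply[of "\<kappa> u" "\<kappa> v" e] Frac_add)
  qed
  then show "\<kappa> u e \<in> Frac" "\<kappa> u \<in> W" by auto
qed

definition basis_T :: "'f \<Rightarrow> 'h \<Rightarrow> ('f \<times> ('f \<times> 'h \<Rightarrow>\<^sub>0 int) set \<Rightarrow>\<^sub>0 int) set" where
  "basis_T z x = T.pt z (TF.RH.pt 1 x)"

lemma T_pt_add_left: "z \<in> Frac \<Longrightarrow> z' \<in> Frac \<Longrightarrow> a \<in> carrier TF.RH.TG \<Longrightarrow>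
    T.pt (z + z') a = T.pt z a \<otimes>\<^bsub>T.TG\<^esub> T.pt z' a"
  using T.pt_add_left[unfolded algebra_on_simps TF.twisted_simps(1)] .

lemma T_pt_add_right: "z \<in> Frac \<Longrightarrow> a \<in> carrier TF.RH.TG \<Longrightarrow> a' \<in> carrier TF.RH.TG \<Longrightarrow>
    T.pt z (a \<otimes>\<^bsub>TF.RH.TG\<^esub> a') = T.pt z a \<otimes>\<^bsub>T.TG\<^esub> T.pt z a'"
  using T.pt_add_right[unfolded algebra_on_simps TF.twisted_simps(1,2)] .

lemma T_pt_smult: "b \<in> B \<Longrightarrow> z \<in> Frac \<Longrightarrow> a \<in> carrier TF.RH.TG \<Longrightarrow> T.pt (b * z) a = T.pt z (b \<odot>\<^bsub>TF.A\<^esub> a)"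
  using T.pt_smult[unfolded algebra_on_simps TF.twisted_simps(1)] .

lemma T_pt_closed: "z \<in> Frac \<Longrightarrow> a \<in> carrier TF.RH.TG \<Longrightarrow> T.pt z a \<in> carrier T.TG"
  using T.pt_closed[unfolded algebra_on_simps TF.twisted_simps(1)] .

lemma basis_T_closed: "z \<in> Frac \<Longrightarrow> basis_T z x \<in> carrier T.TG"
  unfolding basis_T_def by (intro T_pt_closed TF.pt_closed B_1)

lemma basis_T_add: "z \<in> Frac \<Longrightarrow> z' \<in> Frac \<Longrightarrow> basis_T (z + z') x = basis_T z x \<otimes>\<^bsub>T.TG\<^esub> basis_T z' x"
  unfolding basis_T_def by (intro T_pt_add_left TF.pt_closed B_1)

text \<open>Every scalar can be moved across both tensor products into the left factor, so an
  element is recovered from its coordinates. In particular \<open>\<kappa>\<close> is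
  injective.\<close>

lemma T_expand:
  assumes u: "u \<in> carrier T.TG"
  shows "finprod T.TG (\<lambda>e. basis_T (\<kappa> u e) e) E = u"
  using u
proof (induction rule: T.tensor_induct)
  case (pure z a)
  then have z: "z \<in> Frac" by simp
  have a: "a \<in> carrier TF.RH.TG" using pure by (simp add: TF.twisted_simps(1))
  then show ?case
  proof (induction rule: TF.RH.tensor_induct)
    case (pure b x)
    then have b: "b \<in> B" by simp
    \<comment> \<open>The scalar \<open>c\<close> first crosses from \<open>H\<close> to
      \<open>B\<close>, and then joins \<open>b\<close> on the way to the fraction.\<close>
    have pt: "T.pt z (TF.RH.pt b (scale c e)) = basis_T (z * (b * \<iota> c)) e" for c e
    proof -
      have cb: "\<iota> c * b \<in> B" using b by (rule B_scale)
      have "TF.RH.pt b (scale c e) = (\<iota> c * b) \<odot>\<^bsub>TF.A\<^esub> TF.RH.pt 1 e"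
        using TF.pt_scale[OF b, of c e] TF.smult_pure[OF cb B_1, of e] by simp
      then show ?thesis
        using T_pt_smult[OF cb z TF.pt_closed[OF B_1, of e]] by (simp add: basis_T_def mult_ac)
    qed
    have "T.pt z (TF.RH.pt b (\<Sum>e\<in>E. scale (coord e x) e)) = finprod T.TG (\<lambda>e. T.pt z (TF.RH.pt b (scale (coord e x) e))) E"
      by (rule finprod_sum[OF T.comm_group_TG, of "\<lambda>x. T.pt z (TF.RH.pt b x)"])
        (auto simp: TF.pt_add_right b T_pt_add_right z TF.pt_closed T_pt_closed finite_E)
    moreover have "\<kappa> (T.pt z (TF.RH.pt b x)) = (\<lambda>e. z * (b * \<iota> (coord e x)))"
      using z b TF.pt_closed[OF b, of x] by (simp add: \<kappa>_pure liftA_emb_pure) (simp add: fun_scale_def emb_def mult.assoc)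
    ultimately show ?case by (simp only: coord_expand pt)
  next
    case (mult a a')
    have closed: "basis_T (\<kappa> (T.pt z a) e) e' \<in> carrier T.TG" if "a \<in> carrier TF.RH.TG" for a e e'
      using that z by (intro basis_T_closed \<kappa>_values T_pt_closed)
    have "basis_T (\<kappa> (T.pt z (a \<otimes>\<^bsub>TF.RH.TG\<^esub> a')) e) e =
        basis_T (\<kappa> (T.pt z a) e) e \<otimes>\<^bsub>T.TG\<^esub> basis_T (\<kappa> (T.pt z a') e) e" for e
    proof -
      have pts: "T.pt z a \<in> carrier T.TG" "T.pt z a' \<in> carrier T.TG" using mult z by (auto intro: T_pt_closed)
      show ?thesis
        using basis_T_add[OF \<kappa>_values(1)[OF pts(1)] \<kappa>_values(1)[OF pts(2)]] mult(1,2) z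
        by (simp add: T_pt_add_right \<kappa>_add[OF pts] plus_fun_apply[of "\<kappa> (T.pt z a)" "\<kappa> (T.pt z a')"])
    qed
    then show ?case
      using T.TG.finprod_multf[of "\<lambda>e. basis_T (\<kappa> (T.pt z a) e) e" E "\<lambda>e. basis_T (\<kappa> (T.pt z a') e) e",
          OF funcsetI funcsetI, OF closed[OF mult(1)] closed[OF mult(2)]] mult z
      by (simp only: T_pt_add_right)
  qed
next
  case (mult u v)
  have closed: "basis_T (\<kappa> u e) e' \<in> carrier T.TG" if "u \<in> carrier T.TG" for u e e'
    using that by (intro basis_T_closed \<kappa>_values)
  have "basis_T (\<kappa> (u \<otimes>\<^bsub>T.TG\<^esub> v) e) e = basis_T (\<kappa> u e) e \<otimes>\<^bsub>T.TG\<^esub> basis_T (\<kappa> v e) e" for e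
    using basis_T_add[OF \<kappa>_values(1)[OF mult(1)] \<kappa>_values(1)[OF mult(2)]] by (simp add: \<kappa>_add[OF mult(1,2)] plus_fun_apply[of "\<kappa> u" "\<kappa> v" e])
  then show ?case
    using T.TG.finprod_multf[of "\<lambda>e. basis_T (\<kappa> u e) e" E "\<lambda>e. basis_T (\<kappa> v e) e",
        OF funcsetI funcsetI, OF closed[OF mult(1)] closed[OF mult(2)]] mult
    by (simp only:)
qed

text \<open>\<open>shear tinv\<close> undoes \<open>shear t\<close>, so \<open>\<Phi>\<close>
  determines the coordinates \<open>\<kappa>\<close>, and these determine the element.\<close>

lemma \<Phi>_injective:
  assumes "u \<in> carrier T.TG" "v \<in> carrier T.TG" "\<Phi> u = \<Phi> v"
  shows "u = v"
proof -
  have "shear tinv (shear t (\<kappa> u)) = shear tinv (shear t (\<kappa> v))" using assms by (simp add: \<Phi>_eq)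
  then have "\<kappa> u = \<kappa> v" using assms by (simp add: shear_tinv_t \<kappa>_values)
  then have "finprod T.TG (\<lambda>e. basis_T (\<kappa> u e) e) E = v"
    using T_expand[OF assms(2)] by (simp only:)
  then show ?thesis unfolding T_expand[OF assms(1)] .
qed

lemma \<Phi>_in_W: "u \<in> carrier T.TG \<Longrightarrow> \<Phi> u \<in> W"
  by (simp add: \<Phi>_eq shear_in_W)

section \<open>Multiplicativity of the embedding\<close>

lemma mulW_\<Phi>0: "mulW (\<Phi>0 x) (\<Phi>0 y) p = F.conv2 tt (F.conv2 (\<lambda>x y. \<iota> (\<alpha> x y)) (F.pull (\<lambda>y. \<iota> (coord p y)))) x y"
proof -
  have \<Phi>0: "\<Phi>0 x = (\<Sum>e\<in>E. fun_scale (t e) (emb (D e x)))" for x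
    by (rule ext) (simp add: \<Phi>0_def F.conv_def sw_def fun_sum_apply fun_scale_def emb_def)
  have sum_left: "mulW (sum f A) w = (\<Sum>e\<in>A. mulW (f e) w)" for f :: "'h \<Rightarrow> 'h \<Rightarrow> 'f" and w A
    by (induction A rule: infinite_finite_induct) (simp_all add: mulW_add_left)
  have sum_right: "mulW v (sum f A) = (\<Sum>e\<in>A. mulW v (f e))" for f :: "'h \<Rightarrow> 'h \<Rightarrow> 'f" and v A
    by (induction A rule: infinite_finite_induct) (simp_all add: mulW_add_right)
  have star: "\<iota> (coord p (star x y)) = F.conv2 (\<lambda>x y. \<iota> (\<alpha> x y)) (F.pull (\<lambda>y. \<iota> (coord p y))) x y" for x y
    by (simp add: F.conv2_def F.pull_def sw_def star_def coord_sum coord_scale ground.hom_sum ground.hom_mult)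
  have "mulW (\<Phi>0 x) (\<Phi>0 y) = (\<Sum>e\<in>E. \<Sum>e'\<in>E. fun_scale (t e) (fun_scale (t e') (emb (star (D e x) (D e' y)))))"
    unfolding \<Phi>0[of x] \<Phi>0[of y] sum_left unfolding sum_right mulW_scale_left mulW_scale_right mulW_emb
    by (simp only: fun_space.scale_scale mult.commute)
  then have "mulW (\<Phi>0 x) (\<Phi>0 y) p = (\<Sum>e\<in>E. \<Sum>e'\<in>E. t e * (t e' * \<iota> (coord p (star (D e x) (D e' y)))))"
    by (simp only: fun_sum_apply fun_scale_def emb_def)
  then show ?thesis unfolding star F.conv2_def[of tt] tt_def sw_def by (simp only: mult.assoc)
qed

text \<open>The left side is coordinate \<open>p\<close> of the image of the product of
  \<open>x\<close> and \<open>y\<close> twisted by \<sigma>. Since \<open>pull\<close> respects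
  convolution, \<open>t\<close> can be separated from the coordinate, and then
  \<open>\<sigma>_pull_t\<close> trades \<sigma> for \<alpha>.\<close>

lemma \<Phi>0_twisted: "F.conv2 \<sigma> (F.pull (F.conv t (\<lambda>y. \<iota> (coord p y)))) x y = mulW (\<Phi>0 x) (\<Phi>0 y) p"
proof -
  let ?c = "\<lambda>y. \<iota> (coord p y)"
  have c: "F.functional ?c" by (rule F.functional_coord)
  have "F.conv2 \<sigma> (F.pull (F.conv t ?c)) = F.conv2 (F.conv2 \<sigma> (F.pull t)) (F.pull ?c)"
    by (simp only: F.conv2_pull[OF functional_t c, symmetric] F.conv2_assoc[OF form_\<sigma> F.form_pull[OF functional_t] F.form_pull[OF c]])
  also have "\<dots> = F.conv2 tt (F.conv2 (\<lambda>x y. \<iota> (\<alpha> x y)) (F.pull ?c))"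
    by (simp only: \<sigma>_pull_t F.conv2_assoc[OF form_tt form_\<iota>\<alpha> F.form_pull[OF c]])
  finally show ?thesis by (simp only: mulW_\<Phi>0)
qed

lemma liftA_mult:
  assumes a: "a \<in> carrier TF.RH.TG" and a': "a' \<in> carrier TF.RH.TG"
  shows "liftA \<Phi>0 (a \<otimes>\<^bsub>TF.A\<^esub> a') = mulW (liftA \<Phi>0 a) (liftA \<Phi>0 a')"
  using a unfolding TF.twisted_mult
proof (induction rule: TF.RH.tensor_induct)
  case (pure b x)
  then have b: "b \<in> B" by simp
  from a' show ?case
  proof (induction rule: TF.RH.tensor_induct)
    case (pure c y)
    then have c: "c \<in> B" by simp
    have "liftA \<Phi>0 (TF.pure_mult b x c y) = (\<Sum>e\<in>E. \<Sum>e'\<in>E. fun_scale (b * c * \<sigma> e e') (\<Phi>0 (D e x * D e' y)))"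
      unfolding liftA_def by (rule TF.tensor_lift_pure_mult[OF B_scalar_balanced[OF \<Phi>0_add \<Phi>0_scale] b c])
    also have "\<dots> = fun_scale (b * c) (mulW (\<Phi>0 x) (\<Phi>0 y))"
    proof
      fix p
      have "(\<Sum>e\<in>E. \<Sum>e'\<in>E. fun_scale (b * c * \<sigma> e e') (\<Phi>0 (D e x * D e' y))) p
          = b * c * F.conv2 \<sigma> (F.pull (F.conv t (\<lambda>y. \<iota> (coord p y)))) x y"
        by (simp only: fun_sum_apply fun_scale_def F.conv2_def F.pull_def sw_def \<Phi>0_def sum_distrib_left mult.assoc)
      then show "(\<Sum>e\<in>E. \<Sum>e'\<in>E. fun_scale (b * c * \<sigma> e e') (\<Phi>0 (D e x * D e' y))) p
          = fun_scale (b * c) (mulW (\<Phi>0 x) (\<Phi>0 y)) p"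
        by (simp only: \<Phi>0_twisted fun_scale_def)
    qed
    also have "\<dots> = mulW (fun_scale b (\<Phi>0 x)) (fun_scale c (\<Phi>0 y))"
      by (simp only: mulW_scale_left mulW_scale_right fun_space.scale_scale mult.commute[of c b])
    finally show ?case using b c by (simp add: TF.mult.lift2_pure liftA_\<Phi>0_pure)
  next
    case (mult a a')
    then show ?case using TF.pt_closed[OF b, of x]
      by (simp only: TF.mult.lift2_mult_right liftA_\<Phi>0_add TF.mult.lift2_closed mulW_add_right)
  qed
next
  case (mult u v)
  then show ?case using a'
    by (simp only: TF.mult.lift2_mult_left liftA_\<Phi>0_add TF.mult.lift2_closed mulW_add_left)
qed

lemma \<Phi>_mult:
  assumes u: "u \<in> carrier T.TG" and v: "v \<in> carrier T.TG"
  shows "\<Phi> (u \<otimes>\<^bsub>TA\<^esub> v) = mulW (\<Phi> u) (\<Phi> v)"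
  using u unfolding T.tensor_algebra_mult
proof (induction rule: T.tensor_induct)
  case (pure z a)
  then have z: "z \<in> Frac" and a: "a \<in> carrier TF.RH.TG" and aA: "a \<in> carrier TF.A" by (simp_all add: TF.twisted_simps(1))
  from v show ?case
  proof (induction rule: T.tensor_induct)
    case (pure z' a')
    then have z': "z' \<in> Frac" and a': "a' \<in> carrier TF.RH.TG" by (simp_all add: TF.twisted_simps(1))
    have aa': "a \<otimes>\<^bsub>TF.A\<^esub> a' \<in> carrier TF.RH.TG"
      using TF.mult.lift2_closed[OF a a'] by (simp only: TF.twisted_mult)
    have "T.mult.lift2 (T.pt z a) (T.pt z' a') = T.pt (z * z') (a \<otimes>\<^bsub>TF.A\<^esub> a')"
      using T.mult.lift2_pure[of z a z' a'] z pure aA by simp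
    then show ?case using z z' a a' aa'
      by (simp only: \<Phi>_pure Frac_mult liftA_mult mulW_scale_left mulW_scale_right fun_space.scale_scale mult.commute[of z' z])
  next
    case (mult v v')
    then show ?case using T_pt_closed[OF z a]
      by (simp only: T.mult.lift2_mult_right \<Phi>_add T.mult.lift2_closed mulW_add_right)
  qed
next
  case (mult u u')
  then show ?case using v
    by (simp only: T.mult.lift2_mult_left \<Phi>_add T.mult.lift2_closed mulW_add_left)
qed

section \<open>Ring laws of the extended algebra\<close>

lemma one_TA: "\<one>\<^bsub>TA\<^esub> = T.pt 1 (TF.RH.pt (tinv 1) 1)"
  by (simp add: one_tensor_algebra TF.twisted_simps(4))

lemma one_closed_TA: "\<one>\<^bsub>TA\<^esub> \<in> carrier T.TG"
  unfolding one_TA by (intro T_pt_closed TF.pt_closed tinv_1_in_B B_subset_Frac B_1)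

text \<open>These tensors act as the scalars \<open>z\<close>, because \<open>tinv 1\<close> cancels
  the factor \<open>t 1\<close> of \<open>\<Phi>0 1\<close>. They give the unit, and they show that
  ideals are closed under scaling by \<open>Frac\<close>.\<close>

lemma \<Phi>_scalar:
  assumes z: "z \<in> Frac"
  shows "\<Phi> (T.pt z (TF.RH.pt (tinv 1) 1)) = fun_scale z (emb 1)"
proof -
  have "fun_scale (tinv 1) (\<Phi>0 1) = emb 1"
  proof
    fix p
    have "\<Phi>0 1 p = t 1 * emb 1 p"
      by (simp add: \<Phi>0_def emb_def F.conv_one[OF functional_t F.functional_coord])
    then show "fun_scale (tinv 1) (\<Phi>0 1) p = emb 1 p"
      using t_1_tinv_1 by (simp add: fun_scale_def mult.assoc[symmetric] mult.commute)
  qed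
  then show ?thesis using z by (simp add: \<Phi>_pure TF.pt_closed liftA_\<Phi>0_pure tinv_1_in_B)
qed

lemma \<Phi>_one: "\<Phi> \<one>\<^bsub>TA\<^esub> = emb 1"
  unfolding one_TA \<Phi>_scalar[OF B_subset_Frac[OF B_1]] by simp

lemma mult_closed_TA: "u \<in> carrier T.TG \<Longrightarrow> v \<in> carrier T.TG \<Longrightarrow> u \<otimes>\<^bsub>TA\<^esub> v \<in> carrier T.TG"
  by (simp only: T.tensor_algebra_mult T.mult.lift2_closed)

text \<open>Associativity and the unit laws are compared after the injective multiplicative map
  \<open>\<Phi>\<close>; distributivity is built into the lifts that define the product.\<close>

lemma ring_TA: "ring TA"
proof (rule ringI)
  show "abelian_group TA"
    by (rule abelian_group_of_comm_group[OF T.comm_group_TG])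
      (simp_all add: carrier_tensor_algebra add_tensor_algebra zero_tensor_algebra)
  show "monoid TA"
  proof (rule monoidI)
    show "u \<otimes>\<^bsub>TA\<^esub> v \<otimes>\<^bsub>TA\<^esub> w = u \<otimes>\<^bsub>TA\<^esub> (v \<otimes>\<^bsub>TA\<^esub> w)"
      if "u \<in> carrier TA" "v \<in> carrier TA" "w \<in> carrier TA" for u v w
      using that unfolding carrier_tensor_algebra
      by (intro \<Phi>_injective mult_closed_TA) (simp_all only: \<Phi>_mult mult_closed_TA mulW_assoc \<Phi>_in_W)
    show "\<one>\<^bsub>TA\<^esub> \<otimes>\<^bsub>TA\<^esub> u = u" if "u \<in> carrier TA" for u
      using that unfolding carrier_tensor_algebra
      by (intro \<Phi>_injective mult_closed_TA one_closed_TA) (simp_all only: \<Phi>_mult one_closed_TA \<Phi>_one mulW_one_left \<Phi>_in_W)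
    show "u \<otimes>\<^bsub>TA\<^esub> \<one>\<^bsub>TA\<^esub> = u" if "u \<in> carrier TA" for u
      using that unfolding carrier_tensor_algebra
      by (intro \<Phi>_injective mult_closed_TA one_closed_TA) (simp_all only: \<Phi>_mult one_closed_TA \<Phi>_one mulW_one_right \<Phi>_in_W)
  qed (simp_all only: carrier_tensor_algebra mult_closed_TA one_closed_TA)
  show "(u \<oplus>\<^bsub>TA\<^esub> v) \<otimes>\<^bsub>TA\<^esub> w = u \<otimes>\<^bsub>TA\<^esub> w \<oplus>\<^bsub>TA\<^esub> v \<otimes>\<^bsub>TA\<^esub> w"
    if "u \<in> carrier TA" "v \<in> carrier TA" "w \<in> carrier TA" for u v w
    using that unfolding carrier_tensor_algebra add_tensor_algebra T.tensor_algebra_mult by (rule T.mult.lift2_mult_left)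
  show "w \<otimes>\<^bsub>TA\<^esub> (u \<oplus>\<^bsub>TA\<^esub> v) = w \<otimes>\<^bsub>TA\<^esub> u \<oplus>\<^bsub>TA\<^esub> w \<otimes>\<^bsub>TA\<^esub> v"
    if "u \<in> carrier TA" "v \<in> carrier TA" "w \<in> carrier TA" for u v w
    using that(3,1,2) unfolding carrier_tensor_algebra add_tensor_algebra T.tensor_algebra_mult by (rule T.mult.lift2_mult_right)
qed

lemma \<Phi>_zero: "\<Phi> \<one>\<^bsub>T.TG\<^esub> = 0"
proof -
  have "\<Phi> \<one>\<^bsub>T.TG\<^esub> = \<Phi> \<one>\<^bsub>T.TG\<^esub> + \<Phi> \<one>\<^bsub>T.TG\<^esub>"
    using \<Phi>_add[OF T.TG.one_closed T.TG.one_closed] unfolding T.TG.r_one[OF T.TG.one_closed] .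
  then show ?thesis by (rule add_cancel_right_right[THEN iffD1])
qed

lemma \<kappa>_eq: assumes u: "u \<in> carrier T.TG" shows "\<kappa> u = shear tinv (\<Phi> u)"
  unfolding \<Phi>_eq[OF u] by (rule shear_tinv_t[OF \<kappa>_values(2)[OF u], symmetric])

text \<open>\<open>\<kappa>\<close> reaches the standard basis of \<open>W\<close>, and
  \<open>shear t\<close> is onto \<open>W\<close>. It lets closure under multiplication by all of
  \<open>W\<close> be tested on values of \<open>\<Phi>\<close>.\<close>

lemma span_\<Phi>: "W \<subseteq> fun_space.span (\<Phi> ` carrier T.TG)"
proof
  have "emb e \<in> \<kappa> ` carrier T.TG" for e
  proof
    have 1: "1 \<in> Frac" by (rule B_subset_Frac[OF B_1])
    show "basis_T 1 e \<in> carrier T.TG" by (rule basis_T_closed[OF 1])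
    show "emb e = \<kappa> (basis_T 1 e)"
      unfolding basis_T_def \<kappa>_pure[OF 1 TF.pt_closed[OF B_1]] liftA_emb_pure[OF B_1] by simp
  qed
  then have "W \<subseteq> fun_space.span (\<kappa> ` carrier T.TG)"
    unfolding span_emb[symmetric] by (intro fun_space.span_mono) blast
  then have "shear t ` W \<subseteq> fun_space.span (shear t ` \<kappa> ` carrier T.TG)"
    unfolding fun_linear_span_image[OF shear_linear, symmetric] by (rule image_mono)
  moreover have "shear t ` \<kappa> ` carrier T.TG = \<Phi> ` carrier T.TG"
    unfolding image_image by (rule image_cong) (simp_all only: \<Phi>_eq)
  ultimately have *: "shear t ` W \<subseteq> fun_space.span (\<Phi> ` carrier T.TG)" by (simp only:)
  fix v assume "v \<in> W"
  then have "v = shear t (shear tinv v)" by (simp only: shear_t_tinv)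
  then have "v \<in> shear t ` W" using shear_in_W by blast
  then show "v \<in> fun_space.span (\<Phi> ` carrier T.TG)" using * by blast
qed

text \<open>The span over \<open>K\<close> of the image of the ideal is an ideal of
  \<open>W\<close>, hence contains the unit. \<open>shear tinv\<close> carries this over to the
  coordinates \<open>\<kappa>\<close>, which have values in \<open>Frac\<close>, so that linear
  descent applies.\<close>

lemma ideal_one:
  assumes I: "ideal I TA" and u: "u \<in> I" "u \<noteq> \<zero>\<^bsub>TA\<^esub>"
  shows "\<one>\<^bsub>TA\<^esub> \<in> I"
proof -
  note subgroup = ideal.axioms(1)[OF I]
  have I_sub: "I \<subseteq> carrier T.TG" using additive_subgroup.a_subset[OF subgroup] by (simp only: carrier_tensor_algebra)
  have I_add: "v \<otimes>\<^bsub>T.TG\<^esub> w \<in> I" if "v \<in> I" "w \<in> I" for v w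
    using additive_subgroup.a_closed[OF subgroup that] by (simp only: add_tensor_algebra)
  have I_zero: "\<one>\<^bsub>T.TG\<^esub> \<in> I"
    using additive_subgroup.zero_closed[OF subgroup] by (simp only: zero_tensor_algebra)
  have I_mult: "v \<otimes>\<^bsub>TA\<^esub> w \<in> I" "w \<otimes>\<^bsub>TA\<^esub> v \<in> I" if "v \<in> carrier T.TG" "w \<in> I" for v w
    using ideal.I_l_closed[OF I, of w v] ideal.I_r_closed[OF I, of w v] that by (simp_all only: carrier_tensor_algebra)
  define Y where "Y = fun_space.span (\<Phi> ` I)"
  have Y_W: "Y \<subseteq> W"
    unfolding Y_def using I_sub \<Phi>_in_W by (intro fun_space.span_minimal subspace_W) blast
  have mult_Y: "mulW v w \<in> Y \<and> mulW w v \<in> Y" if v: "v \<in> W" and w: "w \<in> Y" for v w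
  proof -
    have "v \<in> fun_space.span (\<Phi> ` carrier T.TG)" using v span_\<Phi> by blast
    then show ?thesis
    proof (rule fun_space.span_induct)
      show "fun_space.subspace {v. mulW v w \<in> Y \<and> mulW w v \<in> Y}"
        unfolding fun_space.subspace_def Y_def
        by (auto simp: mulW_add_left mulW_add_right mulW_scale_left mulW_scale_right fun_space.span_zero
            intro: fun_space.span_add fun_space.span_scale)
      fix v assume "v \<in> \<Phi> ` carrier T.TG"
      then obtain a where a: "a \<in> carrier T.TG" "v = \<Phi> a" by blast
      from w show "mulW v w \<in> Y \<and> mulW w v \<in> Y"
        unfolding Y_def
      proof (rule fun_space.span_induct)
        show "fun_space.subspace {w. mulW v w \<in> fun_space.span (\<Phi> ` I) \<and> mulW w v \<in> fun_space.span (\<Phi> ` I)}"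
          unfolding fun_space.subspace_def
          by (auto simp: mulW_add_left mulW_add_right mulW_scale_left mulW_scale_right fun_space.span_zero
              intro: fun_space.span_add fun_space.span_scale)
        fix w assume "w \<in> \<Phi> ` I"
        then obtain b where b: "b \<in> I" "w = \<Phi> b" by blast
        have "mulW v w = \<Phi> (a \<otimes>\<^bsub>TA\<^esub> b)" "mulW w v = \<Phi> (b \<otimes>\<^bsub>TA\<^esub> a)"
          using \<Phi>_mult[OF a(1) subsetD[OF I_sub b(1)]] \<Phi>_mult[OF subsetD[OF I_sub b(1)] a(1)]
          by (simp_all only: a(2) b(2))
        then show "mulW v w \<in> fun_space.span (\<Phi> ` I) \<and> mulW w v \<in> fun_space.span (\<Phi> ` I)"
          using I_mult[OF a(1) b(1)] by (metis fun_space.span_base imageI)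
      qed
    qed
  qed
  have \<Phi>u: "\<Phi> u \<noteq> 0"
  proof
    assume "\<Phi> u = 0"
    then have "u = \<one>\<^bsub>T.TG\<^esub>"
      using u(1) I_sub by (intro \<Phi>_injective) (simp_all only: \<Phi>_zero subsetD T.TG.one_closed)
    then show False using u(2) by (simp only: zero_tensor_algebra simp_thms)
  qed
  have "emb 1 \<in> Y"
  proof (rule W_simple[of Y "\<Phi> u"])
    show "\<Phi> u \<in> Y" unfolding Y_def using u by (intro fun_space.span_base imageI)
    show "fun_space.subspace Y" unfolding Y_def by (rule fun_space.subspace_span)
  qed (use Y_W mult_Y \<Phi>u in blast)+
  moreover have "shear tinv ` Y = fun_space.span (\<kappa> ` I)"
  proof -
    have "shear tinv ` \<Phi> ` I = \<kappa> ` I"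
      unfolding image_image using I_sub by (intro image_cong refl \<kappa>_eq[symmetric]) (rule subsetD)
    then show ?thesis unfolding Y_def fun_linear_span_image[OF shear_linear] by (simp only:)
  qed
  moreover have "shear tinv (emb 1) = \<kappa> \<one>\<^bsub>TA\<^esub>" by (simp only: \<kappa>_eq[OF one_closed_TA] \<Phi>_one)
  ultimately have in_span: "\<kappa> \<one>\<^bsub>TA\<^esub> \<in> fun_space.span (\<kappa> ` I)" by (metis imageI)
  have "\<kappa> \<one>\<^bsub>TA\<^esub> \<in> \<kappa> ` I"
  proof (rule subfield_descent[of Frac])
    show "z - w \<in> Frac" if "z \<in> Frac" "w \<in> Frac" for z w
      using Frac_add[OF that(1) Frac_minus[OF that(2)]] by simp
    show "0 \<in> \<kappa> ` I"
    proof
      show "0 = \<kappa> \<one>\<^bsub>T.TG\<^esub>" unfolding \<kappa>_eq[OF T.TG.one_closed] \<Phi>_zero by (rule shear_0[symmetric])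
    qed (rule I_zero)
    show "v + w \<in> \<kappa> ` I" if vw: "v \<in> \<kappa> ` I" "w \<in> \<kappa> ` I" for v w
    proof -
      obtain a b where ab: "a \<in> I" "b \<in> I" "v = \<kappa> a" "w = \<kappa> b" using vw by (elim imageE)
      have "v + w = \<kappa> (a \<otimes>\<^bsub>T.TG\<^esub> b)"
        unfolding ab(3,4) by (rule \<kappa>_add[symmetric]) (use ab I_sub in blast)+
      then show ?thesis using I_add[OF ab(1,2)] by (metis imageI)
    qed
    show "fun_scale z v \<in> \<kappa> ` I" if z: "z \<in> Frac" and v: "v \<in> \<kappa> ` I" for z v
    proof -
      obtain a where a: "a \<in> I" "v = \<kappa> a" using v by (elim imageE)
      have aT: "a \<in> carrier T.TG" using I_sub a(1) by (rule subsetD)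
      \<comment> \<open>Scaling by \<open>z\<close> is multiplication by this element of the
        algebra, under which the ideal is closed.\<close>
      let ?z = "T.pt z (TF.RH.pt (tinv 1) 1)"
      have zT: "?z \<in> carrier T.TG" by (intro T_pt_closed TF.pt_closed z tinv_1_in_B)
      have "\<kappa> (?z \<otimes>\<^bsub>TA\<^esub> a) = shear tinv (fun_scale z (\<Phi> a))"
        using aT zT by (simp only: \<kappa>_eq mult_closed_TA \<Phi>_mult \<Phi>_scalar[OF z] mulW_scale_left mulW_one_left \<Phi>_in_W)
      also have "\<dots> = fun_scale z v" using a aT by (simp only: shear_scale \<kappa>_eq)
      finally show ?thesis using I_mult(1)[OF zT a(1)] by (metis imageI)
    qed
    show "v x \<in> Frac" if "v \<in> \<kappa> ` I" for v x
      using that I_sub by (elim imageE) (simp only: \<kappa>_values(1) subsetD)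
    show "\<kappa> \<one>\<^bsub>TA\<^esub> x \<in> Frac" for x by (rule \<kappa>_values(1)[OF one_closed_TA])
  qed (fact Frac_mult Frac_divide Frac_minus in_span)+
  then obtain a where a: "a \<in> I" "\<kappa> \<one>\<^bsub>TA\<^esub> = \<kappa> a" by (elim imageE)
  have aT: "a \<in> carrier T.TG" using I_sub a(1) by (rule subsetD)
  have "\<one>\<^bsub>TA\<^esub> = a"
    by (rule \<Phi>_injective[OF one_closed_TA aT]) (simp only: \<Phi>_eq[OF one_closed_TA] \<Phi>_eq[OF aT] a(2))
  then show ?thesis using a(1) by (simp only:)
qed

lemma simple_TA: "simple_algebra TA"
  unfolding simple_algebra_def
proof (intro conjI allI impI)
  show "ring TA" by (rule ring_TA)
  have "\<one>\<^bsub>TA\<^esub> \<noteq> \<zero>\<^bsub>TA\<^esub>"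
  proof
    assume "\<one>\<^bsub>TA\<^esub> = \<zero>\<^bsub>TA\<^esub>"
    then have "emb 1 = 0" using \<Phi>_one \<Phi>_zero by (simp only: zero_tensor_algebra)
    \<comment> \<open>A zero vector has all residues 0, while the residues of \<open>emb 1\<close>
      are the coordinates of 1.\<close>
    then have "coord e 1 = 0" for e
      using place_emb[of 1 e] by (intro F.P_unique[OF _ F.P_0]) (simp add: zero_fun_apply)
    then have "(1::'h) = 0" using coord_expand[of 1] by simp
    then show False by simp
  qed
  then show "carrier TA \<noteq> {\<zero>\<^bsub>TA\<^esub>}" using one_closed_TA by (auto simp: carrier_tensor_algebra)
  fix I assume I: "ideal I TA"
  show "I = {\<zero>\<^bsub>TA\<^esub>} \<or> I = carrier TA"
  proof (cases "\<exists>u\<in>I. u \<noteq> \<zero>\<^bsub>TA\<^esub>")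
    case True
    then have "\<one>\<^bsub>TA\<^esub> \<in> I" using ideal_one[OF I] by blast
    then show ?thesis using ideal.one_imp_carrier[OF I] by blast
  next
    case False
    moreover have "\<zero>\<^bsub>TA\<^esub> \<in> I"
      using additive_subgroup.zero_closed[OF ideal.axioms(1)[OF I]] .
    ultimately show ?thesis by blast
  qed
qed

end

theorem corollary6p5:
  fixes scale :: "'k::field_char_0 \<Rightarrow> 'h::ring_1 \<Rightarrow> 'h"
    and \<Delta> :: "'h \<Rightarrow> 'h tensor_square"
    and \<epsilon> :: "'h \<Rightarrow> 'k"
    and antipode :: "'h \<Rightarrow> 'h"
    and \<alpha> :: "'h \<Rightarrow> 'h \<Rightarrow> 'k"
    and j :: "('h, 'k) free_comm_algebra set \<Rightarrow> 'f::field"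
  assumes "hopf_algebra scale \<Delta> \<epsilon> antipode"
    and "finite_dimensional scale"
    and "two_cocycle scale \<Delta> \<alpha>"
    and "normalized \<epsilon> \<alpha>"
    and "convolution_invertible scale \<Delta> \<epsilon> \<alpha>"
    and "is_fraction_field (symmetric_algebra scale) j"
    and "simple_algebra (twisted_hopf_algebra scale \<Delta> \<alpha>)"
  shows "simple_algebra
    (tensor_algebra (B_algebra scale \<Delta> \<epsilon> \<alpha> j) (frac_B scale \<Delta> \<epsilon> \<alpha> j) (A_algebra scale \<Delta> \<epsilon> \<alpha> j))"
proof -
  interpret H: hopf_algebra scale \<Delta> \<epsilon> antipode by fact
  obtain S where S: "finite S" "H.span S = UNIV"
    using assms(2) unfolding finite_dimensional_def by blast
  obtain E where E: "H.independent E" "H.span E = UNIV"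
    using H.basis_exists[of UNIV] by (metis top.extremum_uniqueI)
  have fin: "finite E"
    using H.independent_span_bound[OF S(1) E(1)] S(2) by simp
  have hopf: "finite_hopf_algebra scale \<Delta> \<epsilon> antipode E"
    using assms(1) E fin by (simp add: finite_hopf_algebra_def finite_hopf_algebra_axioms_def)
  have frac: "symmetric_fraction_field scale j"
    using assms(6) H.vector_space_axioms
    by (simp add: symmetric_fraction_field_def symmetric_fraction_field_axioms_def)
  interpret universal_twist_simple scale \<Delta> \<epsilon> antipode E j \<alpha>
    using hopf frac assms(3-5,7)
    by (simp add: universal_twist_simple_def universal_twist_simple_axioms_def universal_twist_def
        universal_twist_axioms_def two_cocycle_def)
  show ?thesis unfolding algebra_eqs by (rule simple_TA)
qed

end
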